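(* Let $F$ be a probability distribution on $\mathbb R$ with density $f$ and, for $X\sim F$, $EX=0$ and $\sigma^2:=EX^2<\infty$. Let $X,Y$ be iid $\sim F$, $\Lambda(t)=\ln Ee^{tX}$, $\mathcal D_\Lambda=\{t:\Lambda(t)<\infty\}$, and let $g(t)=\int f(x)f(x+t)\,dx$ be the density of $X-Y$. Suppose: a) $0$ lies in the interior of $\mathcal D_\Lambda$ and $\Lambda(t)\to\infty$ as $t\uparrow\sup\mathcal D_\Lambda$. b) $g$ is continuous and bounded on $(\epsilon,\infty)$ for any $\epsilon>0$, and there exist a constant $\lambda>-1$ and a function $\zeta(z)\ge0$, increasing in $z\ge0$ and slowly varying at $\infty$, such that $$\lim_{x\downarrow0}\frac{g(x)}{x^\lambda\zeta(1/x)}=C\in(0,\infty).$$ Fix $\alpha\in(0,1)$ and $\pi\in(0,1)$ with $Q_{\alpha,\pi}:=\frac{(1-\alpha)(1-\pi)}{\alpha\pi}>1$. For $d>0$ and $N=m+n$, let $$\alpha_*=(1-\pi)\left[1-\pi+\pi\,\frac{P(\bar X_n+d\ge z_NS_m)}{P(\bar X_n\ge z_NS_m)}\right]^{-1},$$ and let $N_*=N_*(d)$ be the minimum value of $N=m+n$ in order to attain $\alpha_*\le\alpha$. Then, under the constraints that 1) $m$ and $n$ grow in proportion to each other such that $m/N\to\rho\in(0,1)$ as $m,n\to\infty$, and 2) $z_N\to\infty$ slowly enough, one gets $$N_*\sim\frac1d\times\frac{\ln Q_{\alpha,\pi}}{(1-\rho)t_0}\qquad\text{as }d\to0+,$$ where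 $t_0>0$ is the unique positive solution to $$t\Lambda'(t)=\frac{(1+\lambda)\rho}{1-\rho}.$$
   Context: $X_1,X_2,\dots,Y_1,Y_2,\dots$ are iid $\sim F$, $$\bar X_n=\frac1n\sum_{k=1}^nX_k,\qquad S_m=\Big(\frac1{2m}\sum_{k=1}^m(Y_{2k-1}-Y_{2k})^2\Big)^{1/2}.$$ For each $N$, $m=m_N$ and $n=n_N$ are positive integers with $m+n=N$. The quantity $\alpha_*$ is the minimum attainable positive false discovery rate, under a random effects model with proportion $\pi$ of false nulls, of the test that rejects a null (zero mean, against mean shift $d$ in the scale of $F$) iff the $t$-type statistic $\sqrt n\,\hat\mu/\hat\sigma$ is at least $z_N\sqrt n$. A function $\zeta$ is slowly varying at $\infty$ if $\lim_{x\to\infty}\zeta(tx)/\zeta(x)=1$ for all $t>0$. "$z_N\to\infty$ slowly enough" means: there is a sequence $\bar z_N\to\infty$ such that the conclusion holds for every sequence $z_N\to\infty$ with $z_N\le\bar z_N$ for all $N$. *)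

theory Defs
  imports "HOL-Probability.Probability" "HOL-Library.Landau_Symbols"
begin

definition cgf_dom :: "real measure \<Rightarrow> real set" where
  "cgf_dom F = {t. integrable F (\<lambda>x. exp (t * x))}"

text \<open>The logarithm of the moment generating function. It is real-valued here, hence meaningful
  only on \<open>cgf_dom F\<close>, the set where the extended-valued function is finite.\<close>

definition cgf :: "real measure \<Rightarrow> real \<Rightarrow> real" where
  "cgf F t = ln (LINT x|F. exp (t * x))"

text \<open>\<open>t\<close> increases to \<open>sup cgf_dom F\<close>, which may be finite or infinite; the supremum is therefore
  taken in the extended reals and the left neighbourhood filter is pulled back to the reals.\<close>

definition at_sup_cgf_dom :: "real measure \<Rightarrow> real filter" where
  "at_sup_cgf_dom F = filtercomap ereal (at_left (SUP t\<in>cgf_dom F. ereal t))"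

text \<open>For a density \<open>f\<close>, this is the density of the difference of two independent variables
  (it depends on \<open>f\<close> only up to null sets).\<close>

definition diff_density :: "(real \<Rightarrow> real) \<Rightarrow> real \<Rightarrow> real" where
  "diff_density f t = (LINT x|lborel. f x * f (x + t))"

definition slowly_varying :: "(real \<Rightarrow> real) \<Rightarrow> bool" where
  "slowly_varying \<zeta> \<longleftrightarrow> (\<forall>t>0. ((\<lambda>x. \<zeta> (t * x) / \<zeta> x) \<longlongrightarrow> 1) at_top)"

text \<open>All variables \<open>X 1, X 2, \<dots>, Y 1, Y 2, \<dots>\<close> are jointly independent with common law \<open>F\<close>;
  \<open>X 0\<close> and \<open>Y 0\<close> are never used.\<close>

definition iid_samples ::
  "'a measure \<Rightarrow> real measure \<Rightarrow> (nat \<Rightarrow> 'a \<Rightarrow> real) \<Rightarrow> (nat \<Rightarrow> 'a \<Rightarrow> real) \<Rightarrow> bool" where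
  "iid_samples M F X Y \<longleftrightarrow>
     prob_space.indep_vars M (\<lambda>_. borel) (case_sum X Y) ({1..} <+> {1..}) \<and>
     (\<forall>k\<ge>1. distr M borel (X k) = F \<and> distr M borel (Y k) = F)"

definition sample_mean :: "(nat \<Rightarrow> 'a \<Rightarrow> real) \<Rightarrow> nat \<Rightarrow> 'a \<Rightarrow> real" where
  "sample_mean X n \<omega> = (1 / real n) * (\<Sum>k=1..n. X k \<omega>)"

definition pair_sd :: "(nat \<Rightarrow> 'a \<Rightarrow> real) \<Rightarrow> nat \<Rightarrow> 'a \<Rightarrow> real" where
  "pair_sd Y m \<omega> =
     sqrt (1 / (2 * real m) * (\<Sum>k=1..m. (Y (2 * k - 1) \<omega> - Y (2 * k) \<omega>)\<^sup>2))"

definition rejection_prob ::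
  "'a measure \<Rightarrow> (nat \<Rightarrow> 'a \<Rightarrow> real) \<Rightarrow> (nat \<Rightarrow> 'a \<Rightarrow> real) \<Rightarrow> nat \<Rightarrow> nat \<Rightarrow> real \<Rightarrow> real \<Rightarrow> real" where
  "rejection_prob M X Y m n z d =
     measure M {\<omega> \<in> space M. sample_mean X n \<omega> + d \<ge> z * pair_sd Y m \<omega>}"

definition alpha_star ::
  "'a measure \<Rightarrow> (nat \<Rightarrow> 'a \<Rightarrow> real) \<Rightarrow> (nat \<Rightarrow> 'a \<Rightarrow> real) \<Rightarrow> real \<Rightarrow> nat \<Rightarrow> nat \<Rightarrow> real \<Rightarrow> real \<Rightarrow> real" where
  "alpha_star M X Y p m n z d =
     (1 - p) * inverse (1 - p + p * (rejection_prob M X Y m n z d / rejection_prob M X Y m n z 0))"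

text \<open>As \<open>m\<close> and \<open>n\<close> are positive, only \<open>N \<ge> 2\<close> is admissible. If no \<open>N\<close> attains the level, the
  infimum is \<open>0\<close>, which cannot be confused with an attained minimum.\<close>

definition N_star ::
  "'a measure \<Rightarrow> (nat \<Rightarrow> 'a \<Rightarrow> real) \<Rightarrow> (nat \<Rightarrow> 'a \<Rightarrow> real) \<Rightarrow> real \<Rightarrow> real \<Rightarrow>
     (nat \<Rightarrow> nat) \<Rightarrow> (nat \<Rightarrow> nat) \<Rightarrow> (nat \<Rightarrow> real) \<Rightarrow> real \<Rightarrow> nat" where
  "N_star M X Y \<alpha> p m n z d = Inf {N. N \<ge> 2 \<and> alpha_star M X Y p (m N) (n N) (z N) d \<le> \<alpha>}"

end

theory Submission
  imports Defs "HOL-Real_Asymp.Real_Asymp"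
begin

text \<open>Put \<open>W k = (Y (2 k - 1) - Y (2 k))\<^sup>2 / 2\<close>. Since the density of \<open>Y - Y'\<close> varies regularly with index \<open>lam\<close> at \<open>0\<close>,
  the Laplace transform of \<open>W\<close> varies regularly with index \<open>- (1 + lam) / 2\<close> at infinity, and exponential
  tilting gives \<open>P (z S_m \<le> x) \<propto> x powr ((1 + lam) m)\<close> up to a factor \<open>exp (o m)\<close>, whatever the speed at which
  \<open>z\<close> tends to infinity. Hence, given a rejection, \<open>z S_m\<close> concentrates where \<open>(1 + lam) \<rho> / (1 - \<rho>) * ln x - \<Lambda>* x\<close>
  is maximal, at \<open>x0 = \<Lambda>' t0\<close>, and a shift of \<open>X_1 + \<dots> + X_n\<close> by the constant \<open>a = n d\<close> multiplies the rejection
  probability by the ratio of \<open>P (X_1 + \<dots> + X_n \<ge> y - a)\<close> and \<open>P (X_1 + \<dots> + X_n \<ge> y)\<close> for \<open>y\<close> near \<open>n x0\<close>.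

  That ratio tends to \<open>exp (t0 a)\<close>, with no local limit theorem needed: for \<open>u x = min 1 (f (x + h) / f x)\<close> and
  \<open>v x = min 1 (f (x - h) / f x)\<close>, translating one summand by \<open>h\<close> gives
  \<open>E [S + h \<ge> y; \<Sum>k. u (X k)] = E [S \<ge> y; \<Sum>k. v (X k)]\<close>, and under the tilted law the two sums are
  \<open>n q\<close> and \<open>n q exp (t0 h)\<close> up to exponentially small probabilities. Here \<open>q > 0\<close> as soon as the density of
  \<open>Y - Y'\<close> is positive at \<open>h\<close>, and \<open>a\<close> is a multiple of such an \<open>h\<close>.\<close>

section \<open>Cumulant generating functions\<close>

text \<open>The rejection probability is exponentially small and its exponent is controlled only up
  to o(n), whereas the ratio sought has a finite limit. The two scales are kept apart: large
  deviation estimates serve only to discard events whose probability is o(\<open>rej 0 N\<close>),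
  and the limiting factor comes from an exact identity, so no prefactor is ever computed. Likewise
  regular variation determines only quotients of Laplace transforms, so bounds for \<open>T\<close>
  carry the common factor \<open>L (tilt N) ^ m N\<close>, which cancels against the lower bound for
  \<open>rej 0 N\<close>. Since \<open>T\<close> is unbounded, a finite partition of its range has
  to be completed by a bound that is uniform over dyadic scales. Finally, the limit is available for
  a = n d held fixed while N grows, and monotonicity in N of the ratio of rejection probabilities is
  not at hand; the passage to the first N that attains the level rests on monotonicity in d, and on
  right continuity at d = 0 to exclude each fixed N.\<close>

lemma abs_exp_minus_one_le:
  fixes y :: real
  shows "\<bar>exp y - 1\<bar> \<le> \<bar>y\<bar> * exp \<bar>y\<bar>"
proof (cases "y \<ge> 0")
  case True
  have "1 - y \<le> exp (- y)" using exp_ge_add_one_self[of "-y"] by simp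
  then have "(1 - y) * exp y \<le> exp (- y) * exp y" by (intro mult_right_mono) auto
  then show ?thesis using True by (simp add: algebra_simps flip: exp_add)
next
  case False
  have "1 + y \<le> exp y" by (rule exp_ge_add_one_self)
  moreover have "\<bar>y\<bar> * 1 \<le> \<bar>y\<bar> * exp \<bar>y\<bar>" by (intro mult_left_mono) auto
  moreover have "exp y \<le> 1" using False by simp
  ultimately show ?thesis using False by linarith
qed

section \<open>Exponential moments, convexity of the cumulant generating function, the saddle
  point\<close>

context real_distribution
begin

lemma integrable_exp_between:
  fixes \<phi> :: "real \<Rightarrow> real"
  assumes [measurable]: "\<phi> \<in> borel_measurable borel"
    and "integrable M (\<lambda>x. \<phi> x * exp (s * x))" "integrable M (\<lambda>x. \<phi> x * exp (u * x))" "s \<le> t" "t \<le> u"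
  shows "integrable M (\<lambda>x. \<phi> x * exp (t * x))"
proof (rule Bochner_Integration.integrable_bound)
  show "integrable M (\<lambda>x. \<bar>\<phi> x * exp (s * x)\<bar> + \<bar>\<phi> x * exp (u * x)\<bar>)"
    using assms by auto
  have "norm (\<phi> x * exp (t * x)) \<le> norm (\<bar>\<phi> x * exp (s * x)\<bar> + \<bar>\<phi> x * exp (u * x)\<bar>)" for x
  proof -
    have "exp (t * x) \<le> exp (s * x) + exp (u * x)"
    proof (cases "x \<ge> 0")
      case True
      then have "exp (t * x) \<le> exp (u * x)" using assms by (simp add: mult_right_mono)
      then show ?thesis by (smt (verit) exp_ge_zero)
    next
      case False
      then have "exp (t * x) \<le> exp (s * x)" using assms by (simp add: mult_right_mono_neg)
      then show ?thesis by (smt (verit) exp_ge_zero)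
    qed
    then have "\<bar>\<phi> x\<bar> * exp (t * x) \<le> \<bar>\<phi> x\<bar> * (exp (s * x) + exp (u * x))"
      by (intro mult_left_mono) auto
    then show ?thesis by (simp add: abs_mult algebra_simps)
  qed
  then show "AE x in M. norm (\<phi> x * exp (t * x)) \<le> norm (\<bar>\<phi> x * exp (s * x)\<bar> + \<bar>\<phi> x * exp (u * x)\<bar>)"
    by simp
qed simp

text \<open>Differentiation under the integral by dominated convergence. The weight
  \<open>\<phi>\<close> allows two applications: with \<open>\<phi> = 1\<close> for the moment
  generating function, and with \<open>\<phi> x = x\<close> for its derivative.\<close>

lemma has_derivative_exp_moment:
  fixes \<phi> :: "real \<Rightarrow> real"
  assumes [measurable]: "\<phi> \<in> borel_measurable borel"
    and int: "\<And>s. s \<in> {a<..<b} \<Longrightarrow> integrable M (\<lambda>x. \<phi> x * exp (s * x))" and t: "t \<in> {a<..<b}"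
  shows "integrable M (\<lambda>x. \<phi> x * x * exp (t * x))" (is ?I)
    and "((\<lambda>s. LINT x|M. \<phi> x * exp (s * x)) has_real_derivative (LINT x|M. \<phi> x * x * exp (t * x))) (at t)" (is ?D)
proof -
  \<comment> \<open>A quarter of the distance to the boundary keeps t - 2\<eta> and t + 2\<eta>
    inside the interval. One factor exp (\<eta>|x|) pays for the difference quotient and a second
    one for |x|, since |x| \<le> exp (\<eta>|x|) / \<eta>; this is the bound
    \<open>w\<close>.\<close>
  define \<eta> where "\<eta> = min (t - a) (b - t) / 4"
  have \<eta>: "\<eta> > 0" "t + 2 * \<eta> \<in> {a<..<b}" "t - 2 * \<eta> \<in> {a<..<b}" using t by (auto simp: \<eta>_def min_def field_simps)
  define w where "w x = (\<bar>\<phi> x * exp ((t + 2 * \<eta>) * x)\<bar> + \<bar>\<phi> x * exp ((t - 2 * \<eta>) * x)\<bar>) / \<eta>" for x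
  have w: "integrable M w" unfolding w_def using int[OF \<eta>(2)] int[OF \<eta>(3)] by auto
  have key: "\<bar>\<phi> x\<bar> * exp (t * x) * (\<bar>x\<bar> * exp (\<eta> * \<bar>x\<bar>)) \<le> w x" for x
  proof -
    have "\<eta> * \<bar>x\<bar> \<le> exp (\<eta> * \<bar>x\<bar>)" using exp_ge_add_one_self[of "\<eta> * \<bar>x\<bar>"] by linarith
    then have 1: "\<bar>x\<bar> \<le> exp (\<eta> * \<bar>x\<bar>) / \<eta>" using \<eta> by (simp add: field_simps)
    have "\<bar>x\<bar> * exp (\<eta> * \<bar>x\<bar>) \<le> exp (\<eta> * \<bar>x\<bar>) / \<eta> * exp (\<eta> * \<bar>x\<bar>)"
      using 1 by (intro mult_right_mono) auto
    also have "\<dots> = exp (2 * \<eta> * \<bar>x\<bar>) / \<eta>" by (simp flip: exp_add add: algebra_simps)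
    also have "\<dots> \<le> (exp (2 * \<eta> * x) + exp (- 2 * \<eta> * x)) / \<eta>"
      using \<eta> by (intro divide_right_mono) (auto simp: abs_if)
    finally have "\<bar>\<phi> x\<bar> * exp (t * x) * (\<bar>x\<bar> * exp (\<eta> * \<bar>x\<bar>))
        \<le> \<bar>\<phi> x\<bar> * exp (t * x) * ((exp (2 * \<eta> * x) + exp (- 2 * \<eta> * x)) / \<eta>)"
      by (intro mult_left_mono) auto
    also have "\<dots> = w x" unfolding w_def
      by (simp add: abs_mult algebra_simps exp_add exp_diff exp_minus divide_simps)
    finally show ?thesis .
  qed
  have key0: "\<bar>\<phi> x * x * exp (t * x)\<bar> \<le> w x" for x
  proof -
    have "\<bar>\<phi> x\<bar> * exp (t * x) * (\<bar>x\<bar> * 1) \<le> \<bar>\<phi> x\<bar> * exp (t * x) * (\<bar>x\<bar> * exp (\<eta> * \<bar>x\<bar>))"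
      using \<eta> by (intro mult_left_mono) auto
    then show ?thesis using key[of x] by (simp add: abs_mult algebra_simps)
  qed
  show ?I
    by (rule Bochner_Integration.integrable_bound[OF w])
      (use order_trans[OF key0 abs_ge_self] in auto)
  have "(\<lambda>n. ((LINT x|M. \<phi> x * exp ((t + S n) * x)) - (LINT x|M. \<phi> x * exp (t * x))) / S n)
      \<longlonglongrightarrow> (LINT x|M. \<phi> x * x * exp (t * x))"
    if S: "\<And>n. S n \<noteq> 0" "S \<longlonglongrightarrow> 0" for S :: "nat \<Rightarrow> real"
  proof -
    \<comment> \<open>The domination holds only for increments below \<open>\<eta>\<close>, so the
      sequence is restarted late enough.\<close>
    have "eventually (\<lambda>n. dist (S n) 0 < \<eta>) sequentially" using S(2) \<eta>(1) by (rule tendstoD)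
    then obtain K where K: "\<And>n. n \<ge> K \<Longrightarrow> \<bar>S n\<bar> < \<eta>" by (auto simp: eventually_sequentially)
    define R where "R n = S (n + K)" for n
    have R: "\<And>n. R n \<noteq> 0" "R \<longlonglongrightarrow> 0" "\<And>n. \<bar>R n\<bar> < \<eta>"
      using S K LIMSEQ_ignore_initial_segment[OF S(2), of K] by (auto simp: R_def[abs_def])
    have "(\<lambda>n. LINT x|M. \<phi> x * exp (t * x) * ((exp (R n * x) - 1) / R n)) \<longlonglongrightarrow> (LINT x|M. \<phi> x * x * exp (t * x))"
    proof (rule integral_dominated_convergence[OF _ _ w])
      show "AE x in M. (\<lambda>n. \<phi> x * exp (t * x) * ((exp (R n * x) - 1) / R n)) \<longlonglongrightarrow> \<phi> x * x * exp (t * x)"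
      proof (rule AE_I2)
        fix x
        have "((\<lambda>s. exp (s * x)) has_real_derivative x) (at 0)"
          by (auto intro!: derivative_eq_intros)
        then have "((\<lambda>s. (exp (s * x) - 1) / s) \<longlongrightarrow> x) (at 0)"
          by (simp add: DERIV_def)
        then have "(\<lambda>n. (exp (R n * x) - 1) / R n) \<longlonglongrightarrow> x"
          using R by (auto simp: tendsto_at_iff_sequentially comp_def)
        then have "(\<lambda>n. \<phi> x * exp (t * x) * ((exp (R n * x) - 1) / R n)) \<longlonglongrightarrow> \<phi> x * exp (t * x) * x"
          by (intro tendsto_intros)
        then show "(\<lambda>n. \<phi> x * exp (t * x) * ((exp (R n * x) - 1) / R n)) \<longlonglongrightarrow> \<phi> x * x * exp (t * x)"
          by (simp add: algebra_simps)
      qed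
      fix n
      have "norm (\<phi> x * exp (t * x) * ((exp (R n * x) - 1) / R n)) \<le> w x" for x
      proof -
        have "\<bar>exp (R n * x) - 1\<bar> \<le> \<bar>R n * x\<bar> * exp \<bar>R n * x\<bar>" by (rule abs_exp_minus_one_le)
        also have "\<dots> \<le> \<bar>R n * x\<bar> * exp (\<eta> * \<bar>x\<bar>)"
          using R(3)[of n] by (intro mult_left_mono) (auto simp: abs_mult intro!: mult_right_mono)
        finally have "\<bar>exp (R n * x) - 1\<bar> / \<bar>R n\<bar> \<le> \<bar>x\<bar> * exp (\<eta> * \<bar>x\<bar>)"
          using R(1)[of n] by (simp add: abs_mult field_simps)
        then have "\<bar>\<phi> x\<bar> * exp (t * x) * (\<bar>exp (R n * x) - 1\<bar> / \<bar>R n\<bar>) \<le> \<bar>\<phi> x\<bar> * exp (t * x) * (\<bar>x\<bar> * exp (\<eta> * \<bar>x\<bar>))"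
          by (intro mult_left_mono) auto
        then show ?thesis using key[of x] by (simp add: abs_mult)
      qed
      then show "AE x in M. norm (\<phi> x * exp (t * x) * ((exp (R n * x) - 1) / R n)) \<le> w x" by simp
    qed simp_all
    moreover have "(LINT x|M. \<phi> x * exp (t * x) * ((exp (R n * x) - 1) / R n))
        = ((LINT x|M. \<phi> x * exp ((t + R n) * x)) - (LINT x|M. \<phi> x * exp (t * x))) / R n" for n
    proof -
      have "t + R n \<in> {a<..<b}" using R(3)[of n] \<eta> by auto
      then have "(LINT x|M. \<phi> x * exp ((t + R n) * x)) - (LINT x|M. \<phi> x * exp (t * x))
          = (LINT x|M. \<phi> x * exp ((t + R n) * x) - \<phi> x * exp (t * x))"
        using int t by (subst Bochner_Integration.integral_diff) auto
      also have "\<dots> / R n = (LINT x|M. (\<phi> x * exp ((t + R n) * x) - \<phi> x * exp (t * x)) / R n)" by simp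
      also have "\<dots> = (LINT x|M. \<phi> x * exp (t * x) * ((exp (R n * x) - 1) / R n))"
        by (intro Bochner_Integration.integral_cong) (auto simp: algebra_simps exp_add diff_divide_distrib)
      finally show ?thesis ..
    qed
    ultimately have "(\<lambda>n. ((LINT x|M. \<phi> x * exp ((t + R n) * x)) - (LINT x|M. \<phi> x * exp (t * x))) / R n)
        \<longlonglongrightarrow> (LINT x|M. \<phi> x * x * exp (t * x))" by (simp only:)
    then show ?thesis unfolding R_def by (rule LIMSEQ_offset)
  qed
  then show ?D
    unfolding DERIV_def tendsto_at_iff_sequentially by (auto simp: comp_def)
qed

lemma zero_in_cgf_dom: "0 \<in> cgf_dom M"
  by (simp add: cgf_dom_def)

lemma cgf_zero: "cgf M 0 = 0"
  using prob_space by (simp add: cgf_def)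

lemma cgf_dom_between: "s \<in> cgf_dom M \<Longrightarrow> u \<in> cgf_dom M \<Longrightarrow> s \<le> t \<Longrightarrow> t \<le> u \<Longrightarrow> t \<in> cgf_dom M"
  using integrable_exp_between[of "\<lambda>_. 1" s u t] by (simp add: cgf_dom_def)

lemma interior_cgf_dom_between:
  assumes "s \<in> interior (cgf_dom M)" "u \<in> interior (cgf_dom M)" "s \<le> t" "t \<le> u"
  shows "t \<in> interior (cgf_dom M)"
proof -
  have "is_interval (cgf_dom M)"
    unfolding is_interval_1 using cgf_dom_between by blast
  then have "is_interval (interior (cgf_dom M))"
    by (simp add: convex_interior is_interval_convex_1)
  then show ?thesis using assms unfolding is_interval_1 by blast
qed

lemma interior_cgf_dom_box:
  assumes "t \<in> interior (cgf_dom M)"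
  obtains a b where "t \<in> {a<..<b}" "{a<..<b} \<subseteq> interior (cgf_dom M)"
proof -
  obtain e where "e > 0" "ball t e \<subseteq> interior (cgf_dom M)"
    using assms open_interior open_contains_ball by blast
  then show ?thesis by (intro that[of "t - e" "t + e"]) (auto simp: ball_eq_greaterThanLessThan)
qed

lemma exp_moment_pos:
  assumes "t \<in> cgf_dom M"
  shows "0 < (LINT x|M. exp (t * x))"
proof -
  have "(LINT x|M. 0) < (LINT x|M. exp (t * x))"
    by (rule integral_less_AE_space) (use assms emeasure_space_1 in \<open>auto simp: cgf_dom_def\<close>)
  then show ?thesis by simp
qed

lemma exp_cgf: "t \<in> cgf_dom M \<Longrightarrow> exp (cgf M t) = (LINT x|M. exp (t * x))"
  using exp_moment_pos[of t] by (simp add: cgf_def)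

lemma
  assumes t: "t \<in> interior (cgf_dom M)"
  shows integrable_moment_exp: "integrable M (\<lambda>x. x * exp (t * x))"
    and cgf_has_derivative:
      "(cgf M has_real_derivative (LINT x|M. x * exp (t * x)) / (LINT x|M. exp (t * x))) (at t)"
    and cgf_deriv_continuous: "isCont (deriv (cgf M)) t"
proof -
  obtain a b where ab: "t \<in> {a<..<b}" "{a<..<b} \<subseteq> interior (cgf_dom M)"
    using interior_cgf_dom_box[OF t] .
  have int: "integrable M (\<lambda>x. 1 * exp (s * x))" if "s \<in> {a<..<b}" for s
    using ab that interior_subset[of "cgf_dom M"] by (auto simp: cgf_dom_def)
  have intx: "integrable M (\<lambda>x. x * exp (s * x))"
    and D1: "((\<lambda>s. LINT x|M. exp (s * x)) has_real_derivative (LINT x|M. x * exp (s * x))) (at s)"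
    if "s \<in> {a<..<b}" for s
    using has_derivative_exp_moment[of "\<lambda>_. 1" a b s] int that by auto
  have pos: "0 < (LINT x|M. exp (s * x))" if "s \<in> {a<..<b}" for s
    using ab that interior_subset[of "cgf_dom M"] by (intro exp_moment_pos) auto
  have D: "(cgf M has_real_derivative (LINT x|M. x * exp (s * x)) / (LINT x|M. exp (s * x))) (at s)"
    if "s \<in> {a<..<b}" for s
    unfolding cgf_def[abs_def] by (rule DERIV_cong[OF DERIV_chain2[OF DERIV_ln_divide[OF pos[OF that]] D1[OF that]]]) simp
  show "integrable M (\<lambda>x. x * exp (t * x))"
    "(cgf M has_real_derivative (LINT x|M. x * exp (t * x)) / (LINT x|M. exp (t * x))) (at t)"
    using intx D ab by auto
  \<comment> \<open>The second application, with weight \<open>x\<close>: the numerator of the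
    formula for the derivative is itself differentiable, hence continuous.\<close>
  have D2: "((\<lambda>s. LINT x|M. x * exp (s * x)) has_real_derivative (LINT x|M. x * x * exp (t * x))) (at t)"
    by (rule has_derivative_exp_moment(2)[of "\<lambda>x. x" a b t]) (use intx ab in auto)
  have "isCont (\<lambda>s. (LINT x|M. x * exp (s * x)) / (LINT x|M. exp (s * x))) t"
    using DERIV_isCont[OF D2] DERIV_isCont[OF D1[OF ab(1)]] pos[OF ab(1)] by auto
  moreover have "eventually (\<lambda>s. s \<in> {a<..<b}) (nhds t)"
    using ab(1) by (intro eventually_nhds_in_open) auto
  then have "eventually (\<lambda>s. deriv (cgf M) s = (LINT x|M. x * exp (s * x)) / (LINT x|M. exp (s * x))) (nhds t)"
    by eventually_elim (use D in \<open>auto intro: DERIV_imp_deriv\<close>)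
  ultimately show "isCont (deriv (cgf M)) t"
    by (subst isCont_cong) auto
qed

lemma cgf_deriv:
  assumes "t \<in> interior (cgf_dom M)"
  shows "deriv (cgf M) t = (LINT x|M. x * exp (t * x)) / (LINT x|M. exp (t * x))"
    and "(cgf M has_real_derivative deriv (cgf M) t) (at t)"
proof -
  show "deriv (cgf M) t = (LINT x|M. x * exp (t * x)) / (LINT x|M. exp (t * x))"
    by (rule DERIV_imp_deriv[OF cgf_has_derivative[OF assms]])
  then show "(cgf M has_real_derivative deriv (cgf M) t) (at t)"
    using cgf_has_derivative[OF assms] by metis
qed

text \<open>Centring at \<open>y = deriv (cgf M) s\<close>, the function \<open>t \<mapsto> (x - y) * exp (t * (x - y))\<close> is increasing for
  every \<open>x\<close>, and its integral vanishes at \<open>t = s\<close>.\<close>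

lemma cgf_deriv_strict_mono:
  assumes s: "s \<in> interior (cgf_dom M)" and t: "t \<in> interior (cgf_dom M)" and "s < t"
    and no_atoms: "\<And>x. measure M {x} = 0"
  shows "deriv (cgf M) s < deriv (cgf M) t"
proof -
  define y where "y = deriv (cgf M) s"
  define H where "H u = (LINT x|M. (x - y) * exp (u * (x - y)))" for u
  have int: "integrable M (\<lambda>x. (x - y) * exp (u * (x - y)))"
    and H: "H u = exp (- u * y) * (LINT x|M. exp (u * x)) * (deriv (cgf M) u - y)"
    if "u \<in> interior (cgf_dom M)" for u
  proof -
    have 1: "integrable M (\<lambda>x. exp (u * x))"
      using that interior_subset[of "cgf_dom M"] by (auto simp: cgf_dom_def)
    have eq: "(x - y) * exp (u * (x - y)) = exp (- u * y) * (x * exp (u * x)) - exp (- u * y) * y * exp (u * x)" for x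
      by (simp add: algebra_simps exp_diff exp_minus divide_simps)
    show "integrable M (\<lambda>x. (x - y) * exp (u * (x - y)))"
      unfolding eq using 1 integrable_moment_exp[OF that] by auto
    have "0 < (LINT x|M. exp (u * x))" using that interior_subset[of "cgf_dom M"] by (auto intro!: exp_moment_pos)
    then have "(LINT x|M. x * exp (u * x)) = deriv (cgf M) u * (LINT x|M. exp (u * x))"
      by (simp add: cgf_deriv(1)[OF that])
    then show "H u = exp (- u * y) * (LINT x|M. exp (u * x)) * (deriv (cgf M) u - y)"
      unfolding H_def eq using 1 integrable_moment_exp[OF that]
      by (simp add: right_diff_distrib)
  qed
  have "H s < H t" unfolding H_def
  proof (rule integral_less_AE_space)
    show "AE x in M. (x - y) * exp (s * (x - y)) < (x - y) * exp (t * (x - y))"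
    proof (rule AE_I[of _ _ "{y}"])
      show "{x \<in> space M. \<not> (x - y) * exp (s * (x - y)) < (x - y) * exp (t * (x - y))} \<subseteq> {y}"
      proof
        fix x assume x: "x \<in> {x \<in> space M. \<not> (x - y) * exp (s * (x - y)) < (x - y) * exp (t * (x - y))}"
        show "x \<in> {y}"
        proof (rule ccontr)
          assume "x \<notin> {y}"
          then consider "x < y" | "x > y" by fastforce
          then show False
            using x \<open>s < t\<close> by cases (auto simp: mult_less_cancel_left)
        qed
      qed
      show "emeasure M {y} = 0" using no_atoms[of y] by (simp add: emeasure_eq_measure)
    qed auto
  qed (use int s t emeasure_space_1 in auto)
  then have "0 < exp (- t * y) * (LINT x|M. exp (t * x)) * (deriv (cgf M) t - y)"
    using H[OF s] H[OF t] by (simp add: y_def)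
  moreover have "0 < (LINT x|M. exp (t * x))" using t interior_subset[of "cgf_dom M"] by (auto intro!: exp_moment_pos)
  ultimately have "0 < deriv (cgf M) t - y" by (metis exp_gt_zero mult_pos_pos zero_less_mult_pos)
  then show ?thesis by (simp add: y_def)
qed

text \<open>Convexity: the mean value theorem yields a derivative at a point between
  \<open>s\<close> and \<open>t\<close>, and monotonicity compares it with the one at
  \<open>t\<close>. With s = 0 this bounds \<Lambda>(t) by t \<Lambda>'(t); with s the saddle point
  it controls exponents away from it.\<close>

lemma cgf_le_tangent:
  assumes s: "s \<in> interior (cgf_dom M)" and t: "t \<in> interior (cgf_dom M)"
    and no_atoms: "\<And>x. measure M {x} = 0"
  shows "cgf M t - cgf M s \<le> deriv (cgf M) t * (t - s)"
proof -
  consider "s < t" | "t < s" | "s = t" by linarith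
  then show ?thesis
  proof cases
    case 1
    then obtain u where u: "s < u" "u < t" "cgf M t - cgf M s = (t - s) * deriv (cgf M) u"
      using MVT2[of s t "cgf M" "deriv (cgf M)"] cgf_deriv(2) interior_cgf_dom_between[OF s t] by metis
    have "deriv (cgf M) u \<le> deriv (cgf M) t"
      using u interior_cgf_dom_between[OF s t, of u] t no_atoms by (intro less_imp_le cgf_deriv_strict_mono) auto
    then show ?thesis using u 1 by (simp add: mult.commute mult_left_mono)
  next
    case 2
    then obtain u where u: "t < u" "u < s" "cgf M s - cgf M t = (s - t) * deriv (cgf M) u"
      using MVT2[of t s "cgf M" "deriv (cgf M)"] cgf_deriv(2) interior_cgf_dom_between[OF t s] by metis
    have "deriv (cgf M) t \<le> deriv (cgf M) u"
      using u interior_cgf_dom_between[OF t s, of u] t no_atoms by (intro less_imp_le cgf_deriv_strict_mono) auto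
    then have "(s - t) * deriv (cgf M) t \<le> (s - t) * deriv (cgf M) u" using 2 by (intro mult_left_mono) auto
    then show ?thesis using u by (simp add: algebra_simps)
  qed auto
qed

text \<open>The point \<open>u\<close> places the supremum strictly above \<open>s\<close>, so left
  neighbourhoods of the supremum reach into the interval above \<open>s\<close>. A point there that
  lies strictly below the supremum is in the domain, where the value of \<open>cgf\<close> is
  meaningful.\<close>

lemma cgf_at_sup_unbounded:
  assumes lim: "filterlim (cgf M) at_top (at_sup_cgf_dom M)" and "s \<in> cgf_dom M" "s < u" "u \<in> cgf_dom M"
  obtains t where "s < t" "t \<in> cgf_dom M" "cgf M t > B"
proof -
  define T where "T = (SUP t\<in>cgf_dom M. ereal t)"
  have sT: "ereal s < T"
    using assms(3,4) by (auto simp: T_def less_SUP_iff)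
  have "eventually (\<lambda>t. cgf M t > B) (filtercomap ereal (at_left T))"
    using lim by (auto simp: filterlim_at_top_dense at_sup_cgf_dom_def T_def)
  then obtain P where P: "eventually P (at_left T)" "\<And>t. P (ereal t) \<Longrightarrow> cgf M t > B"
    by (auto simp: eventually_filtercomap)
  obtain b where b: "b < T" "\<And>y. b < y \<Longrightarrow> y < T \<Longrightarrow> P y"
    using P(1) eventually_at_left[OF sT] by metis
  have "max b (ereal s) < T" using b sT by auto
  then obtain t where t: "max b (ereal s) < ereal t" "ereal t < T"
    using ereal_dense2 by blast
  then obtain v where v: "v \<in> cgf_dom M" "t < v" by (auto simp: T_def less_SUP_iff)
  have "t \<in> cgf_dom M" using cgf_dom_between[OF assms(2) v(1), of t] t v by auto
  then show ?thesis using that[of t] t b P by auto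
qed

text \<open>On the part of the domain in (0, t], exp (s x) \<le> 1 + exp (t x) bounds \<Lambda> by
  \<open>B\<close>. Divergence at the supremum provides a domain point with \<Lambda> above
  \<open>B\<close>, and that point must lie strictly to the right of \<open>t\<close>.\<close>

lemma positive_cgf_dom_interior:
  assumes lim: "filterlim (cgf M) at_top (at_sup_cgf_dom M)" and t: "t \<in> cgf_dom M" "t > 0"
  shows "t \<in> interior (cgf_dom M)"
proof -
  define B where "B = ln (1 + (LINT x|M. exp (t * x)))"
  have pos: "0 < (LINT x|M. exp (t * x))" using t by (intro exp_moment_pos)
  obtain s where s: "0 < s" "s \<in> cgf_dom M" "cgf M s > B"
    using cgf_at_sup_unbounded[OF lim zero_in_cgf_dom t(2,1), of B] by metis
  have "\<not> s \<le> t"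
  proof
    assume "s \<le> t"
    have "(LINT x|M. exp (s * x)) \<le> (LINT x|M. 1 + exp (t * x))"
    proof (rule integral_mono)
      fix x show "exp (s * x) \<le> 1 + exp (t * x)"
      proof (cases "x \<ge> 0")
        case True
        then have "exp (s * x) \<le> exp (t * x)" using \<open>s \<le> t\<close> by (simp add: mult_right_mono)
        then show ?thesis by linarith
      next
        case False
        then have "exp (s * x) \<le> 1" using s by (simp add: mult_nonneg_nonpos)
        then show ?thesis by (smt (verit) exp_ge_zero)
      qed
    qed (use s t in \<open>auto simp: cgf_dom_def\<close>)
    also have "\<dots> = 1 + (LINT x|M. exp (t * x))"
      using t prob_space by (simp add: cgf_dom_def)
    finally have "cgf M s \<le> B" unfolding cgf_def B_def using exp_moment_pos[OF s(2)] by simp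
    then show False using s by simp
  qed
  then have "{0<..<s} \<subseteq> cgf_dom M" using cgf_dom_between[OF zero_in_cgf_dom s(2)] by auto
  then show ?thesis using t \<open>\<not> s \<le> t\<close> by (intro interiorI[of "{0<..<s}"]) auto
qed

text \<open>Existence: t \<Lambda>'(t) vanishes at 0 and dominates \<Lambda>(t), which exceeds c
  somewhere, so the intermediate value theorem applies. Uniqueness: at a solution s one has
  \<Lambda>'(s) = c / s > 0, and from there on both factors of the product increase.\<close>

lemma cgf_saddle_point_ex1:
  assumes lim: "filterlim (cgf M) at_top (at_sup_cgf_dom M)" and int0: "0 \<in> interior (cgf_dom M)"
    and no_atoms: "\<And>x. measure M {x} = 0" and "0 < (c::real)"
  obtains t where "t > 0" "t \<in> cgf_dom M" "t * deriv (cgf M) t = c"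
    "\<And>s. s > 0 \<Longrightarrow> s \<in> cgf_dom M \<Longrightarrow> s * deriv (cgf M) s = c \<Longrightarrow> s = t"
proof -
  obtain e where "e > 0" "cball 0 e \<subseteq> cgf_dom M"
    using int0 by (auto simp: mem_interior_cball)
  then have e: "0 < e" "e \<in> cgf_dom M" by (auto simp: cball_eq_atLeastAtMost)
  obtain t where t: "0 < t" "t \<in> cgf_dom M" "cgf M t > c"
    using cgf_at_sup_unbounded[OF lim zero_in_cgf_dom e, of c] by metis
  have ti: "t \<in> interior (cgf_dom M)" using positive_cgf_dom_interior[OF lim] t by auto
  have "c < t * deriv (cgf M) t"
    using cgf_le_tangent[OF int0 ti no_atoms] t(3) by (simp add: cgf_zero mult.commute)
  moreover have "\<forall>x. 0 \<le> x \<and> x \<le> t \<longrightarrow> isCont (\<lambda>t. t * deriv (cgf M) t) x"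
    using interior_cgf_dom_between[OF int0 ti] by (auto intro!: continuous_intros cgf_deriv_continuous)
  ultimately obtain t0 where t0: "0 \<le> t0" "t0 \<le> t" "t0 * deriv (cgf M) t0 = c"
    using IVT[of "\<lambda>t. t * deriv (cgf M) t" 0 c t] t(1) \<open>0 < c\<close> by auto
  have mono: "s * deriv (cgf M) s < u * deriv (cgf M) u"
    if "0 < s" "s < u" "u \<in> cgf_dom M" "s * deriv (cgf M) s = c" for s u
  proof -
    have ui: "u \<in> interior (cgf_dom M)" using positive_cgf_dom_interior[OF lim] that by auto
    then have "deriv (cgf M) s < deriv (cgf M) u"
      using interior_cgf_dom_between[OF int0 ui, of s] that no_atoms by (intro cgf_deriv_strict_mono) auto
    moreover have "0 < deriv (cgf M) s" using that \<open>0 < c\<close> by (metis zero_less_mult_pos)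
    ultimately show ?thesis using that by (intro mult_strict_mono) auto
  qed
  show ?thesis
  proof (rule that[of t0])
    show "t0 > 0" using t0 \<open>0 < c\<close> by (cases "t0 = 0") auto
    show "t0 \<in> cgf_dom M" using cgf_dom_between[OF zero_in_cgf_dom t(2)] t0 by auto
    fix s assume s: "s > 0" "s \<in> cgf_dom M" "s * deriv (cgf M) s = c"
    then show "s = t0"
      using mono[of s t0] mono[of t0 s] t0 \<open>t0 > 0\<close> \<open>t0 \<in> cgf_dom M\<close> by (cases s t0 rule: linorder_cases) auto
  qed (use t0 in auto)
qed

end

section \<open>Gaussian transforms of regularly varying densities\<close>

text \<open>The Laplace transform of the image of the density \<open>G\<close> under the map from x
  to x^2 / 2.\<close>

definition gauss_trans :: "(real \<Rightarrow> real) \<Rightarrow> real \<Rightarrow> real" where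
  "gauss_trans G \<theta> = (LINT x|lborel. G x * exp (- \<theta> * x\<^sup>2 / 2))"

lemma integral_pos_near_zero:
  fixes H :: "real \<Rightarrow> real"
  assumes int: "integrable lborel H" and nonneg: "\<And>x. 0 \<le> H x" and pos: "eventually (\<lambda>x. 0 < H x) (at_right 0)"
  shows "0 < (LINT x|lborel. H x)"
proof -
  obtain b where b: "0 < b" "\<And>y. 0 < y \<Longrightarrow> y < b \<Longrightarrow> 0 < H y"
    using pos by (auto simp: eventually_at_right[of 0 1] )
  have "(LINT x|lborel. H x) \<noteq> 0"
  proof
    assume "(LINT x|lborel. H x) = 0"
    then have "AE x in lborel. H x = 0" using int nonneg by (simp add: integral_nonneg_eq_0_iff_AE)
    then have "AE x in lborel. x \<notin> {0<..<b}" by eventually_elim (use b(2) in force)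
    then have "{0<..<b} \<in> null_sets lborel" by (subst AE_iff_null_sets) auto
    then show False using b(1) by (simp add: null_sets_def)
  qed
  moreover have "0 \<le> (LINT x|lborel. H x)" using nonneg by simp
  ultimately show ?thesis by linarith
qed

context
  fixes G :: "real \<Rightarrow> real"
  assumes int: "integrable lborel G" and nonneg: "\<And>x. 0 \<le> G x"
    and left: "\<And>x. x \<le> 0 \<Longrightarrow> G x = 0" and pos: "eventually (\<lambda>x. 0 < G x) (at_right 0)"
begin

lemma gauss_integrable:
  assumes "0 \<le> \<theta>" "A \<in> sets borel"
  shows "integrable lborel (\<lambda>x. G x * indicator A x * exp (- \<theta> * x\<^sup>2 / 2))"
proof (rule Bochner_Integration.integrable_bound[OF int])
  show "AE x in lborel. norm (G x * indicator A x * exp (- \<theta> * x\<^sup>2 / 2)) \<le> norm (G x)"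
  proof (rule AE_I2)
    fix x
    have "exp (- \<theta> * x\<^sup>2 / 2) \<le> 1" using assms by simp
    then have "\<bar>G x\<bar> * exp (- \<theta> * x\<^sup>2 / 2) \<le> \<bar>G x\<bar>" by (intro mult_left_le) auto
    then show "norm (G x * indicator A x * exp (- \<theta> * x\<^sup>2 / 2)) \<le> norm (G x)"
      by (auto simp: indicator_def abs_mult)
  qed
qed (use assms int in auto)

text \<open>The part of the integral beyond \<open>\<delta>\<close> is at most a constant times exp
  (-\<theta> \<delta>^2 / 2), while the part below \<delta> / 2 is at least a positive constant
  times exp (-\<theta> \<delta>^2 / 8). The relative error therefore decays at the rate 1/2 - 1/8 =
  3/8 times \<delta>^2.\<close>

lemma gauss_truncation:
  assumes "0 < \<delta>"
  shows "((\<lambda>\<theta>. (LINT x|lborel. G x * indicator {..<\<delta>} x * exp (- \<theta> * x\<^sup>2 / 2)) / gauss_trans G \<theta>) \<longlongrightarrow> 1) at_top"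
proof -
  define K where "K = (LINT x|lborel. G x)"
  define p where "p = (LINT x|lborel. G x * indicator {..<\<delta>/2} x)"
  let ?I = "\<lambda>\<theta>. LINT x|lborel. G x * indicator {..<\<delta>} x * exp (- \<theta> * x\<^sup>2 / 2)"
  have intp: "integrable lborel (\<lambda>x. G x * indicator {..<\<delta>/2} x)"
    using gauss_integrable[of 0 "{..<\<delta>/2}"] by simp
  have "eventually (\<lambda>x. x < \<delta>/2) (at_right (0::real))"
    using assms by (intro eventually_at_right_less[THEN eventually_mono] order_tendstoD tendsto_intros) auto
  with pos have "eventually (\<lambda>x. 0 < G x * indicator {..<\<delta>/2} x) (at_right 0)"
    by eventually_elim auto
  then have p: "0 < p"
    unfolding p_def using intp nonneg by (intro integral_pos_near_zero) (auto simp: indicator_def)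
  have bound: "\<bar>?I \<theta> / gauss_trans G \<theta> - 1\<bar> \<le> K / p * exp (- (3 * \<delta>\<^sup>2 / 8) * \<theta>)" if "\<theta> \<ge> 0" for \<theta>
  proof -
    have i1: "integrable lborel (\<lambda>x. G x * exp (- \<theta> * x\<^sup>2 / 2))"
      using gauss_integrable[OF that, of UNIV] by simp
    have "gauss_trans G \<theta> - ?I \<theta> = (LINT x|lborel. G x * exp (- \<theta> * x\<^sup>2 / 2) - G x * indicator {..<\<delta>} x * exp (- \<theta> * x\<^sup>2 / 2))"
      unfolding gauss_trans_def using i1 gauss_integrable[OF that] by simp
    moreover have "\<dots> \<le> (LINT x|lborel. exp (- \<theta> * \<delta>\<^sup>2 / 2) * G x)"
    proof (rule integral_mono)
      fix x
      show "G x * exp (- \<theta> * x\<^sup>2 / 2) - G x * indicator {..<\<delta>} x * exp (- \<theta> * x\<^sup>2 / 2) \<le> exp (- \<theta> * \<delta>\<^sup>2 / 2) * G x"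
      proof (cases "x < \<delta>")
        case False
        then have "\<delta>\<^sup>2 \<le> x\<^sup>2" using assms by (intro power_mono) auto
        then have "exp (- \<theta> * x\<^sup>2 / 2) \<le> exp (- \<theta> * \<delta>\<^sup>2 / 2)" using that by (simp add: mult_left_mono)
        then have "G x * exp (- \<theta> * x\<^sup>2 / 2) \<le> G x * exp (- \<theta> * \<delta>\<^sup>2 / 2)" by (intro mult_left_mono nonneg)
        then show ?thesis using False by (simp add: mult.commute)
      qed (use nonneg in auto)
    qed (use i1 gauss_integrable[OF that] int in auto)
    moreover have "\<dots> = exp (- \<theta> * \<delta>\<^sup>2 / 2) * K" by (simp add: K_def)
    moreover have "(LINT x|lborel. G x * exp (- \<theta> * x\<^sup>2 / 2) - G x * indicator {..<\<delta>} x * exp (- \<theta> * x\<^sup>2 / 2)) \<ge> 0"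
      using nonneg by (intro Bochner_Integration.integral_nonneg) (auto simp: indicator_def)
    ultimately have up: "0 \<le> gauss_trans G \<theta> - ?I \<theta>" "gauss_trans G \<theta> - ?I \<theta> \<le> exp (- \<theta> * \<delta>\<^sup>2 / 2) * K" by auto
    have "(LINT x|lborel. exp (- \<theta> * (\<delta>/2)\<^sup>2 / 2) * (G x * indicator {..<\<delta>/2} x)) \<le> gauss_trans G \<theta>"
      unfolding gauss_trans_def
    proof (rule integral_mono)
      fix x
      show "exp (- \<theta> * (\<delta>/2)\<^sup>2 / 2) * (G x * indicator {..<\<delta>/2} x) \<le> G x * exp (- \<theta> * x\<^sup>2 / 2)"
      proof (cases "0 < x \<and> x < \<delta>/2")
        case True
        then have "x\<^sup>2 \<le> (\<delta>/2)\<^sup>2" by (intro power_mono) auto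
        then have "\<theta> * x\<^sup>2 \<le> \<theta> * (\<delta>/2)\<^sup>2" using that by (intro mult_left_mono)
        then have "exp (- \<theta> * (\<delta>/2)\<^sup>2 / 2) \<le> exp (- \<theta> * x\<^sup>2 / 2)" by simp
        then have "exp (- \<theta> * (\<delta>/2)\<^sup>2 / 2) * G x \<le> exp (- \<theta> * x\<^sup>2 / 2) * G x" by (intro mult_right_mono nonneg)
        then show ?thesis using True by (simp add: mult.commute)
      next
        case False
        then have "x \<le> 0 \<or> \<delta>/2 \<le> x" by auto
        then show ?thesis using left[of x] nonneg[of x] by auto
      qed
    qed (use i1 intp in auto)
    then have lo: "exp (- \<theta> * (\<delta>/2)\<^sup>2 / 2) * p \<le> gauss_trans G \<theta>" by (simp add: p_def)
    moreover have "0 < exp (- \<theta> * (\<delta>/2)\<^sup>2 / 2) * p" using p by simp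
    ultimately have L: "0 < gauss_trans G \<theta>" by linarith
    have factor: "a * K / (b * p) = K / p * (a / b)" for a b :: real by (simp only: times_divide_times_eq) (metis mult.commute)
    have "\<bar>?I \<theta> / gauss_trans G \<theta> - 1\<bar> = (gauss_trans G \<theta> - ?I \<theta>) / gauss_trans G \<theta>"
      using up L by (simp add: abs_if field_simps)
    also have "\<dots> \<le> (exp (- \<theta> * \<delta>\<^sup>2 / 2) * K) / (exp (- \<theta> * (\<delta>/2)\<^sup>2 / 2) * p)"
      using up lo p by (intro frac_le) auto
    also have "\<dots> = K / p * exp (- \<theta> * \<delta>\<^sup>2 / 2 - (- \<theta> * (\<delta>/2)\<^sup>2 / 2))"
      by (subst exp_diff) (rule factor)
    also have "- \<theta> * \<delta>\<^sup>2 / 2 - (- \<theta> * (\<delta>/2)\<^sup>2 / 2) = - (3 * \<delta>\<^sup>2 / 8) * \<theta>"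
      unfolding power_divide by simp
    finally show ?thesis .
  qed
  have "filterlim (\<lambda>\<theta>::real. - (3 * \<delta>\<^sup>2 / 8) * \<theta>) at_bot at_top"
    using assms by (intro filterlim_tendsto_neg_mult_at_bot[OF tendsto_const] filterlim_ident) auto
  then have "((\<lambda>\<theta>. K / p * exp (- (3 * \<delta>\<^sup>2 / 8) * \<theta>)) \<longlongrightarrow> 0) at_top"
    by (intro tendsto_mult_right_zero filterlim_compose[OF exp_at_bot])
  then have "((\<lambda>\<theta>. ?I \<theta> / gauss_trans G \<theta> - 1) \<longlongrightarrow> 0) at_top"
    by (rule Lim_null_comparison[rotated]) (use bound in \<open>auto intro!: eventually_mono[OF eventually_ge_at_top[of 0]]\<close>)
  then show ?thesis by (rule LIM_zero_cancel)
qed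

lemma gauss_truncation_pos:
  assumes "0 < \<delta>" "0 \<le> \<theta>"
  shows "0 < (LINT x|lborel. G x * indicator {..<\<delta>} x * exp (- \<theta> * x\<^sup>2 / 2))"
proof (rule integral_pos_near_zero)
  have "eventually (\<lambda>x. x < \<delta>) (at_right (0::real))"
    using assms by (intro eventually_at_right_less[THEN eventually_mono] order_tendstoD tendsto_intros) auto
  with pos show "eventually (\<lambda>x. 0 < G x * indicator {..<\<delta>} x * exp (- \<theta> * x\<^sup>2 / 2)) (at_right 0)"
    by eventually_elim auto
qed (use nonneg gauss_integrable[OF assms(2), of "{..<\<delta>}"] in auto)

lemma gauss_trans_pos: "0 \<le> \<theta> \<Longrightarrow> 0 < gauss_trans G \<theta>"
proof -
  assume "0 \<le> \<theta>"
  have "0 < (LINT x|lborel. G x * indicator {..<1} x * exp (- \<theta> * x\<^sup>2 / 2))"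
    using \<open>0 \<le> \<theta>\<close> by (intro gauss_truncation_pos) auto
  also have "\<dots> \<le> gauss_trans G \<theta>"
    unfolding gauss_trans_def using gauss_integrable[OF \<open>0 \<le> \<theta>\<close>, of UNIV] gauss_integrable[OF \<open>0 \<le> \<theta>\<close>, of "{..<1}"] nonneg
    by (intro integral_mono) (auto simp: indicator_def)
  finally show ?thesis .
qed

text \<open>Only the behaviour of \<open>G\<close> near \<open>0\<close> matters for large \<open>\<theta>\<close>, and there the substitution \<open>x \<mapsto> k * x\<close> with
  \<open>k = 1 / sqrt r\<close> trades the factor \<open>r\<close> in the exponent for the ratio \<open>G (k * x) / G x\<close>.\<close>

lemma gauss_trans_regular_variation:
  assumes rv: "\<And>k. 0 < k \<Longrightarrow> ((\<lambda>x. G (k * x) / G x) \<longlongrightarrow> k powr lam) (at_right 0)" and "0 < r"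
  shows "((\<lambda>\<theta>. gauss_trans G (r * \<theta>) / gauss_trans G \<theta>) \<longlongrightarrow> r powr (- ((1 + lam) / 2))) at_top"
proof -
  define k where "k = 1 / sqrt r"
  have k: "0 < k" "r * k\<^sup>2 = 1" using \<open>0 < r\<close> by (auto simp: k_def power_divide)
  define \<kappa> where "\<kappa> = k * k powr lam"
  have \<kappa>: "0 < \<kappa>" using k by (simp add: \<kappa>_def)
  have k_eq: "k = r powr (- (1/2))"
    using \<open>0 < r\<close> by (simp add: k_def powr_minus_divide powr_half_sqrt)
  have "\<kappa> = k powr (1 + lam)" using k by (simp add: \<kappa>_def powr_add)
  also have "\<dots> = r powr (- ((1 + lam) / 2))" using \<open>0 < r\<close> by (simp add: k_eq powr_powr)
  finally have \<kappa>_eq: "\<kappa> = r powr (- ((1 + lam) / 2))" .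
  let ?I = "\<lambda>\<theta> \<delta>. LINT x|lborel. G x * indicator {..<\<delta>} x * exp (- \<theta> * x\<^sup>2 / 2)"
  have "((\<lambda>\<theta>. gauss_trans G (r * \<theta>) / gauss_trans G \<theta>) \<longlongrightarrow> \<kappa>) at_top"
  proof (rule tendstoI)
    fix e :: real assume "0 < e"
    \<comment> \<open>Two relative errors of size \<open>\<epsilon>\<close> are multiplied below;
      together they cost at most 3 \<epsilon> \<kappa>, which is less than \<open>e\<close>.\<close>
    define \<epsilon> where "\<epsilon> = min (1/2) (e / (4 * \<kappa>))"
    have \<epsilon>: "0 < \<epsilon>" "\<epsilon> \<le> 1/2" "4 * \<epsilon> * \<kappa> \<le> e" using \<open>0 < e\<close> \<kappa> by (auto simp: \<epsilon>_def min_def field_simps)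
    have "eventually (\<lambda>x. dist (G (k * x) / G x) (k powr lam) < \<epsilon> * k powr lam) (at_right 0)"
      using rv[OF k(1)] \<epsilon> k by (intro tendstoD) auto
    with pos have "eventually (\<lambda>x. 0 < G x \<and> dist (G (k * x) / G x) (k powr lam) < \<epsilon> * k powr lam) (at_right 0)"
      by eventually_elim auto
    then obtain \<delta> where \<delta>: "0 < \<delta>"
      "\<And>x. 0 < x \<Longrightarrow> x < \<delta> \<Longrightarrow> 0 < G x \<and> dist (G (k * x) / G x) (k powr lam) < \<epsilon> * k powr lam"
      by (auto simp: eventually_at_right[of 0 1])
    have G: "(1 - \<epsilon>) * k powr lam * G x \<le> G (k * x)" "G (k * x) \<le> (1 + \<epsilon>) * k powr lam * G x" if "x < \<delta>" for x
    proof -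
      have "(1 - \<epsilon>) * k powr lam * G x \<le> G (k * x) \<and> G (k * x) \<le> (1 + \<epsilon>) * k powr lam * G x"
      proof (cases "0 < x")
        case True
        then have 1: "0 < G x" and 2: "\<bar>G (k * x) / G x - k powr lam\<bar> < \<epsilon> * k powr lam"
          using \<delta>(2)[of x] that by (auto simp: dist_real_def)
        from 2 have "(1 - \<epsilon>) * k powr lam \<le> G (k * x) / G x" "G (k * x) / G x \<le> (1 + \<epsilon>) * k powr lam"
          by (simp_all add: abs_less_iff algebra_simps)
        then show ?thesis using 1 by (simp add: pos_le_divide_eq pos_divide_le_eq)
      next
        case False
        then have "G x = 0" "G (k * x) = 0" using k by (auto intro!: left simp: mult_nonneg_nonpos)
        then show ?thesis by simp
      qed
      then show "(1 - \<epsilon>) * k powr lam * G x \<le> G (k * x)" "G (k * x) \<le> (1 + \<epsilon>) * k powr lam * G x" by auto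
    qed
    have J: "\<kappa> * (1 - \<epsilon>) * ?I \<theta> \<delta> \<le> ?I (r * \<theta>) (k * \<delta>) \<and> ?I (r * \<theta>) (k * \<delta>) \<le> \<kappa> * (1 + \<epsilon>) * ?I \<theta> \<delta>" if "\<theta> \<ge> 0" for \<theta>
    proof -
      let ?H = "\<lambda>x. G (k * x) * indicator {..<\<delta>} x * exp (- \<theta> * x\<^sup>2 / 2)"
      \<comment> \<open>Because r k^2 = 1, the Gaussian factor with parameter r \<theta> at k x is
        the one with parameter \<theta> at x. The summand 0 matches the affine substitution
        rule.\<close>
      have integrand: "G (0 + k * x) * indicator {..<k * \<delta>} (0 + k * x) * exp (- (r * \<theta>) * (0 + k * x)\<^sup>2 / 2) = ?H x" for x
      proof -
        have "r * \<theta> * (k * x)\<^sup>2 = (r * k\<^sup>2) * (\<theta> * x\<^sup>2)" by (simp add: power_mult_distrib)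
        then have "r * \<theta> * (k * x)\<^sup>2 = \<theta> * x\<^sup>2" using k by simp
        then show ?thesis using k by (auto simp: indicator_def)
      qed
      have subst: "?I (r * \<theta>) (k * \<delta>) = k * (LINT x|lborel. ?H x)"
        using lborel_integral_real_affine[of k "\<lambda>x. G x * indicator {..<k * \<delta>} x * exp (- (r * \<theta>) * x\<^sup>2 / 2)" 0] k
        unfolding integrand by simp
      have "integrable lborel (\<lambda>x. G (0 + k * x) * indicator {..<k * \<delta>} (0 + k * x) * exp (- (r * \<theta>) * (0 + k * x)\<^sup>2 / 2))"
        using gauss_integrable[of "r * \<theta>" "{..<k * \<delta>}"] that \<open>0 < r\<close> k
        by (intro lborel_integrable_real_affine) auto
      then have iH: "integrable lborel ?H" unfolding integrand .
      have iI: "integrable lborel (\<lambda>x. G x * indicator {..<\<delta>} x * exp (- \<theta> * x\<^sup>2 / 2))"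
        using gauss_integrable[OF that] by simp
      have "(LINT x|lborel. ((1 - \<epsilon>) * k powr lam) * (G x * indicator {..<\<delta>} x * exp (- \<theta> * x\<^sup>2 / 2))) \<le> (LINT x|lborel. ?H x)"
        using iH G by (intro integral_mono integrable_mult_right iI)
          (auto simp: indicator_def intro!: mult_right_mono simp flip: mult.assoc)
      moreover have "(LINT x|lborel. ?H x) \<le> (LINT x|lborel. ((1 + \<epsilon>) * k powr lam) * (G x * indicator {..<\<delta>} x * exp (- \<theta> * x\<^sup>2 / 2)))"
        using iH G by (intro integral_mono integrable_mult_right iI)
          (auto simp: indicator_def intro!: mult_right_mono simp flip: mult.assoc)
      ultimately have "(1 - \<epsilon>) * k powr lam * ?I \<theta> \<delta> \<le> (LINT x|lborel. ?H x)"
          "(LINT x|lborel. ?H x) \<le> (1 + \<epsilon>) * k powr lam * ?I \<theta> \<delta>"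
        by simp_all
      then have "k * ((1 - \<epsilon>) * k powr lam * ?I \<theta> \<delta>) \<le> ?I (r * \<theta>) (k * \<delta>)"
        "?I (r * \<theta>) (k * \<delta>) \<le> k * ((1 + \<epsilon>) * k powr lam * ?I \<theta> \<delta>)"
        unfolding subst using k by (auto intro!: mult_left_mono)
      then show ?thesis by (simp add: \<kappa>_def mult_ac)
    qed
    \<comment> \<open>Both truncations are asymptotically harmless, so the quotient of the full
      transforms is that of the truncated ones, sandwiched in \<open>J\<close>, times a factor
      tending to 1.\<close>
    have A: "((\<lambda>\<theta>. ?I (r * \<theta>) (k * \<delta>) / gauss_trans G (r * \<theta>)) \<longlongrightarrow> 1) at_top"
      using k \<delta>(1) \<open>0 < r\<close>
      by (intro filterlim_compose[OF gauss_truncation[of "k * \<delta>"]] filterlim_tendsto_pos_mult_at_top[OF tendsto_const] filterlim_ident) auto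
    have B: "((\<lambda>\<theta>. ?I \<theta> \<delta> / gauss_trans G \<theta>) \<longlongrightarrow> 1) at_top" by (rule gauss_truncation[OF \<delta>(1)])
    have "((\<lambda>\<theta>. (?I \<theta> \<delta> / gauss_trans G \<theta>) / (?I (r * \<theta>) (k * \<delta>) / gauss_trans G (r * \<theta>))) \<longlongrightarrow> 1 / 1) at_top"
      by (intro tendsto_divide A B) simp
    then have "eventually (\<lambda>\<theta>. dist ((?I \<theta> \<delta> / gauss_trans G \<theta>) / (?I (r * \<theta>) (k * \<delta>) / gauss_trans G (r * \<theta>))) 1 < \<epsilon>) at_top"
      using \<epsilon> by (intro tendstoD) auto
    with eventually_ge_at_top[of 0]
    show "eventually (\<lambda>\<theta>. dist (gauss_trans G (r * \<theta>) / gauss_trans G \<theta>) \<kappa> < e) at_top"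
    proof eventually_elim
      case (elim \<theta>)
      define a where "a = ?I \<theta> \<delta>"
      define b where "b = ?I (r * \<theta>) (k * \<delta>)"
      define q where "q = (a / gauss_trans G \<theta>) / (b / gauss_trans G (r * \<theta>))"
      have ab: "0 < a" "0 < b" using gauss_truncation_pos elim \<delta>(1) k \<open>0 < r\<close> by (auto simp: a_def b_def)
      have L: "0 < gauss_trans G \<theta>" "0 < gauss_trans G (r * \<theta>)" using gauss_trans_pos elim \<open>0 < r\<close> by auto
      have q: "1 - \<epsilon> \<le> q" "q \<le> 1 + \<epsilon>" using elim unfolding a_def[symmetric] b_def[symmetric] q_def[symmetric] by (auto simp: dist_real_def)
      have j: "\<kappa> * (1 - \<epsilon>) \<le> b / a" "b / a \<le> \<kappa> * (1 + \<epsilon>)"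
        using J[of \<theta>] elim ab unfolding a_def[symmetric] b_def[symmetric] by (auto simp: pos_le_divide_eq pos_divide_le_eq)
      have eq: "gauss_trans G (r * \<theta>) / gauss_trans G \<theta> = (b / a) * q"
        unfolding q_def using ab L by (simp add: field_simps)
      have "(b / a) * q \<le> (\<kappa> * (1 + \<epsilon>)) * (1 + \<epsilon>)" using j q \<epsilon> \<kappa> ab by (intro mult_mono) auto
      also have "\<dots> = \<kappa> + (2 * \<epsilon> + \<epsilon> * \<epsilon>) * \<kappa>" by (simp add: algebra_simps)
      also have "\<dots> \<le> \<kappa> + (2 * \<epsilon> + \<epsilon> * 1) * \<kappa>" using \<epsilon> \<kappa> by (intro add_left_mono mult_right_mono mult_left_mono) auto
      also have "\<dots> = \<kappa> + 3 * \<epsilon> * \<kappa>" by (simp add: algebra_simps)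
      also have "\<dots> < \<kappa> + e" using \<epsilon>(3) mult_pos_pos[OF \<epsilon>(1) \<kappa>] by linarith
      finally have 1: "(b / a) * q < \<kappa> + e" .
      have "\<kappa> - e < \<kappa> - 2 * \<epsilon> * \<kappa>" using \<epsilon>(3) mult_pos_pos[OF \<epsilon>(1) \<kappa>] by linarith
      also have "\<dots> \<le> (\<kappa> * (1 - \<epsilon>)) * (1 - \<epsilon>)" using \<epsilon> \<kappa> by (simp add: algebra_simps)
      also have "\<dots> \<le> (b / a) * q" using j q \<epsilon> \<kappa> ab by (intro mult_mono) auto
      finally show ?case using 1 eq by (simp add: dist_real_def abs_less_iff)
    qed
  qed
  then show ?thesis unfolding \<kappa>_eq .
qed

end

section \<open>Regular variation of the density at zero\<close>

text \<open>The ratio condition forces \<open>\<zeta>\<close> to be non-zero eventually, as a quotient with denominator \<open>0\<close> has value \<open>0\<close>.\<close>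

lemma regular_variation_at_zero:
  fixes g \<zeta> :: "real \<Rightarrow> real"
  assumes \<zeta>: "\<And>x. 0 \<le> x \<Longrightarrow> 0 \<le> \<zeta> x" "slowly_varying \<zeta>" and "0 < C"
    and lim: "((\<lambda>x. g x / (x powr lam * \<zeta> (1 / x))) \<longlongrightarrow> C) (at_right 0)"
  shows "eventually (\<lambda>x. 0 < g x) (at_right 0)"
    and "\<And>k. 0 < k \<Longrightarrow> ((\<lambda>x. g (k * x) / g x) \<longlongrightarrow> k powr lam) (at_right 0)"
proof -
  define h where "h x = g x / (x powr lam * \<zeta> (1 / x))" for x
  have h: "(h \<longlongrightarrow> C) (at_right 0)" using lim by (simp add: h_def[abs_def])
  have hpos: "eventually (\<lambda>x. 0 < h x) (at_right 0)" using order_tendstoD(1)[OF h \<open>0 < C\<close>] .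
  have xpos: "eventually (\<lambda>x::real. 0 < x) (at_right 0)" by (rule eventually_at_right_less)
  from hpos xpos have hz: "eventually (\<lambda>x. 0 < x \<and> 0 < g x \<and> 0 < \<zeta> (1 / x)) (at_right 0)"
  proof eventually_elim
    case (elim x)
    then have "0 \<le> \<zeta> (1 / x)" using \<zeta>(1)[of "1 / x"] by simp
    moreover have "\<zeta> (1 / x) \<noteq> 0" using elim by (auto simp: h_def)
    ultimately have z: "0 < \<zeta> (1 / x)" by simp
    then have "0 < x powr lam * \<zeta> (1 / x)" using elim by simp
    then have "0 < g x" using elim(1) unfolding h_def by (simp add: zero_less_divide_iff)
    then show ?case using z elim by auto
  qed
  then show "eventually (\<lambda>x. 0 < g x) (at_right 0)" by eventually_elim auto
  fix k :: real assume "0 < k"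
  have kx: "filterlim (\<lambda>x. k * x) (at_right 0) (at_right 0)"
    unfolding filterlim_at using \<open>0 < k\<close>
    by (auto intro!: tendsto_eq_intros eventually_mono[OF xpos])
  have hk: "((\<lambda>x. h (k * x)) \<longlongrightarrow> C) (at_right 0)" by (rule filterlim_compose[OF h kx])
  \<comment> \<open>Scaling x by k scales the argument of \<open>\<zeta>\<close> by 1 / k, so slow
    variation is used with that factor.\<close>
  have "((\<lambda>x. \<zeta> (1 / k * (1 / x)) / \<zeta> (1 / x)) \<longlongrightarrow> 1) (at_right 0)"
  proof -
    have "((\<lambda>y. \<zeta> (1 / k * y) / \<zeta> y) \<longlongrightarrow> 1) at_top" using \<zeta>(2)[unfolded slowly_varying_def, rule_format, of "1 / k"] \<open>0 < k\<close> by simp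
    then show ?thesis by (rule filterlim_compose) (auto simp: divide_inverse intro!: filterlim_inverse_at_top_right)
  qed
  then have "((\<lambda>x. h (k * x) / h x * (k powr lam * (\<zeta> (1 / k * (1 / x)) / \<zeta> (1 / x)))) \<longlongrightarrow> C / C * (k powr lam * 1)) (at_right 0)"
    using \<open>0 < C\<close> by (intro tendsto_intros hk h) auto
  then have "((\<lambda>x. h (k * x) / h x * (k powr lam * (\<zeta> (1 / k * (1 / x)) / \<zeta> (1 / x)))) \<longlongrightarrow> k powr lam) (at_right 0)"
    using \<open>0 < C\<close> by simp
  moreover have "eventually (\<lambda>x. h (k * x) / h x * (k powr lam * (\<zeta> (1 / k * (1 / x)) / \<zeta> (1 / x))) = g (k * x) / g x) (at_right 0)"
    using hz filterlim_iff[THEN iffD1, OF kx, rule_format, OF hz]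
  proof eventually_elim
    case (elim x)
    then show ?case using \<open>0 < k\<close> by (simp add: h_def powr_mult field_simps)
  qed
  ultimately show "((\<lambda>x. g (k * x) / g x) \<longlongrightarrow> k powr lam) (at_right 0)"
    by (rule Lim_transform_eventually)
qed

section \<open>The law of the difference of two independent variables\<close>

lemma nn_integral_even:
  fixes h :: "real \<Rightarrow> ennreal"
  assumes [measurable]: "h \<in> borel_measurable borel" and even: "\<And>x. h (- x) = h x"
  shows "(\<integral>\<^sup>+x. h x \<partial>lborel) = 2 * (\<integral>\<^sup>+x. h x * indicator {0<..} x \<partial>lborel)"
proof -
  have "(\<integral>\<^sup>+x. h x \<partial>lborel) = (\<integral>\<^sup>+x. h x * indicator {0<..} x + h x * indicator {..<0} x \<partial>lborel)"
  proof (rule nn_integral_cong_AE)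
    show "AE x in lborel. h x = h x * indicator {0<..} x + h x * indicator {..<0} x"
      using AE_lborel_singleton[of "0::real"] by eventually_elim (auto simp: indicator_def)
  qed
  also have "\<dots> = (\<integral>\<^sup>+x. h x * indicator {0<..} x \<partial>lborel) + (\<integral>\<^sup>+x. h x * indicator {..<0} x \<partial>lborel)"
    by (intro nn_integral_add) auto
  also have "(\<integral>\<^sup>+x. h x * indicator {..<0} x \<partial>lborel) = (\<integral>\<^sup>+x. h x * indicator {0<..} x \<partial>lborel)"
    using nn_integral_real_affine[of "\<lambda>x. h x * indicator {..<0} x" "-1" 0]
    by (simp add: even indicator_def)
  finally show ?thesis by (simp add: mult_2)
qed

lemma diff_density_measurable [measurable]:
  assumes [measurable]: "f \<in> borel_measurable borel"
  shows "diff_density f \<in> borel_measurable borel"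
  unfolding diff_density_def[abs_def] by measurable

text \<open>Fubini after the substitution y = x + t. The autocorrelation of \<open>f\<close> is
  controlled only at positive arguments (at 0 it may diverge); evenness folds the negative half-line
  onto the positive one, which gives the factor 2.\<close>

lemma nn_integral_difference:
  fixes f :: "real \<Rightarrow> real" and h :: "real \<Rightarrow> ennreal"
  assumes [measurable]: "f \<in> borel_measurable borel" and nonneg: "\<And>x. 0 \<le> f x"
    and int: "\<And>t. 0 < t \<Longrightarrow> integrable lborel (\<lambda>x. f x * f (x + t))"
    and [measurable]: "h \<in> borel_measurable borel" and even: "\<And>x. h (- x) = h x"
  shows "(\<integral>\<^sup>+x. \<integral>\<^sup>+y. h (x - y) \<partial>(density lborel (\<lambda>x. ennreal (f x))) \<partial>(density lborel (\<lambda>x. ennreal (f x))))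
    = 2 * (\<integral>\<^sup>+t. h t * ennreal (diff_density f t * indicator {0<..} t) \<partial>lborel)"
proof -
  \<comment> \<open>The autocorrelation with values in the extended nonnegative reals, for which
    Fubini holds without integrability; it is identified with \<open>diff_density\<close> only for t
    > 0.\<close>
  define g where "g t = (\<integral>\<^sup>+x. ennreal (f x * f (x + t)) \<partial>lborel)" for t
  have [measurable]: "g \<in> borel_measurable borel" unfolding g_def[abs_def] by measurable
  have g: "g t = ennreal (diff_density f t)" if "0 < t" for t
    unfolding g_def diff_density_def using int[OF that] nonneg by (intro nn_integral_eq_integral) auto
  have g_even: "g (- t) = g t" for t
  proof -
    have "g (- t) = (\<integral>\<^sup>+x. ennreal (f (t + 1 * x) * f (t + 1 * x - t)) \<partial>lborel)"
      unfolding g_def using nn_integral_real_affine[of "\<lambda>x. ennreal (f x * f (x - t))" 1 t] by simp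
    then show ?thesis unfolding g_def by (simp add: mult.commute add.commute)
  qed
  have "(\<integral>\<^sup>+x. \<integral>\<^sup>+y. h (x - y) \<partial>(density lborel (\<lambda>x. ennreal (f x))) \<partial>(density lborel (\<lambda>x. ennreal (f x))))
      = (\<integral>\<^sup>+x. \<integral>\<^sup>+y. ennreal (f x) * (ennreal (f y) * h (x - y)) \<partial>lborel \<partial>lborel)"
    by (simp add: nn_integral_density nn_integral_cmult)
  also have "\<dots> = (\<integral>\<^sup>+x. \<integral>\<^sup>+t. ennreal (f x) * (ennreal (f (x + t)) * h t) \<partial>lborel \<partial>lborel)"
  proof (rule nn_integral_cong)
    fix x :: real
    have "(\<integral>\<^sup>+y. ennreal (f x) * (ennreal (f y) * h (x - y)) \<partial>lborel)
        = (\<integral>\<^sup>+t. ennreal (f x) * (ennreal (f (x + 1 * t)) * h (x - (x + 1 * t))) \<partial>lborel)"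
      by (subst nn_integral_real_affine[where c = 1 and t = x]) auto
    then show "(\<integral>\<^sup>+y. ennreal (f x) * (ennreal (f y) * h (x - y)) \<partial>lborel)
        = (\<integral>\<^sup>+t. ennreal (f x) * (ennreal (f (x + t)) * h t) \<partial>lborel)"
      by (simp add: even)
  qed
  also have "\<dots> = (\<integral>\<^sup>+t. \<integral>\<^sup>+x. ennreal (f x) * (ennreal (f (x + t)) * h t) \<partial>lborel \<partial>lborel)"
    by (rule lborel_pair.Fubini') simp
  also have "\<dots> = (\<integral>\<^sup>+t. h t * g t \<partial>lborel)"
    unfolding g_def using nonneg
    by (subst nn_integral_cmult[symmetric]) (auto intro!: nn_integral_cong simp: ennreal_mult mult_ac)
  also have "\<dots> = 2 * (\<integral>\<^sup>+t. h t * g t * indicator {0<..} t \<partial>lborel)"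
    by (rule nn_integral_even) (auto simp: even g_even)
  also have "(\<integral>\<^sup>+t. h t * g t * indicator {0<..} t \<partial>lborel)
      = (\<integral>\<^sup>+t. h t * ennreal (diff_density f t * indicator {0<..} t) \<partial>lborel)"
    by (intro nn_integral_cong) (auto simp: g indicator_def)
  finally show ?thesis .
qed

section \<open>Sums of independent identically distributed variables\<close>

lemma exp_le_quadratic:
  fixes v :: real
  assumes "\<bar>v\<bar> \<le> 1"
  shows "exp v \<le> 1 + v + v\<^sup>2"
proof (cases "0 \<le> v")
  case True
  then show ?thesis using exp_bound[of v] assms by simp
next
  case False
  have "1 - v \<le> exp (- v)" using exp_ge_add_one_self[of "- v"] by simp
  then have "exp v * (1 - v) \<le> exp v * exp (- v)" by (intro mult_left_mono) auto
  then have 1: "exp v * (1 - v) \<le> 1" by (simp flip: exp_add)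
  have "v * v\<^sup>2 \<le> 0" using False by (intro mult_nonpos_nonneg) auto
  then have "1 \<le> (1 + v + v\<^sup>2) * (1 - v)" by (simp add: algebra_simps power2_eq_square)
  with 1 have "exp v * (1 - v) \<le> (1 + v + v\<^sup>2) * (1 - v)" by linarith
  then show ?thesis using False by (simp add: mult_le_cancel_right)
qed

lemma (in prob_space) nn_integral_indep_var:
  fixes \<phi> :: "real \<times> real \<Rightarrow> ennreal"
  assumes ind: "indep_var borel A borel B" and [measurable]: "\<phi> \<in> borel_measurable borel"
  shows "(\<integral>\<^sup>+\<omega>. \<phi> (A \<omega>, B \<omega>) \<partial>M) = (\<integral>\<^sup>+\<omega>. (\<integral>\<^sup>+x. \<phi> (x, B \<omega>) \<partial>(distr M borel A)) \<partial>M)"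
proof -
  have [measurable]: "A \<in> borel_measurable M" "B \<in> borel_measurable M"
    using indep_var_rv1[OF ind] indep_var_rv2[OF ind] by auto
  interpret DA: prob_space "distr M borel A" by (rule prob_space_distr) simp
  interpret DB: prob_space "distr M borel B" by (rule prob_space_distr) simp
  interpret DAB: pair_sigma_finite "distr M borel A" "distr M borel B" ..
  have meas: "\<phi> \<in> borel_measurable (borel \<Otimes>\<^sub>M borel)" by (simp add: borel_prod)
  have "(\<integral>\<^sup>+\<omega>. \<phi> (A \<omega>, B \<omega>) \<partial>M) = (\<integral>\<^sup>+p. \<phi> p \<partial>(distr M (borel \<Otimes>\<^sub>M borel) (\<lambda>\<omega>. (A \<omega>, B \<omega>))))"
    using meas by (subst nn_integral_distr) auto
  also have "\<dots> = (\<integral>\<^sup>+p. \<phi> p \<partial>(distr M borel A \<Otimes>\<^sub>M distr M borel B))"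
    using ind by (simp add: indep_var_distribution_eq)
  also have "\<dots> = (\<integral>\<^sup>+y. \<integral>\<^sup>+x. \<phi> (x, y) \<partial>(distr M borel A) \<partial>(distr M borel B))"
    using meas by (intro DAB.nn_integral_snd[symmetric]) (simp cong: measurable_cong_sets)
  also have "\<dots> = (\<integral>\<^sup>+\<omega>. (\<integral>\<^sup>+x. \<phi> (x, B \<omega>) \<partial>(distr M borel A)) \<partial>M)"
    using meas by (subst nn_integral_distr) (auto intro!: DA.borel_measurable_nn_integral simp: borel_prod[symmetric])
  finally show ?thesis .
qed

locale iid_sequence = prob_space M for M :: "'a measure" +
  fixes Z :: "nat \<Rightarrow> 'a \<Rightarrow> real" and F :: "real measure"
  assumes indep: "indep_vars (\<lambda>_. borel) Z {1..}"
    and law: "\<And>k. 1 \<le> k \<Longrightarrow> distr M borel (Z k) = F"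
begin

lemma Z_measurable: "1 \<le> k \<Longrightarrow> Z k \<in> borel_measurable M"
  using indep by (auto simp: indep_vars_def)

lemma law_sets [simp]: "sets F = sets borel"
  using law[of 1] by auto

lemma law_space [simp]: "space F = UNIV"
  using law[of 1] by (auto simp flip: law[of 1])

lemma sum_measurable [measurable]:
  "C \<in> borel_measurable borel \<Longrightarrow> (\<lambda>\<omega>. \<Sum>k=1..n. C (Z k \<omega>) :: real) \<in> borel_measurable M"
  using Z_measurable by (intro borel_measurable_sum) auto

definition psum :: "nat \<Rightarrow> 'a \<Rightarrow> real" where
  "psum n \<omega> = (\<Sum>k=1..n. Z k \<omega>)"

lemma psum_measurable [measurable]: "psum n \<in> borel_measurable M"
  unfolding psum_def[abs_def] by (rule sum_measurable) simp

definition tail :: "nat \<Rightarrow> real \<Rightarrow> real" where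
  "tail n y = prob {\<omega> \<in> space M. y \<le> psum n \<omega>}"

lemma
  fixes C :: "real \<Rightarrow> real"
  assumes [measurable]: "C \<in> borel_measurable borel" and int: "integrable F (\<lambda>x. exp (C x))"
  shows integrable_exp_sum: "integrable M (\<lambda>\<omega>. exp (\<Sum>k=1..n. C (Z k \<omega>)))"
    and expectation_exp_sum: "expectation (\<lambda>\<omega>. exp (\<Sum>k=1..n. C (Z k \<omega>))) = (LINT x|F. exp (C x)) ^ n"
proof -
  have ind: "indep_vars (\<lambda>_. borel) (\<lambda>k \<omega>. exp (C (Z k \<omega>))) {1..n}"
  proof (rule indep_vars_compose2[where X = Z and M' = "\<lambda>_. borel"])
    show "indep_vars (\<lambda>_. borel) Z {1..n}" by (rule indep_vars_subset[OF indep]) auto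
  qed measurable
  have intk: "integrable M (\<lambda>\<omega>. exp (C (Z k \<omega>)))" if "1 \<le> k" for k
  proof -
    have "integrable (distr M borel (Z k)) (\<lambda>x. exp (C x))" using int law[OF that] by simp
    then show ?thesis using Z_measurable[OF that] by (subst (asm) integrable_distr_eq) auto
  qed
  have expk: "expectation (\<lambda>\<omega>. exp (C (Z k \<omega>))) = (LINT x|F. exp (C x))" if "1 \<le> k" for k
    using Z_measurable[OF that] by (subst law[OF that, symmetric], subst integral_distr) auto
  have prod: "exp (\<Sum>k=1..n. C (Z k \<omega>)) = (\<Prod>k=1..n. exp (C (Z k \<omega>)))" for \<omega>
    by (simp add: exp_sum)
  show "integrable M (\<lambda>\<omega>. exp (\<Sum>k=1..n. C (Z k \<omega>)))"
    unfolding prod using ind intk by (intro indep_vars_integrable) auto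
  have "expectation (\<lambda>\<omega>. \<Prod>k=1..n. exp (C (Z k \<omega>))) = (\<Prod>k=1..n. expectation (\<lambda>\<omega>. exp (C (Z k \<omega>))))"
    using ind intk by (intro indep_vars_lebesgue_integral) auto
  also have "\<dots> = (\<Prod>k=1..n. LINT x|F. exp (C x))" by (intro prod.cong) (auto simp: expk)
  finally show "expectation (\<lambda>\<omega>. exp (\<Sum>k=1..n. C (Z k \<omega>))) = (LINT x|F. exp (C x)) ^ n"
    unfolding prod by simp
qed

text \<open>Markov's inequality for exp of an additive functional. With \<open>C\<close> linear it
  is the Chernoff bound; with \<open>C\<close> a linear term plus a multiple of a centred weight it
  bounds joint events of the sum and the weights.\<close>

lemma exponential_markov:
  assumes [measurable]: "C \<in> borel_measurable borel" and int: "integrable F (\<lambda>x. exp (C x))"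
    and E: "\<And>\<omega>. \<omega> \<in> E \<Longrightarrow> c \<le> (\<Sum>k=1..n. C (Z k \<omega>))" and [measurable]: "E \<in> events"
  shows "prob E \<le> exp (- c) * (LINT x|F. exp (C x)) ^ n"
proof -
  have "prob E = expectation (indicator E)" by simp
  also have "\<dots> \<le> expectation (\<lambda>\<omega>. exp (- c) * exp (\<Sum>k=1..n. C (Z k \<omega>)))"
  proof (rule integral_mono)
    show "integrable M (indicator E :: 'a \<Rightarrow> real)" by (auto intro!: integrable_real_indicator simp: less_top[symmetric])
    fix \<omega>
    show "indicator E \<omega> \<le> exp (- c) * exp (\<Sum>k=1..n. C (Z k \<omega>))"
      using E[of \<omega>] by (auto simp: indicator_def simp flip: exp_add)
  qed (use integrable_exp_sum[OF assms(1) int] in auto)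
  finally show ?thesis using expectation_exp_sum[OF assms(1) int] by simp
qed

text \<open>Cramer's change of measure without constructing the tilted law. The n-th power of the
  moment at \<open>t\<close> is E exp (t S); outside the window, exp (t S) is dominated by the
  exponentials with parameters t + s and t - s', whose contributions \<open>up\<close> and
  \<open>lo\<close> make smaller by exp (-\<kappa> n). On the window, exp (t S) is at most a
  constant, and its probability remains. The absolute value of \<open>t\<close> allows negative
  tilts, which are used for the variance estimate.\<close>

lemma tilted_lower_bound:
  assumes int: "integrable F (\<lambda>x. exp (t * x))" "integrable F (\<lambda>x. exp ((t + s) * x))" "integrable F (\<lambda>x. exp ((t - s') * x))"
    and s: "0 \<le> s" "0 \<le> s'"
    and up: "(LINT x|F. exp ((t + s) * x)) * exp (- s * (\<beta> + \<eta>)) \<le> exp (- \<kappa>) * (LINT x|F. exp (t * x))"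
    and lo: "(LINT x|F. exp ((t - s') * x)) * exp (s' * (\<beta> - \<eta>)) \<le> exp (- \<kappa>) * (LINT x|F. exp (t * x))"
  shows "exp (- (real n * (t * \<beta> + \<bar>t\<bar> * \<eta>))) * (LINT x|F. exp (t * x)) ^ n * (1 - 2 * exp (- \<kappa> * real n))
    \<le> prob {\<omega> \<in> space M. \<bar>psum n \<omega> - real n * \<beta>\<bar> \<le> real n * \<eta>}"
proof -
  let ?m = "LINT x|F. exp (t * x)"
  let ?E = "{\<omega> \<in> space M. \<bar>psum n \<omega> - real n * \<beta>\<bar> \<le> real n * \<eta>}"
  let ?c = "real n * (t * \<beta> + \<bar>t\<bar> * \<eta>)"
  have sum: "(\<Sum>k=1..n. a * Z k \<omega>) = a * psum n \<omega>" for a \<omega> by (simp add: psum_def sum_distrib_left)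
  have i: "integrable M (\<lambda>\<omega>. exp (a * psum n \<omega>))" "expectation (\<lambda>\<omega>. exp (a * psum n \<omega>)) = (LINT x|F. exp (a * x)) ^ n"
    if "integrable F (\<lambda>x. exp (a * x))" for a
    using integrable_exp_sum[OF _ that, of n] expectation_exp_sum[OF _ that, of n] unfolding sum by auto
  have iE: "integrable M (indicator ?E :: 'a \<Rightarrow> real)"
    by (intro integrable_real_indicator) (auto simp: less_top[symmetric])
  have "?m ^ n = expectation (\<lambda>\<omega>. exp (t * psum n \<omega>))" using i int by simp
  also have "\<dots> \<le> expectation (\<lambda>\<omega>. exp ?c * indicator ?E \<omega> + exp (- s * (\<beta> + \<eta>) * real n) * exp ((t + s) * psum n \<omega>)
      + exp (s' * (\<beta> - \<eta>) * real n) * exp ((t - s') * psum n \<omega>))"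
  proof (rule integral_mono)
    fix \<omega> assume \<omega>: "\<omega> \<in> space M"
    let ?S = "psum n \<omega>"
    have "real n * (\<beta> + \<eta>) < ?S \<or> ?S < real n * (\<beta> - \<eta>) \<or> \<bar>?S - real n * \<beta>\<bar> \<le> real n * \<eta>"
      by (simp only: distrib_left right_diff_distrib) linarith
    then consider "real n * (\<beta> + \<eta>) < ?S" | "?S < real n * (\<beta> - \<eta>)" | "\<bar>?S - real n * \<beta>\<bar> \<le> real n * \<eta>"
      by blast
    then show "exp (t * ?S) \<le> exp ?c * indicator ?E \<omega> + exp (- s * (\<beta> + \<eta>) * real n) * exp ((t + s) * ?S)
      + exp (s' * (\<beta> - \<eta>) * real n) * exp ((t - s') * ?S)"
    proof cases
      case 1
      then have "0 \<le> s * (?S - real n * (\<beta> + \<eta>))" using s by simp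
      then have "exp (t * ?S) \<le> exp (- s * (\<beta> + \<eta>) * real n) * exp ((t + s) * ?S)"
        by (simp flip: exp_add add: algebra_simps)
      then show ?thesis by (smt (verit) exp_gt_zero indicator_pos_le mult_nonneg_nonneg)
    next
      case 2
      then have "0 \<le> s' * (real n * (\<beta> - \<eta>) - ?S)" using s by simp
      then have "exp (t * ?S) \<le> exp (s' * (\<beta> - \<eta>) * real n) * exp ((t - s') * ?S)"
        by (simp flip: exp_add add: algebra_simps)
      then show ?thesis by (smt (verit) exp_gt_zero indicator_pos_le mult_nonneg_nonneg)
    next
      case 3
      have "t * (?S - real n * \<beta>) \<le> \<bar>t\<bar> * \<bar>?S - real n * \<beta>\<bar>" by (metis abs_ge_self abs_mult)
      also have "\<dots> \<le> \<bar>t\<bar> * (real n * \<eta>)" using 3 by (intro mult_left_mono) auto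
      finally have "exp (t * ?S) \<le> exp ?c" by (simp add: algebra_simps)
      then show ?thesis using 3 \<omega> by (auto intro!: add_increasing2)
    qed
  qed (use i int iE in auto)
  also have "\<dots> = exp ?c * prob ?E + exp (- s * (\<beta> + \<eta>) * real n) * (LINT x|F. exp ((t + s) * x)) ^ n
      + exp (s' * (\<beta> - \<eta>) * real n) * (LINT x|F. exp ((t - s') * x)) ^ n"
    using i int iE by simp
  also have "exp (- s * (\<beta> + \<eta>) * real n) * (LINT x|F. exp ((t + s) * x)) ^ n
      = ((LINT x|F. exp ((t + s) * x)) * exp (- s * (\<beta> + \<eta>))) ^ n"
    by (simp only: exp_of_nat2_mult power_mult_distrib) (rule mult.commute)
  also have "exp (s' * (\<beta> - \<eta>) * real n) * (LINT x|F. exp ((t - s') * x)) ^ n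
      = ((LINT x|F. exp ((t - s') * x)) * exp (s' * (\<beta> - \<eta>))) ^ n"
    by (simp only: exp_of_nat2_mult power_mult_distrib) (rule mult.commute)
  also have "exp ?c * prob ?E + ((LINT x|F. exp ((t + s) * x)) * exp (- s * (\<beta> + \<eta>))) ^ n
        + ((LINT x|F. exp ((t - s') * x)) * exp (s' * (\<beta> - \<eta>))) ^ n
      \<le> exp ?c * prob ?E + (exp (- \<kappa>) * ?m) ^ n + (exp (- \<kappa>) * ?m) ^ n"
    using up lo by (intro add_mono power_mono order_refl) auto
  also have "(exp (- \<kappa>) * ?m) ^ n = exp (- \<kappa> * real n) * ?m ^ n"
    by (simp only: exp_of_nat2_mult power_mult_distrib)
  finally have "?m ^ n * (1 - 2 * exp (- \<kappa> * real n)) \<le> exp ?c * prob ?E" by (simp add: algebra_simps)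
  then have "exp (- ?c) * (?m ^ n * (1 - 2 * exp (- \<kappa> * real n))) \<le> exp (- ?c) * (exp ?c * prob ?E)"
    by (intro mult_left_mono) auto
  also have "\<dots> = prob ?E" by (simp add: exp_minus)
  finally show ?thesis by (simp only: mult.assoc)
qed

text \<open>Given the sum \<open>R\<close> of the other summands, which is independent of
  \<open>Z i\<close>, the event is a threshold condition on \<open>Z i\<close> alone, and
  \<open>swap\<close> applies at the level y - R.\<close>

lemma swap_one_summand:
  fixes u v :: "real \<Rightarrow> real"
  assumes [measurable]: "u \<in> borel_measurable borel" "v \<in> borel_measurable borel"
    and swap: "\<And>c. (\<integral>\<^sup>+x. indicator {c..} (x + h) * ennreal (u x) \<partial>F) = (\<integral>\<^sup>+x. indicator {c..} x * ennreal (v x) \<partial>F)"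
    and i: "i \<in> {1..n}"
  shows "(\<integral>\<^sup>+\<omega>. indicator {y..} (psum n \<omega> + h) * ennreal (u (Z i \<omega>)) \<partial>M)
    = (\<integral>\<^sup>+\<omega>. indicator {y..} (psum n \<omega>) * ennreal (v (Z i \<omega>)) \<partial>M)"
proof -
  define R where "R \<omega> = (\<Sum>k\<in>{1..n}-{i}. Z k \<omega>)" for \<omega>
  have ind: "indep_var borel (Z i) borel R"
    unfolding R_def[abs_def] using i
    by (intro indep_vars_sum indep_vars_subset[OF indep]) auto
  have psum: "psum n \<omega> = Z i \<omega> + R \<omega>" for \<omega>
    unfolding psum_def R_def using i by (subst sum.remove[of _ i]) auto
  have D: "distr M borel (Z i) = F" using law i by auto
  have split: "(\<integral>\<^sup>+\<omega>. indicator {y..} (psum n \<omega> + c) * ennreal (w (Z i \<omega>)) \<partial>M)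
      = (\<integral>\<^sup>+\<omega>. (\<integral>\<^sup>+x. indicator {y - R \<omega>..} (x + c) * ennreal (w x) \<partial>F) \<partial>M)"
    if [measurable]: "w \<in> borel_measurable borel" for w :: "real \<Rightarrow> real" and c
  proof -
    let ?\<phi> = "\<lambda>p :: real \<times> real. indicator {y..} (fst p + snd p + c) * ennreal (w (fst p))"
    have "?\<phi> \<in> borel_measurable (borel \<Otimes>\<^sub>M borel)" by measurable
    then have meas: "?\<phi> \<in> borel_measurable borel" by (simp only: borel_prod)
    have "(\<integral>\<^sup>+\<omega>. indicator {y..} (psum n \<omega> + c) * ennreal (w (Z i \<omega>)) \<partial>M) = (\<integral>\<^sup>+\<omega>. ?\<phi> (Z i \<omega>, R \<omega>) \<partial>M)"
      by (simp add: psum)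
    also have "\<dots> = (\<integral>\<^sup>+\<omega>. (\<integral>\<^sup>+x. ?\<phi> (x, R \<omega>) \<partial>(distr M borel (Z i))) \<partial>M)"
      by (rule nn_integral_indep_var[OF ind meas])
    also have "\<dots> = (\<integral>\<^sup>+\<omega>. (\<integral>\<^sup>+x. indicator {y - R \<omega>..} (x + c) * ennreal (w x) \<partial>F) \<partial>M)"
      unfolding D by (intro nn_integral_cong) (auto simp: indicator_def)
    finally show ?thesis .
  qed
  have "(\<integral>\<^sup>+x. indicator {y - R \<omega>..} (x + h) * ennreal (u x) \<partial>F)
      = (\<integral>\<^sup>+x. indicator {y - R \<omega>..} (x + 0) * ennreal (v x) \<partial>F)" for \<omega>
    using swap[of "y - R \<omega>"] by simp
  then show ?thesis using split[of u h] split[of v 0] by simp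
qed

lemma swap_weights:
  fixes u v :: "real \<Rightarrow> real"
  assumes [measurable]: "u \<in> borel_measurable borel" "v \<in> borel_measurable borel"
    and u: "\<And>x. 0 \<le> u x" "\<And>x. u x \<le> 1" and v: "\<And>x. 0 \<le> v x" "\<And>x. v x \<le> 1"
    and swap: "\<And>c. (\<integral>\<^sup>+x. indicator {c..} (x + h) * ennreal (u x) \<partial>F) = (\<integral>\<^sup>+x. indicator {c..} x * ennreal (v x) \<partial>F)"
  shows "expectation (\<lambda>\<omega>. indicator {y - h..} (psum n \<omega>) * (\<Sum>k=1..n. u (Z k \<omega>)))
    = expectation (\<lambda>\<omega>. indicator {y..} (psum n \<omega>) * (\<Sum>k=1..n. v (Z k \<omega>)))"
proof -
  have 1: "expectation (\<lambda>\<omega>. indicator {a..} (psum n \<omega>) * (\<Sum>k=1..n. w (Z k \<omega>)))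
      = enn2real (\<Sum>k=1..n. \<integral>\<^sup>+\<omega>. indicator {a..} (psum n \<omega>) * ennreal (w (Z k \<omega>)) \<partial>M)"
    if [measurable]: "w \<in> borel_measurable borel" and w: "\<And>x. 0 \<le> w x" for w :: "real \<Rightarrow> real" and a
  proof -
    have "expectation (\<lambda>\<omega>. indicator {a..} (psum n \<omega>) * (\<Sum>k=1..n. w (Z k \<omega>)))
        = enn2real (\<integral>\<^sup>+\<omega>. ennreal (indicator {a..} (psum n \<omega>) * (\<Sum>k=1..n. w (Z k \<omega>))) \<partial>M)"
    proof (rule integral_eq_nn_integral)
      show "(\<lambda>\<omega>. indicator {a..} (psum n \<omega>) * (\<Sum>k=1..n. w (Z k \<omega>))) \<in> borel_measurable M"
        by measurable
      show "AE \<omega> in M. 0 \<le> indicator {a..} (psum n \<omega>) * (\<Sum>k=1..n. w (Z k \<omega>))"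
        using w by (intro AE_I2 mult_nonneg_nonneg sum_nonneg) auto
    qed
    also have "(\<integral>\<^sup>+\<omega>. ennreal (indicator {a..} (psum n \<omega>) * (\<Sum>k=1..n. w (Z k \<omega>))) \<partial>M)
        = (\<integral>\<^sup>+\<omega>. (\<Sum>k=1..n. indicator {a..} (psum n \<omega>) * ennreal (w (Z k \<omega>))) \<partial>M)"
      using w by (intro nn_integral_cong) (auto simp: indicator_def sum_ennreal)
    also have "\<dots> = (\<Sum>k=1..n. \<integral>\<^sup>+\<omega>. indicator {a..} (psum n \<omega>) * ennreal (w (Z k \<omega>)) \<partial>M)"
      using Z_measurable by (intro nn_integral_sum) auto
    finally show ?thesis .
  qed
  have eq: "indicator {y - h..} s = (indicator {y..} (s + h) :: ennreal)" for s
    by (auto simp: indicator_def)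
  have "(\<Sum>k=1..n. \<integral>\<^sup>+\<omega>. indicator {y - h..} (psum n \<omega>) * ennreal (u (Z k \<omega>)) \<partial>M)
      = (\<Sum>k=1..n. \<integral>\<^sup>+\<omega>. indicator {y..} (psum n \<omega>) * ennreal (v (Z k \<omega>)) \<partial>M)"
    unfolding eq using assms by (intro sum.cong refl swap_one_summand) auto
  then show ?thesis by (simp only: 1[OF assms(1) u(1)] 1[OF assms(2) v(1)])
qed

text \<open>A Chernoff bound under the tilted law, where the weights have mean
  \<open>\<beta>\<close>: the probability that their average exceeds the mean by
  \<open>\<epsilon>\<close> decays like exp (-n \<epsilon>^2 / 36). Undoing the tilt on {S \<ge> y}
  contributes exp (-t y) and the n-th power of the moment.\<close>

lemma tilted_weight_upper:
  assumes [measurable]: "w \<in> borel_measurable borel" and w: "\<And>x. \<bar>w x\<bar> \<le> 1" and "0 \<le> t"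
    and int: "integrable F (\<lambda>x. exp (t * x))" and \<beta>: "(LINT x|F. w x * exp (t * x)) = \<beta> * (LINT x|F. exp (t * x))"
    and \<beta>1: "\<bar>\<beta>\<bar> \<le> 1" and \<epsilon>: "0 < \<epsilon>" "\<epsilon> \<le> 1"
  shows "prob {\<omega> \<in> space M. y \<le> psum n \<omega> \<and> real n * (\<beta> + \<epsilon>) \<le> (\<Sum>k=1..n. w (Z k \<omega>))}
    \<le> exp (- t * y) * (exp (- (\<epsilon>\<^sup>2 / 36)) * (LINT x|F. exp (t * x))) ^ n"
proof -
  let ?m = "LINT x|F. exp (t * x)"
  \<comment> \<open>The minimiser of -s \<epsilon> + 9 s^2, with minimum -\<epsilon>^2 / 36; the 9
    comes from |w - \<beta> - \<epsilon>| \<le> 3.\<close>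
  define s where "s = \<epsilon> / 18"
  have s: "0 < s" using \<epsilon> by (simp add: s_def)
  define C where "C x = t * x + s * (w x - \<beta> - \<epsilon>)" for x
  have [measurable]: "C \<in> borel_measurable borel" unfolding C_def[abs_def] by measurable
  have bound: "exp (C x) \<le> exp (t * x) * (1 + s * (w x - \<beta> - \<epsilon>) + 9 * s\<^sup>2)" for x
  proof -
    let ?v = "s * (w x - \<beta> - \<epsilon>)"
    have 3: "\<bar>w x - \<beta> - \<epsilon>\<bar> \<le> 3" using w[of x] \<beta>1 \<epsilon> by linarith
    then have v: "\<bar>?v\<bar> \<le> s * 3" using s by (simp add: abs_mult)
    then have "\<bar>?v\<bar> \<le> 1" using \<epsilon> by (simp add: s_def)
    then have "exp ?v \<le> 1 + ?v + ?v\<^sup>2" by (rule exp_le_quadratic)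
    moreover have "?v\<^sup>2 \<le> 9 * s\<^sup>2" using power_mono[OF v, of 2] by (simp add: power_mult_distrib)
    ultimately have "exp (t * x) * exp ?v \<le> exp (t * x) * (1 + ?v + 9 * s\<^sup>2)" by (intro mult_left_mono) auto
    then show ?thesis by (simp add: C_def exp_add)
  qed
  have iw: "integrable F (\<lambda>x. w x * exp (t * x))"
  proof (rule Bochner_Integration.integrable_bound[OF int])
    show "AE x in F. norm (w x * exp (t * x)) \<le> norm (exp (t * x))"
      using w by (intro AE_I2) (auto simp: abs_mult mult_left_le_one_le)
  qed (simp cong: measurable_cong_sets)
  have expand: "exp (t * x) * (1 + s * (w x - \<beta> - \<epsilon>) + 9 * s\<^sup>2)
      = (1 - s * \<beta> - s * \<epsilon> + 9 * s\<^sup>2) * exp (t * x) + s * (w x * exp (t * x))" for x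
    by (simp add: algebra_simps)
  have iB: "integrable F (\<lambda>x. exp (t * x) * (1 + s * (w x - \<beta> - \<epsilon>) + 9 * s\<^sup>2))"
    unfolding expand using iw int by auto
  have iC: "integrable F (\<lambda>x. exp (C x))"
    by (rule Bochner_Integration.integrable_bound[OF iB])
      (use order_trans[OF bound abs_ge_self] in \<open>auto cong: measurable_cong_sets\<close>)
  have "(LINT x|F. exp (C x)) \<le> (LINT x|F. exp (t * x) * (1 + s * (w x - \<beta> - \<epsilon>) + 9 * s\<^sup>2))"
    using iC iB bound by (intro integral_mono) auto
  also have "\<dots> = (1 - s * \<beta> - s * \<epsilon> + 9 * s\<^sup>2) * ?m + s * (\<beta> * ?m)"
    unfolding expand using iw int \<beta> by simp
  also have "\<dots> = (1 - \<epsilon>\<^sup>2 / 36) * ?m" by (simp add: s_def algebra_simps power2_eq_square)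
  also have "\<dots> \<le> exp (- (\<epsilon>\<^sup>2 / 36)) * ?m"
    using exp_ge_add_one_self[of "- (\<epsilon>\<^sup>2 / 36)"] by (intro mult_right_mono) auto
  finally have le: "(LINT x|F. exp (C x)) \<le> exp (- (\<epsilon>\<^sup>2 / 36)) * ?m" .
  have "prob {\<omega> \<in> space M. y \<le> psum n \<omega> \<and> real n * (\<beta> + \<epsilon>) \<le> (\<Sum>k=1..n. w (Z k \<omega>))}
    \<le> exp (- (t * y)) * (LINT x|F. exp (C x)) ^ n"
  proof (rule exponential_markov[OF _ iC])
    fix \<omega> assume \<omega>: "\<omega> \<in> {\<omega> \<in> space M. y \<le> psum n \<omega> \<and> real n * (\<beta> + \<epsilon>) \<le> (\<Sum>k=1..n. w (Z k \<omega>))}"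
    have "(\<Sum>k=1..n. C (Z k \<omega>)) = t * psum n \<omega> + s * ((\<Sum>k=1..n. w (Z k \<omega>)) - real n * (\<beta> + \<epsilon>))"
      by (simp add: C_def psum_def sum.distrib sum_distrib_left sum_subtractf right_diff_distrib algebra_simps)
    moreover have "t * y \<le> t * psum n \<omega>" using \<omega> \<open>0 \<le> t\<close> by (intro mult_left_mono) auto
    moreover have "0 \<le> s * ((\<Sum>k=1..n. w (Z k \<omega>)) - real n * (\<beta> + \<epsilon>))" using \<omega> s by simp
    ultimately show "t * y \<le> (\<Sum>k=1..n. C (Z k \<omega>))" by linarith
  qed measurable
  also have "\<dots> \<le> exp (- (t * y)) * (exp (- (\<epsilon>\<^sup>2 / 36)) * ?m) ^ n"
    using le by (intro mult_left_mono power_mono) auto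
  finally show ?thesis by simp
qed

text \<open>The upper bound applied to -w, which is why weights are bounded there in absolute value
  instead of being taken in [0, 1].\<close>

lemma tilted_weight_lower:
  assumes [measurable]: "w \<in> borel_measurable borel" and w: "\<And>x. \<bar>w x\<bar> \<le> 1" and "0 \<le> t"
    and int: "integrable F (\<lambda>x. exp (t * x))" and \<beta>: "(LINT x|F. w x * exp (t * x)) = \<beta> * (LINT x|F. exp (t * x))"
    and \<beta>1: "\<bar>\<beta>\<bar> \<le> 1" and \<epsilon>: "0 < \<epsilon>" "\<epsilon> \<le> 1"
  shows "prob {\<omega> \<in> space M. y \<le> psum n \<omega> \<and> (\<Sum>k=1..n. w (Z k \<omega>)) \<le> real n * (\<beta> - \<epsilon>)}
    \<le> exp (- t * y) * (exp (- (\<epsilon>\<^sup>2 / 36)) * (LINT x|F. exp (t * x))) ^ n"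
proof -
  have "{\<omega> \<in> space M. y \<le> psum n \<omega> \<and> (\<Sum>k=1..n. w (Z k \<omega>)) \<le> real n * (\<beta> - \<epsilon>)}
      = {\<omega> \<in> space M. y \<le> psum n \<omega> \<and> real n * (- \<beta> + \<epsilon>) \<le> (\<Sum>k=1..n. - w (Z k \<omega>))}"
    by (auto simp: sum_negf algebra_simps)
  then show ?thesis
    using tilted_weight_upper[of "\<lambda>x. - w x" t "- \<beta>" \<epsilon> y n] assms by simp
qed

end

text \<open>Supplies the two moment hypotheses of the tilted lower bound. For small \<open>s\<close>
  the difference quotients of \<Lambda> at \<open>t\<close> are within \<eta> / 2 of \<Lambda>'(t),
  so a window of half-width \<open>\<eta>\<close> leaves the surplus \<kappa> = s \<eta> /
  2.\<close>

lemma (in real_distribution) exponential_tilt_gap: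
  assumes t: "t \<in> interior (cgf_dom M)" and "0 < \<eta>"
  obtains s \<kappa> where "0 < s" "0 < \<kappa>" "t + s \<in> cgf_dom M" "t - s \<in> cgf_dom M"
    "(LINT x|M. exp ((t + s) * x)) * exp (- s * (deriv (cgf M) t + \<eta>)) \<le> exp (- \<kappa>) * (LINT x|M. exp (t * x))"
    "(LINT x|M. exp ((t - s) * x)) * exp (s * (deriv (cgf M) t - \<eta>)) \<le> exp (- \<kappa>) * (LINT x|M. exp (t * x))"
proof -
  let ?x = "deriv (cgf M) t"
  obtain a b where ab: "t \<in> {a<..<b}" "{a<..<b} \<subseteq> interior (cgf_dom M)" using interior_cgf_dom_box[OF t] .
  have "((\<lambda>h. (cgf M (t + h) - cgf M t) / h) \<longlongrightarrow> ?x) (at 0)"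
    using cgf_deriv(2)[OF t] by (simp add: DERIV_def)
  then obtain d where d: "0 < d" "\<And>h. h \<noteq> 0 \<Longrightarrow> \<bar>h\<bar> < d \<Longrightarrow> \<bar>(cgf M (t + h) - cgf M t) / h - ?x\<bar> < \<eta> / 2"
    using \<open>0 < \<eta>\<close> unfolding LIM_def by (metis diff_zero dist_real_def half_gt_zero)
  define s where "s = min (d / 2) (min (t - a) (b - t) / 2)"
  have s: "0 < s" "s < d" "a < t - s" "t + s < b" using d(1) ab(1) by (auto simp: s_def min_def field_simps)
  have dom: "t \<in> cgf_dom M" "t + s \<in> cgf_dom M" "t - s \<in> cgf_dom M"
    using s(1,3,4) ab(1) subset_trans[OF ab(2) interior_subset] by (auto simp: subset_iff)
  have "\<bar>(cgf M (t + s) - cgf M t) / s - ?x\<bar> < \<eta> / 2" using s by (intro d(2)) auto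
  then have "(cgf M (t + s) - cgf M t) / s < ?x + \<eta> / 2" by linarith
  then have 1: "cgf M (t + s) - s * (?x + \<eta>) \<le> cgf M t - s * \<eta> / 2" using s by (simp add: field_simps)
  have "\<bar>(cgf M (t + - s) - cgf M t) / (- s) - ?x\<bar> < \<eta> / 2" using s by (intro d(2)) auto
  then have "?x - \<eta> / 2 < (cgf M (t - s) - cgf M t) / (- s)" unfolding add_uminus_conv_diff by linarith
  then have 2: "cgf M (t - s) + s * (?x - \<eta>) \<le> cgf M t - s * \<eta> / 2" using s by (simp add: field_simps)
  show ?thesis
  proof (rule that[of s "s * \<eta> / 2"])
    show "(LINT x|M. exp ((t + s) * x)) * exp (- s * (?x + \<eta>)) \<le> exp (- (s * \<eta> / 2)) * (LINT x|M. exp (t * x))"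
      unfolding exp_cgf[OF dom(1), symmetric] exp_cgf[OF dom(2), symmetric] exp_add[symmetric] using 1 by simp
    show "(LINT x|M. exp ((t - s) * x)) * exp (s * (?x - \<eta>)) \<le> exp (- (s * \<eta> / 2)) * (LINT x|M. exp (t * x))"
      unfolding exp_cgf[OF dom(1), symmetric] exp_cgf[OF dom(3), symmetric] exp_add[symmetric] using 2 by simp
  qed (use s dom \<open>0 < \<eta>\<close> in auto)
qed

sublocale iid_sequence \<subseteq> F: real_distribution F
proof -
  have "prob_space F"
    using prob_space_distr[OF Z_measurable[of 1]] by (simp add: law)
  then show "real_distribution F"
    by (simp add: real_distribution_def real_distribution_axioms_def)
qed

section \<open>Large deviation lower bound and comparison of shifted tails\<close>

context iid_sequence
begin

text \<open>Tilting slightly beyond \<open>t\<close> puts the mean of the tilted law above \<open>deriv (cgf F) t\<close>, so the bound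
  covers levels \<open>y\<close> on both sides of \<open>n * deriv (cgf F) t\<close>.\<close>

lemma cramer_lower_bound:
  assumes t: "t \<in> interior (cgf_dom F)" "0 < t" and no_atoms: "\<And>x. measure F {x} = 0" and "0 < \<epsilon>"
  obtains \<delta> where "0 < \<delta>"
    "eventually (\<lambda>n. \<forall>y \<le> real n * (deriv (cgf F) t + \<delta>).
      exp (- real n * (t * deriv (cgf F) t - cgf F t + \<epsilon>)) \<le> tail n y) sequentially"
proof -
  define x where "x = deriv (cgf F) t"
  \<comment> \<open>The exponent paid when tilting at \<open>u\<close> with a window of half-width
    (\<Lambda>'(u) - x) / 2. It is continuous and equals t x - \<Lambda>(t) at u = t, so some u > t
    costs at most \<epsilon> / 2 more.\<close>
  define H where "H u = u * deriv (cgf F) u - cgf F u + u * (deriv (cgf F) u - x) / 2" for u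
  have "isCont H t"
    unfolding H_def[abs_def]
    by (intro continuous_intros F.cgf_deriv_continuous t DERIV_isCont[OF F.cgf_deriv(2)]) simp
  then have "(H \<longlongrightarrow> H t) (at_right t)" by (simp add: continuous_at filterlim_at_split)
  moreover have "H t < t * x - cgf F t + \<epsilon> / 2" using \<open>0 < \<epsilon>\<close> by (simp add: H_def x_def)
  ultimately have "eventually (\<lambda>u. H u < t * x - cgf F t + \<epsilon> / 2) (at_right t)"
    by (rule order_tendstoD)
  moreover have "eventually (\<lambda>u. u \<in> interior (cgf_dom F)) (at_right t)"
    using t(1) by (intro filter_leD[OF at_le[OF subset_UNIV] eventually_at_in_open']) auto
  moreover have "eventually (\<lambda>u. t < u) (at_right t)" by (rule eventually_at_right_less)
  ultimately have "eventually (\<lambda>u. H u < t * x - cgf F t + \<epsilon> / 2 \<and> u \<in> interior (cgf_dom F) \<and> t < u) (at_right t)"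
    by eventually_elim auto
  then obtain u where u: "H u < t * x - cgf F t + \<epsilon> / 2" "u \<in> interior (cgf_dom F)" "t < u"
    by (auto dest!: eventually_happens'[OF trivial_limit_at_right_real])
  define x1 where "x1 = deriv (cgf F) u"
  have "x < x1" unfolding x_def x1_def by (rule F.cgf_deriv_strict_mono[OF t(1) u(2,3) no_atoms])
  \<comment> \<open>Half the gap: the lower end x1 - \<delta> of the window around the new mean is
    exactly x + \<delta>.\<close>
  define \<delta> where "\<delta> = (x1 - x) / 2"
  have \<delta>: "0 < \<delta>" "x1 - \<delta> = x + \<delta>" using \<open>x < x1\<close> by (auto simp: \<delta>_def field_simps)
  obtain s \<kappa> where s: "0 < s" "0 < \<kappa>" "u + s \<in> cgf_dom F" "u - s \<in> cgf_dom F"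
    and gap: "(LINT x|F. exp ((u + s) * x)) * exp (- s * (x1 + \<delta>)) \<le> exp (- \<kappa>) * (LINT x|F. exp (u * x))"
    "(LINT x|F. exp ((u - s) * x)) * exp (s * (x1 - \<delta>)) \<le> exp (- \<kappa>) * (LINT x|F. exp (u * x))"
    using F.exponential_tilt_gap[OF u(2) \<delta>(1)] unfolding x1_def by metis
  have ud: "u \<in> cgf_dom F" using u interior_subset by auto
  have *: "exp (- (real n * H u)) * (1 - 2 * exp (- \<kappa> * real n)) \<le> tail n y"
    if "y \<le> real n * (x + \<delta>)" for n y
  proof -
    have "exp (- (real n * (u * x1 + \<bar>u\<bar> * \<delta>))) * (LINT x|F. exp (u * x)) ^ n * (1 - 2 * exp (- \<kappa> * real n))
        \<le> prob {\<omega> \<in> space M. \<bar>psum n \<omega> - real n * x1\<bar> \<le> real n * \<delta>}"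
      using s ud by (intro tilted_lower_bound[OF _ _ _ _ _ gap]) (auto simp: cgf_dom_def)
    also have "exp (- (real n * (u * x1 + \<bar>u\<bar> * \<delta>))) * (LINT x|F. exp (u * x)) ^ n
        = exp (- (real n * (u * x1 + \<bar>u\<bar> * \<delta>)) + real n * cgf F u)"
      by (simp only: F.exp_cgf[OF ud, symmetric] exp_add exp_of_nat_mult)
    also have "- (real n * (u * x1 + \<bar>u\<bar> * \<delta>)) + real n * cgf F u = - (real n * H u)"
      using u t by (simp add: H_def \<delta>_def x1_def algebra_simps)
    also have "prob {\<omega> \<in> space M. \<bar>psum n \<omega> - real n * x1\<bar> \<le> real n * \<delta>} \<le> tail n y"
      unfolding tail_def
    proof (rule finite_measure_mono)
      show "{\<omega> \<in> space M. \<bar>psum n \<omega> - real n * x1\<bar> \<le> real n * \<delta>} \<subseteq> {\<omega> \<in> space M. y \<le> psum n \<omega>}"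
      proof safe
        fix \<omega> assume "\<bar>psum n \<omega> - real n * x1\<bar> \<le> real n * \<delta>"
        then have "real n * (x1 - \<delta>) \<le> psum n \<omega>" by (simp add: right_diff_distrib abs_le_iff)
        then show "y \<le> psum n \<omega>" using that \<delta>(2) by simp
      qed
    qed measurable
    finally show ?thesis .
  qed
  have "((\<lambda>n. 1 - 2 * exp (- \<kappa> * real n)) \<longlonglongrightarrow> 1)" using s(2) by real_asymp
  then have "eventually (\<lambda>n. 1/2 < 1 - 2 * exp (- \<kappa> * real n)) sequentially" by (rule order_tendstoD) simp
  moreover have "((\<lambda>n. exp (- (\<epsilon> / 2) * real n)) \<longlonglongrightarrow> 0)" using \<open>0 < \<epsilon>\<close> by real_asymp
  then have "eventually (\<lambda>n. exp (- (\<epsilon> / 2) * real n) < 1 / 2) sequentially" by (rule order_tendstoD) simp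
  ultimately have "eventually (\<lambda>n. \<forall>y \<le> real n * (x + \<delta>). exp (- real n * (t * x - cgf F t + \<epsilon>)) \<le> tail n y) sequentially"
  proof eventually_elim
    case (elim n)
    have "real n * H u \<le> real n * (t * x - cgf F t + \<epsilon> / 2)" using u by (intro mult_left_mono) auto
    then have "- real n * (t * x - cgf F t + \<epsilon>) \<le> - (real n * H u) + (- (\<epsilon> / 2) * real n)" by (simp add: algebra_simps)
    then have "exp (- real n * (t * x - cgf F t + \<epsilon>)) \<le> exp (- (real n * H u) + (- (\<epsilon> / 2) * real n))" by simp
    also have "\<dots> = exp (- (real n * H u)) * exp (- (\<epsilon> / 2) * real n)" by (simp only: exp_add)
    also have "\<dots> \<le> exp (- (real n * H u)) * (1 - 2 * exp (- \<kappa> * real n))" using elim by (intro mult_left_mono) auto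
    finally show ?case using *[of _ n] by (meson order_trans)
  qed
  then show ?thesis using that \<delta>(1) unfolding x_def by blast
qed

text \<open>Bounding the weights from below on one side and from above on the other turns an identity between
  weighted tail integrals into a comparison of tails.\<close>

lemma weighted_tail_compare:
  fixes w1 w2 :: "real \<Rightarrow> real"
  assumes eq: "expectation (\<lambda>\<omega>. indicator {y1..} (psum n \<omega>) * (\<Sum>k=1..n. w1 (Z k \<omega>)))
      = expectation (\<lambda>\<omega>. indicator {y2..} (psum n \<omega>) * (\<Sum>k=1..n. w2 (Z k \<omega>)))"
    and w12 [measurable]: "w1 \<in> borel_measurable borel" "w2 \<in> borel_measurable borel"
    and w1: "\<And>x. 0 \<le> w1 x" "\<And>x. w1 x \<le> 1" and w2: "\<And>x. 0 \<le> w2 x" "\<And>x. w2 x \<le> 1"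
    and "0 \<le> a" "0 \<le> b" "0 < \<theta>" "0 < n"
  shows "(a - \<theta>) * tail n y1 \<le> (b + \<theta>) * tail n y2
    + prob {\<omega> \<in> space M. y2 \<le> psum n \<omega> \<and> real n * (b + \<theta>) \<le> (\<Sum>k=1..n. w2 (Z k \<omega>))}
    + a * prob {\<omega> \<in> space M. y1 \<le> psum n \<omega> \<and> (\<Sum>k=1..n. w1 (Z k \<omega>)) \<le> real n * (a - \<theta>)}"
proof -
  have Sn: "0 \<le> (\<Sum>k=1..n. w (Z k \<omega>))" "(\<Sum>k=1..n. w (Z k \<omega>)) \<le> real n"
    if "\<And>x. 0 \<le> w x" "\<And>x. w x \<le> 1" for w :: "real \<Rightarrow> real" and \<omega>
    using that sum_mono[of "{1..n}" "\<lambda>k. w (Z k \<omega>)" "\<lambda>_. 1"] by (auto intro: sum_nonneg)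
  let ?W1 = "\<lambda>\<omega>. \<Sum>k=1..n. w1 (Z k \<omega>)" and ?W2 = "\<lambda>\<omega>. \<Sum>k=1..n. w2 (Z k \<omega>)"
  let ?A = "{\<omega> \<in> space M. y1 \<le> psum n \<omega>}" and ?B = "{\<omega> \<in> space M. y2 \<le> psum n \<omega>}"
  let ?A' = "{\<omega> \<in> space M. y1 \<le> psum n \<omega> \<and> ?W1 \<omega> \<le> real n * (a - \<theta>)}"
  let ?B' = "{\<omega> \<in> space M. y2 \<le> psum n \<omega> \<and> real n * (b + \<theta>) \<le> ?W2 \<omega>}"
  have iI: "integrable M (indicator S :: 'a \<Rightarrow> real)" if "S \<in> events" for S
    using that by (intro integrable_real_indicator) (auto simp: less_top[symmetric])
  have iS: "integrable M (\<lambda>\<omega>. indicator {z..} (psum n \<omega>) * (\<Sum>k=1..n. w (Z k \<omega>)))"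
    if [measurable]: "w \<in> borel_measurable borel" and "\<And>x. 0 \<le> w x" "\<And>x. w x \<le> 1" for w :: "real \<Rightarrow> real" and z
  proof (rule integrable_const_bound[where B = "real n"])
    show "AE \<omega> in M. norm (indicator {z..} (psum n \<omega>) * (\<Sum>k=1..n. w (Z k \<omega>))) \<le> real n"
      using Sn[of w, OF that(2,3)] by (intro AE_I2) (simp add: indicator_def)
  qed measurable
  have evs: "?A \<in> events" "?B \<in> events" "?A' \<in> events" "?B' \<in> events" by measurable
  have pr: "expectation (\<lambda>\<omega>. c * indicator S \<omega>) = c * prob S" if "S \<in> events" for c S
    using sets.sets_into_space[OF that] by (simp add: Int_absorb2)
  note ints = iI[OF evs(1)] iI[OF evs(2)] iI[OF evs(3)] iI[OF evs(4)] iS[of w1, OF w12(1) w1] iS[of w2, OF w12(2) w2]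
  have "real n * (a - \<theta>) * prob ?A = expectation (\<lambda>\<omega>. real n * (a - \<theta>) * indicator ?A \<omega>)" by (simp only: pr[OF evs(1)])
  also have "\<dots> \<le> expectation (\<lambda>\<omega>. indicator {y1..} (psum n \<omega>) * ?W1 \<omega> + real n * a * indicator ?A' \<omega>)"
  proof (rule integral_mono)
    fix \<omega> assume \<omega>: "\<omega> \<in> space M"
    have "real n * (a - \<theta>) \<le> real n * a" using \<open>0 < \<theta>\<close> by (intro mult_left_mono) auto
    then show "real n * (a - \<theta>) * indicator ?A \<omega> \<le> indicator {y1..} (psum n \<omega>) * ?W1 \<omega> + real n * a * indicator ?A' \<omega>"
      using \<omega> Sn(1)[of w1 \<omega>, OF w1] by (simp add: indicator_def)
  qed (intro Bochner_Integration.integrable_add integrable_mult_right ints)+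
  also have "\<dots> = expectation (\<lambda>\<omega>. indicator {y2..} (psum n \<omega>) * ?W2 \<omega>) + real n * a * prob ?A'"
    
    by (subst Bochner_Integration.integral_add, (intro integrable_mult_right ints)+) (simp only: eq pr[OF evs(3)])
  also have "expectation (\<lambda>\<omega>. indicator {y2..} (psum n \<omega>) * ?W2 \<omega>)
      \<le> expectation (\<lambda>\<omega>. real n * (b + \<theta>) * indicator ?B \<omega> + real n * indicator ?B' \<omega>)"
  proof (rule integral_mono)
    fix \<omega> assume \<omega>: "\<omega> \<in> space M"
    have "0 \<le> real n * (b + \<theta>)" using \<open>0 < \<theta>\<close> \<open>0 \<le> b\<close> by simp
    then show "indicator {y2..} (psum n \<omega>) * ?W2 \<omega> \<le> real n * (b + \<theta>) * indicator ?B \<omega> + real n * indicator ?B' \<omega>"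
      using \<omega> Sn(2)[of w2 \<omega>, OF w2] by (simp add: indicator_def)
  qed (intro Bochner_Integration.integrable_add integrable_mult_right ints)+
  also have "\<dots> = real n * (b + \<theta>) * prob ?B + real n * prob ?B'"
    by (subst Bochner_Integration.integral_add, (intro integrable_mult_right ints)+) (simp only: pr[OF evs(2)] pr[OF evs(4)])
  finally have "real n * ((a - \<theta>) * prob ?A) \<le> real n * ((b + \<theta>) * prob ?B + prob ?B' + a * prob ?A')"
    by (simp add: algebra_simps)
  then show ?thesis using \<open>0 < n\<close> by (simp add: tail_def mult_le_cancel_left)
qed

text \<open>Under the tilted law the weights \<open>u\<close> and \<open>v\<close> have means q and
  q exp (t h), and the weighted identity makes the ratio of the tails the ratio of these means. The
  atypical weights cost \<open>Err\<close>, which must be compared with \<open>tail n y\<close>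
  itself: this is where the Cramer lower bound and the restriction of \<open>y\<close> to a window
  around n \<Lambda>'(t) enter.\<close>

lemma tail_shift_step:
  assumes f: "f \<in> borel_measurable borel" "\<And>x. 0 \<le> f x" and F_eq: "F = density lborel (\<lambda>x. ennreal (f x))"
    and t: "t \<in> interior (cgf_dom F)" "0 < t" and no_atoms: "\<And>x. measure F {x} = 0"
    and h: "0 < diff_density f h" and "0 < \<epsilon>"
  obtains \<delta> where "0 < \<delta>"
    "eventually (\<lambda>n. \<forall>y. \<bar>y - real n * deriv (cgf F) t\<bar> \<le> real n * \<delta> \<longrightarrow>
      exp (t * h - \<epsilon>) * tail n y \<le> tail n (y - h) \<and> tail n (y - h) \<le> exp (t * h + \<epsilon>) * tail n y) sequentially"
proof -
  note [measurable] = f(1)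
  define x where "x = deriv (cgf F) t"
  define m where "m = (LINT x|F. exp (t * x))"
  \<comment> \<open>Truncated likelihood ratios, so that f u and f v are translates of the same
    overlap of f with its shift. Where \<open>f x = 0\<close> the quotient is 0 by convention and
    both sides of \<open>uf\<close> and \<open>vf\<close> vanish.\<close>
  define u where "u x = min 1 (f (x + h) / f x)" for x
  define v where "v x = min 1 (f (x - h) / f x)" for x
  have uv [measurable]: "u \<in> borel_measurable borel" "v \<in> borel_measurable borel"
    unfolding u_def[abs_def] v_def[abs_def] by measurable
  have u01: "0 \<le> u x" "u x \<le> 1" and v01: "0 \<le> v x" "v x \<le> 1" for x
    using f(2) by (auto simp: u_def v_def)
  have uf: "f x * u x = min (f x) (f (x + h))" and vf: "f x * v x = min (f x) (f (x - h))" for x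
    using f(2)[of x] f(2)[of "x + h"] f(2)[of "x - h"] by (auto simp: u_def v_def min_def field_simps)
  have swap: "(\<integral>\<^sup>+x. \<phi> (x + h) * ennreal (u x) \<partial>F) = (\<integral>\<^sup>+x. \<phi> x * ennreal (v x) \<partial>F)"
    if [measurable]: "\<phi> \<in> borel_measurable borel" for \<phi>
  proof -
    have "(\<integral>\<^sup>+x. \<phi> (x + h) * ennreal (u x) \<partial>F) = (\<integral>\<^sup>+x. ennreal (f x) * (\<phi> (x + h) * ennreal (u x)) \<partial>lborel)"
      unfolding F_eq by (rule nn_integral_density) measurable
    also have "\<dots> = (\<integral>\<^sup>+x. \<phi> (x + h) * ennreal (min (f x) (f (x + h))) \<partial>lborel)"
      using f(2) u01 by (intro nn_integral_cong) (simp add: uf[symmetric] ennreal_mult mult_ac)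
    also have "\<dots> = (\<integral>\<^sup>+x. \<phi> x * ennreal (min (f (x - h)) (f x)) \<partial>lborel)"
      by (subst nn_integral_real_affine[where c = 1 and t = "- h"]) auto
    also have "\<dots> = (\<integral>\<^sup>+x. ennreal (f x) * (\<phi> x * ennreal (v x)) \<partial>lborel)"
      using f(2) v01 by (intro nn_integral_cong) (simp add: min.commute vf[symmetric] ennreal_mult mult_ac)
    also have "\<dots> = (\<integral>\<^sup>+x. \<phi> x * ennreal (v x) \<partial>F)"
      unfolding F_eq by (rule nn_integral_density[symmetric]) measurable
    finally show ?thesis .
  qed
  have td: "t \<in> cgf_dom F" using t interior_subset by auto
  then have int: "integrable F (\<lambda>x. exp (t * x))" by (simp add: cgf_dom_def)
  have m: "0 < m" unfolding m_def by (rule F.exp_moment_pos[OF td])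
  have iw: "integrable F (\<lambda>x. w x * exp (t * x))" if [measurable]: "w \<in> borel_measurable borel" and "\<And>x. 0 \<le> w x" "\<And>x. w x \<le> 1" for w
    by (rule Bochner_Integration.integrable_bound[OF int])
      (use that in \<open>auto simp: abs_mult mult_left_le_one_le cong: measurable_cong_sets\<close>)
  define q where "q = (LINT x|F. u x * exp (t * x)) / m"
  have q_eq: "(LINT x|F. u x * exp (t * x)) = q * m" using m by (simp add: q_def)
  have "(LINT x|F. v x * exp (t * x)) = exp (t * h) * (LINT x|F. u x * exp (t * x))"
  proof -
    have "(LINT x|F. v x * exp (t * x)) = enn2real (\<integral>\<^sup>+x. ennreal (exp (t * x)) * ennreal (v x) \<partial>F)"
      using v01 by (subst integral_eq_nn_integral) (auto simp: ennreal_mult mult.commute cong: measurable_cong_sets)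
    also have "\<dots> = enn2real (\<integral>\<^sup>+x. ennreal (exp (t * (x + h))) * ennreal (u x) \<partial>F)"
      by (subst swap[symmetric]) auto
    also have "\<dots> = (LINT x|F. u x * exp (t * (x + h)))"
      using u01 by (subst integral_eq_nn_integral) (auto simp: ennreal_mult mult.commute cong: measurable_cong_sets)
    also have "\<dots> = (LINT x|F. exp (t * h) * (u x * exp (t * x)))"
      by (intro Bochner_Integration.integral_cong) (auto simp: exp_add algebra_simps)
    finally show ?thesis by simp
  qed
  then have qv_eq: "(LINT x|F. v x * exp (t * x)) = (q * exp (t * h)) * m" by (simp add: q_eq)
  \<comment> \<open>If q were 0, then f(x) f(x + h) would vanish almost everywhere, against the
    positivity of \<open>diff_density f h\<close>.\<close>
  have q_pos: "0 < q"
  proof -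
    have "(LINT x|F. u x * exp (t * x)) \<noteq> 0"
    proof
      assume "(LINT x|F. u x * exp (t * x)) = 0"
      then have "AE x in F. u x * exp (t * x) = 0"
        using iw[OF uv(1) u01] u01 by (subst (asm) integral_nonneg_eq_0_iff_AE) auto
      then have "AE x in lborel. 0 < ennreal (f x) \<longrightarrow> u x = 0"
        unfolding F_eq by (subst (asm) AE_density) auto
      then have "AE x in lborel. f x * f (x + h) = 0"
      proof eventually_elim
        case (elim x)
        then show ?case using uf[of x] f(2)[of x] f(2)[of "x + h"] by (cases "f x = 0") (auto simp: min_def split: if_splits)
      qed
      then have "diff_density f h = 0"
        unfolding diff_density_def by (subst integral_cong_AE[where g = "\<lambda>_. 0"]) auto
      then show False using h by simp
    qed
    moreover have "0 \<le> (LINT x|F. u x * exp (t * x))" using u01 by simp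
    ultimately show ?thesis using m by (simp add: q_def)
  qed
  have w_le: "(LINT x|F. w x * exp (t * x)) \<le> m" if [measurable]: "w \<in> borel_measurable borel" and "\<And>x. 0 \<le> w x" "\<And>x. w x \<le> 1" for w
    unfolding m_def using iw[OF that] int that by (intro integral_mono) (auto simp: mult_left_le_one_le)
  have q_le: "q \<le> 1" "q * exp (t * h) \<le> 1"
    using w_le[OF uv(1) u01] w_le[OF uv(2) v01] m by (auto simp: q_eq qv_eq)
  let ?e = "exp (t * h)"
  \<comment> \<open>The coefficients anticipate the two final estimates, after
    \<open>Err n y\<close> has been replaced by \<open>\<theta> * tail n y\<close>. At \<theta> = 0
    both inequalities are strict because q > 0, so they persist for small \<theta>.\<close>
  have "eventually (\<lambda>\<theta>. q * ?e + \<theta> * (2 + q * ?e) < exp (t * h + \<epsilon>) * (q - \<theta>)) (at_right 0)"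
  proof -
    have "((\<lambda>\<theta>. exp (t * h + \<epsilon>) * (q - \<theta>) - (q * ?e + \<theta> * (2 + q * ?e))) \<longlongrightarrow> exp (t * h + \<epsilon>) * (q - 0) - (q * ?e + 0 * (2 + q * ?e))) (at_right 0)"
      by (intro tendsto_intros)
    moreover have "0 < exp (t * h + \<epsilon>) * (q - 0) - (q * ?e + 0 * (2 + q * ?e))"
      using q_pos \<open>0 < \<epsilon>\<close> by (simp add: mult.commute)
    ultimately show ?thesis using order_tendstoD(1) by fastforce
  qed
  moreover have "eventually (\<lambda>\<theta>. exp (t * h - \<epsilon>) * (q + \<theta>) < q * ?e - \<theta> * (1 + ?e + q * ?e)) (at_right 0)"
  proof -
    have "((\<lambda>\<theta>. q * ?e - \<theta> * (1 + ?e + q * ?e) - exp (t * h - \<epsilon>) * (q + \<theta>)) \<longlongrightarrow> q * ?e - 0 * (1 + ?e + q * ?e) - exp (t * h - \<epsilon>) * (q + 0)) (at_right 0)"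
      by (intro tendsto_intros)
    moreover have "0 < q * ?e - 0 * (1 + ?e + q * ?e) - exp (t * h - \<epsilon>) * (q + 0)"
      using q_pos \<open>0 < \<epsilon>\<close> by (simp add: mult.commute)
    ultimately show ?thesis using order_tendstoD(1) by fastforce
  qed
  moreover have "eventually (\<lambda>\<theta>. \<theta> < min 1 q) (at_right (0::real))"
    using q_pos by (intro order_tendstoD(2)[OF tendsto_ident_at]) auto
  moreover have "eventually (\<lambda>\<theta>::real. 0 < \<theta>) (at_right 0)" by (rule eventually_at_right_less)
  ultimately have "eventually (\<lambda>\<theta>. q * ?e + \<theta> * (2 + q * ?e) < exp (t * h + \<epsilon>) * (q - \<theta>) \<and>
      exp (t * h - \<epsilon>) * (q + \<theta>) < q * ?e - \<theta> * (1 + ?e + q * ?e) \<and> \<theta> < min 1 q \<and> 0 < \<theta>) (at_right 0)"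
    by eventually_elim auto
  then obtain \<theta> where \<theta>1: "q * ?e + \<theta> * (2 + q * ?e) < exp (t * h + \<epsilon>) * (q - \<theta>)"
    and \<theta>2: "exp (t * h - \<epsilon>) * (q + \<theta>) < q * ?e - \<theta> * (1 + ?e + q * ?e)" and \<theta>: "0 < \<theta>" "\<theta> \<le> 1" "\<theta> < q"
    by (auto dest!: eventually_happens'[OF trivial_limit_at_right_real])
  define \<kappa> where "\<kappa> = \<theta>\<^sup>2 / 36"
  have \<kappa>: "0 < \<kappa>" using \<theta> by (simp add: \<kappa>_def)
  obtain \<delta>' where \<delta>': "0 < \<delta>'" and low: "eventually (\<lambda>n. \<forall>y \<le> real n * (x + \<delta>').
      exp (- real n * (t * x - cgf F t + \<kappa> / 4)) \<le> tail n y) sequentially"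
    using cramer_lower_bound[OF t no_atoms, of "\<kappa> / 4"] \<kappa> unfolding x_def by auto
  \<comment> \<open>Budget: the atypical weights gain \<kappa> per observation, the Cramer bound
    loses \<kappa> / 4, and moving \<open>y\<close> within the window loses at most t \<delta> \<le>
    \<kappa> / 4. A net gain of \<kappa> / 2 remains and makes \<open>Err n y\<close> at most
    \<open>\<theta> * tail n y\<close>.\<close>
  define \<delta> where "\<delta> = min \<delta>' (\<kappa> / (4 * t))"
  have \<delta>: "0 < \<delta>" "\<delta> \<le> \<delta>'" "t * \<delta> \<le> \<kappa> / 4" using \<delta>' \<kappa> t by (auto simp: \<delta>_def min_def field_simps)
  define Err where "Err n y = exp (- t * y) * (exp (- \<kappa>) * m) ^ n" for n :: nat and y
  have Err_shift: "Err n (y - h) = ?e * Err n y" for n y by (simp add: Err_def exp_add algebra_simps flip: exp_add)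
  have "((\<lambda>n. exp (- (\<kappa> / 2) * real n)) \<longlonglongrightarrow> 0)" using \<kappa> by real_asymp
  then have "eventually (\<lambda>n. exp (- (\<kappa> / 2) * real n) < \<theta>) sequentially" using \<theta> by (intro order_tendstoD) auto
  with low eventually_gt_at_top[of 0]
  have "eventually (\<lambda>n. \<forall>y. \<bar>y - real n * x\<bar> \<le> real n * \<delta> \<longrightarrow>
      exp (t * h - \<epsilon>) * tail n y \<le> tail n (y - h) \<and> tail n (y - h) \<le> exp (t * h + \<epsilon>) * tail n y) sequentially"
  proof eventually_elim
    case (elim n)
    show ?case
    proof (intro allI impI)
      fix y assume y: "\<bar>y - real n * x\<bar> \<le> real n * \<delta>"
      have "y \<le> real n * (x + \<delta>)" using y by (simp add: distrib_left abs_le_iff)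
      also have "\<dots> \<le> real n * (x + \<delta>')" using \<delta> by (intro mult_left_mono) auto
      finally have T: "exp (- real n * (t * x - cgf F t + \<kappa> / 4)) \<le> tail n y" using elim by auto
      have E: "Err n y \<le> \<theta> * tail n y"
      proof -
        have "t * (real n * x - y) \<le> t * (real n * \<delta>)" using y t by (intro mult_left_mono) (auto simp: abs_le_iff)
        also have "\<dots> = real n * (t * \<delta>)" by simp
        also have "\<dots> \<le> real n * (\<kappa> / 4)" using \<delta> by (intro mult_left_mono) auto
        finally have 1: "- t * y \<le> real n * (\<kappa> / 4) - t * (real n * x)" by (simp add: algebra_simps)
        have "Err n y = exp (- t * y + real n * (- \<kappa> + cgf F t))"
          unfolding Err_def m_def F.exp_cgf[OF td, symmetric] by (simp only: exp_add exp_of_nat_mult)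
        also have "\<dots> \<le> exp (- (\<kappa> / 2) * real n + - real n * (t * x - cgf F t + \<kappa> / 4))"
          using 1 by (simp add: algebra_simps)
        also have "\<dots> = exp (- (\<kappa> / 2) * real n) * exp (- real n * (t * x - cgf F t + \<kappa> / 4))" by (rule exp_add)
        also have "\<dots> \<le> \<theta> * tail n y" using elim \<theta> T by (intro mult_mono) auto
        finally show ?thesis .
      qed
      have n: "0 < n" using elim by simp
      let ?U = "\<lambda>\<omega>. \<Sum>k=1..n. u (Z k \<omega>)" and ?V = "\<lambda>\<omega>. \<Sum>k=1..n. v (Z k \<omega>)"
      have eq: "expectation (\<lambda>\<omega>. indicator {y - h..} (psum n \<omega>) * ?U \<omega>) = expectation (\<lambda>\<omega>. indicator {y..} (psum n \<omega>) * ?V \<omega>)"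
        using u01 v01 by (intro swap_weights swap) auto
      have wU: "\<bar>u x\<bar> \<le> 1" and wV: "\<bar>v x\<bar> \<le> 1" for x using u01[of x] v01[of x] by auto
      have b1: "\<bar>q\<bar> \<le> 1" "\<bar>q * ?e\<bar> \<le> 1" using q_pos q_le by auto
      have t0: "0 \<le> t" using t by simp
      have q0: "0 \<le> q" "0 \<le> q * ?e" using q_pos by auto
      note ubs = tilted_weight_upper[OF uv(1) wU t0 int q_eq[unfolded m_def] b1(1) \<theta>(1,2), folded \<kappa>_def m_def]
        tilted_weight_lower[OF uv(1) wU t0 int q_eq[unfolded m_def] b1(1) \<theta>(1,2), folded \<kappa>_def m_def]
        tilted_weight_upper[OF uv(2) wV t0 int qv_eq[unfolded m_def] b1(2) \<theta>(1,2), folded \<kappa>_def m_def]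
        tilted_weight_lower[OF uv(2) wV t0 int qv_eq[unfolded m_def] b1(2) \<theta>(1,2), folded \<kappa>_def m_def]
      note ubs' = ubs[of _ n, folded Err_def]
      have T0: "0 \<le> tail n y" "0 \<le> tail n (y - h)" by (auto simp: tail_def)
      have "(q - \<theta>) * tail n (y - h) \<le> (q * ?e + \<theta>) * tail n y + Err n y + q * Err n (y - h)"
        using weighted_tail_compare[OF eq uv u01 v01 q0 \<theta>(1) n] ubs'(3)[of y] mult_left_mono[OF ubs'(2)[of "y - h"] q0(1)] by linarith
      also have "\<dots> = (q * ?e + \<theta>) * tail n y + (1 + q * ?e) * Err n y" by (simp add: Err_shift algebra_simps)
      also have "\<dots> \<le> (q * ?e + \<theta>) * tail n y + (1 + q * ?e) * (\<theta> * tail n y)"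
        using E q_pos by (intro add_left_mono mult_left_mono) auto
      also have "\<dots> = (q * ?e + \<theta> * (2 + q * ?e)) * tail n y" by (simp add: algebra_simps)
      also have "\<dots> \<le> exp (t * h + \<epsilon>) * (q - \<theta>) * tail n y" using \<theta>1 T0 by (intro mult_right_mono) auto
      finally have "(q - \<theta>) * tail n (y - h) \<le> (q - \<theta>) * (exp (t * h + \<epsilon>) * tail n y)" by (simp add: mult_ac)
      then have up: "tail n (y - h) \<le> exp (t * h + \<epsilon>) * tail n y" using \<theta> by simp
      have "(q * ?e - \<theta>) * tail n y \<le> (q + \<theta>) * tail n (y - h) + Err n (y - h) + q * ?e * Err n y"
        using weighted_tail_compare[OF eq[symmetric] uv(2,1) v01 u01 q0(2,1) \<theta>(1) n] ubs'(1)[of "y - h"]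
          mult_left_mono[OF ubs'(4)[of y] q0(2)] by linarith
      also have "\<dots> = (q + \<theta>) * tail n (y - h) + (?e + q * ?e) * Err n y" by (simp add: Err_shift algebra_simps)
      also have "\<dots> \<le> (q + \<theta>) * tail n (y - h) + (?e + q * ?e) * (\<theta> * tail n y)"
        using E q_pos by (intro add_left_mono mult_left_mono) auto
      finally have "(q * ?e - \<theta> * (1 + ?e + q * ?e)) * tail n y \<le> (q + \<theta>) * tail n (y - h)"
        by (simp add: algebra_simps)
      moreover have "exp (t * h - \<epsilon>) * (q + \<theta>) * tail n y \<le> (q * ?e - \<theta> * (1 + ?e + q * ?e)) * tail n y"
        using \<theta>2 T0 by (intro mult_right_mono) auto
      ultimately have "(q + \<theta>) * (exp (t * h - \<epsilon>) * tail n y) \<le> (q + \<theta>) * tail n (y - h)" by (simp add: mult_ac)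
      then have "exp (t * h - \<epsilon>) * tail n y \<le> tail n (y - h)" using \<theta> q_pos by (simp add: mult_le_cancel_left)
      with up show "exp (t * h - \<epsilon>) * tail n y \<le> tail n (y - h) \<and> tail n (y - h) \<le> exp (t * h + \<epsilon>) * tail n y" by simp
    qed
  qed
  then show ?thesis using that \<delta>(1) unfolding x_def by blast
qed

end

context iid_sequence
begin

text \<open>The density of the difference is known to be positive only near 0, so the shift
  \<open>a\<close> is cut into equal steps h = a / (j + 1) with j large. The one-step estimates are
  chained by induction on the number of steps, splitting the tolerance in half each time.\<close>

lemma tail_shift:
  assumes f: "f \<in> borel_measurable borel" "\<And>x. 0 \<le> f x" and F_eq: "F = density lborel (\<lambda>x. ennreal (f x))"
    and t: "t \<in> interior (cgf_dom F)" "0 < t" and no_atoms: "\<And>x. measure F {x} = 0"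
    and g: "eventually (\<lambda>h. 0 < diff_density f h) (at_right 0)" and "0 < a" "0 < \<epsilon>"
  obtains \<delta> where "0 < \<delta>"
    "eventually (\<lambda>n. \<forall>y. \<bar>y - real n * deriv (cgf F) t\<bar> \<le> real n * \<delta> \<longrightarrow>
      exp (t * a - \<epsilon>) * tail n y \<le> tail n (y - a) \<and> tail n (y - a) \<le> exp (t * a + \<epsilon>) * tail n y) sequentially"
proof -
  define x where "x = deriv (cgf F) t"
  have "filterlim (\<lambda>j. a / real (Suc j)) (at_right 0) sequentially"
    unfolding filterlim_at using \<open>0 < a\<close> by (auto intro!: real_tendsto_divide_at_top[OF tendsto_const] filterlim_compose[OF filterlim_real_sequentially filterlim_Suc] simp del: of_nat_Suc)
  then have "eventually (\<lambda>j. 0 < diff_density f (a / real (Suc j))) sequentially"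
    using g by (auto simp: filterlim_iff)
  then obtain j where j: "0 < diff_density f (a / real (Suc j))"
    by (auto simp: eventually_sequentially)
  define h where "h = a / real (Suc j)"
  have h: "0 < h" "a = real (Suc j) * h" using \<open>0 < a\<close> by (auto simp: h_def simp del: of_nat_Suc)
  have "\<exists>\<delta>>0. eventually (\<lambda>n. \<forall>y. \<bar>y - real n * x\<bar> \<le> real n * \<delta> \<longrightarrow>
      exp (t * (real i * h) - \<epsilon>) * tail n y \<le> tail n (y - real i * h) \<and>
      tail n (y - real i * h) \<le> exp (t * (real i * h) + \<epsilon>) * tail n y) sequentially"
    if "0 < \<epsilon>" for i \<epsilon>
    using that
  proof (induction i arbitrary: \<epsilon>)
    case 0
    have "tail n y * exp (- \<epsilon>) \<le> tail n y" "tail n y \<le> tail n y * exp \<epsilon>" for n y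
      using 0 by (auto simp: tail_def mult_left_le mult_le_cancel_left1)
    then show ?case by (auto intro!: exI[of _ 1] always_eventually simp: mult.commute)
  next
    case (Suc i)
    obtain \<delta>1 where \<delta>1: "0 < \<delta>1" and ev1: "eventually (\<lambda>n. \<forall>y. \<bar>y - real n * x\<bar> \<le> real n * \<delta>1 \<longrightarrow>
      exp (t * (real i * h) - \<epsilon> / 2) * tail n y \<le> tail n (y - real i * h) \<and>
      tail n (y - real i * h) \<le> exp (t * (real i * h) + \<epsilon> / 2) * tail n y) sequentially"
      using Suc.IH[of "\<epsilon> / 2"] Suc.prems by auto
    obtain \<delta>2 where \<delta>2: "0 < \<delta>2" and ev2: "eventually (\<lambda>n. \<forall>y. \<bar>y - real n * x\<bar> \<le> real n * \<delta>2 \<longrightarrow>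
      exp (t * h - \<epsilon> / 2) * tail n y \<le> tail n (y - h) \<and>
      tail n (y - h) \<le> exp (t * h + \<epsilon> / 2) * tail n y) sequentially"
      using tail_shift_step[OF f F_eq t no_atoms j, of "\<epsilon> / 2"] Suc.prems unfolding x_def h_def by auto
    \<comment> \<open>After the first step the level is y - h; halving the window leaves room for
      \<open>h\<close>, which is at most n \<delta>1 / 2 for large n.\<close>
    define \<delta> where "\<delta> = min (\<delta>1 / 2) \<delta>2"
    have \<delta>: "0 < \<delta>" "\<delta> \<le> \<delta>1 / 2" "\<delta> \<le> \<delta>2" using \<delta>1 \<delta>2 by (auto simp: \<delta>_def)
    have "eventually (\<lambda>n. h / (\<delta>1 / 2) \<le> real n) sequentially"
      by (rule eventually_compose_filterlim[OF eventually_ge_at_top filterlim_real_sequentially])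
    with ev1 ev2 have "eventually (\<lambda>n. \<forall>y. \<bar>y - real n * x\<bar> \<le> real n * \<delta> \<longrightarrow>
      exp (t * (real (Suc i) * h) - \<epsilon>) * tail n y \<le> tail n (y - real (Suc i) * h) \<and>
      tail n (y - real (Suc i) * h) \<le> exp (t * (real (Suc i) * h) + \<epsilon>) * tail n y) sequentially"
    proof eventually_elim
      case (elim n)
      show ?case
      proof (intro allI impI)
        fix y assume y: "\<bar>y - real n * x\<bar> \<le> real n * \<delta>"
        have "h \<le> real n * (\<delta>1 / 2)" using elim(3) \<delta>1 by (simp add: field_simps)
        moreover have "real n * \<delta> \<le> real n * (\<delta>1 / 2)" "real n * \<delta> \<le> real n * \<delta>2"
          by (intro mult_left_mono \<delta> of_nat_0_le_iff)+
        ultimately have "\<bar>y - h - real n * x\<bar> \<le> real n * \<delta>1" "\<bar>y - real n * x\<bar> \<le> real n * \<delta>2"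
          using y h(1) by (auto simp: abs_le_iff)
        then have A: "exp (t * (real i * h) - \<epsilon> / 2) * tail n (y - h) \<le> tail n (y - h - real i * h)"
          "tail n (y - h - real i * h) \<le> exp (t * (real i * h) + \<epsilon> / 2) * tail n (y - h)"
          and B: "exp (t * h - \<epsilon> / 2) * tail n y \<le> tail n (y - h)" "tail n (y - h) \<le> exp (t * h + \<epsilon> / 2) * tail n y"
          using elim(1,2) by blast+
        have sh: "y - real (Suc i) * h = y - h - real i * h" by (simp add: algebra_simps)
        have e: "t * (real (Suc i) * h) - \<epsilon> = (t * (real i * h) - \<epsilon> / 2) + (t * h - \<epsilon> / 2)"
          "t * (real (Suc i) * h) + \<epsilon> = (t * (real i * h) + \<epsilon> / 2) + (t * h + \<epsilon> / 2)"
          by (simp_all add: algebra_simps)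
        have "exp (t * (real (Suc i) * h) - \<epsilon>) * tail n y = exp (t * (real i * h) - \<epsilon> / 2) * (exp (t * h - \<epsilon> / 2) * tail n y)"
          unfolding e exp_add by (rule mult.assoc)
        also have "\<dots> \<le> exp (t * (real i * h) - \<epsilon> / 2) * tail n (y - h)" using B by (intro mult_left_mono) auto
        finally have lo: "exp (t * (real (Suc i) * h) - \<epsilon>) * tail n y \<le> tail n (y - real (Suc i) * h)"
          unfolding sh using A by linarith
        have "exp (t * (real i * h) + \<epsilon> / 2) * tail n (y - h) \<le> exp (t * (real i * h) + \<epsilon> / 2) * (exp (t * h + \<epsilon> / 2) * tail n y)"
          using B by (intro mult_left_mono) auto
        also have "\<dots> = exp (t * (real (Suc i) * h) + \<epsilon>) * tail n y" unfolding e exp_add by (rule mult.assoc[symmetric])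
        finally have "tail n (y - real (Suc i) * h) \<le> exp (t * (real (Suc i) * h) + \<epsilon>) * tail n y"
          unfolding sh using A by linarith
        with lo show "exp (t * (real (Suc i) * h) - \<epsilon>) * tail n y \<le> tail n (y - real (Suc i) * h) \<and>
          tail n (y - real (Suc i) * h) \<le> exp (t * (real (Suc i) * h) + \<epsilon>) * tail n y" by simp
      qed
    qed
    then show ?case using \<delta>(1) by blast
  qed
  from this[OF \<open>0 < \<epsilon>\<close>, of "Suc j"] show ?thesis using that unfolding x_def h(2) by blast
qed

lemma tail_chernoff:
  assumes "0 \<le> t" "t \<in> cgf_dom F"
  shows "tail n y \<le> exp (- t * y + real n * cgf F t)"
proof -
  have "tail n y \<le> exp (- (t * y)) * (LINT x|F. exp (t * x)) ^ n"
    unfolding tail_def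
  proof (rule exponential_markov)
    fix \<omega> assume "\<omega> \<in> {\<omega> \<in> space M. y \<le> psum n \<omega>}"
    then have "t * y \<le> t * psum n \<omega>" using assms by (intro mult_left_mono) auto
    then show "t * y \<le> (\<Sum>k=1..n. t * Z k \<omega>)" by (simp add: psum_def sum_distrib_left)
  qed (use assms in \<open>auto simp: cgf_dom_def\<close>)
  also have "\<dots> = exp (- t * y + real n * cgf F t)"
    unfolding F.exp_cgf[OF assms(2), symmetric] by (simp only: exp_add exp_of_nat_mult mult_minus_left)
  finally show ?thesis .
qed

end

text \<open>Fubini: a comparison for each fixed value \<tau> of \<open>B\<close> survives
  integration over the law of \<open>B\<close>. The set \<open>D\<close> is present because the
  tails are comparable only for \<tau> near \<open>x0\<close>.\<close>

lemma (in prob_space) indep_compare: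
  fixes A B :: "'a \<Rightarrow> real"
  assumes ind: "indep_var borel A borel B" and [measurable]: "D \<in> sets borel" "g \<in> borel_measurable borel" "h \<in> borel_measurable borel"
    and "0 \<le> K" and le: "\<And>\<tau>. \<tau> \<in> D \<Longrightarrow> prob {\<omega> \<in> space M. g \<tau> \<le> A \<omega>} \<le> K * prob {\<omega> \<in> space M. h \<tau> \<le> A \<omega>}"
  shows "prob {\<omega> \<in> space M. g (B \<omega>) \<le> A \<omega> \<and> B \<omega> \<in> D} \<le> K * prob {\<omega> \<in> space M. h (B \<omega>) \<le> A \<omega> \<and> B \<omega> \<in> D}"
proof -
  have [measurable]: "A \<in> borel_measurable M" "B \<in> borel_measurable M"
    using indep_var_rv1[OF ind] indep_var_rv2[OF ind] by auto
  have eq: "emeasure M {\<omega> \<in> space M. k (B \<omega>) \<le> A \<omega> \<and> B \<omega> \<in> D}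
      = (\<integral>\<^sup>+\<omega>. indicator D (B \<omega>) * ennreal (prob {\<omega>' \<in> space M. k (B \<omega>) \<le> A \<omega>'}) \<partial>M)"
    if [measurable]: "k \<in> borel_measurable borel" for k :: "real \<Rightarrow> real"
  proof -
    let ?\<phi> = "\<lambda>p :: real \<times> real. indicator {p. k (snd p) \<le> fst p \<and> snd p \<in> D} p :: ennreal"
    have "?\<phi> \<in> borel_measurable (borel \<Otimes>\<^sub>M borel)" by measurable
    then have meas: "?\<phi> \<in> borel_measurable borel" by (simp only: borel_prod)
    have "emeasure M {\<omega> \<in> space M. k (B \<omega>) \<le> A \<omega> \<and> B \<omega> \<in> D}
        = (\<integral>\<^sup>+\<omega>. indicator {\<omega> \<in> space M. k (B \<omega>) \<le> A \<omega> \<and> B \<omega> \<in> D} \<omega> \<partial>M)"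
      by (rule nn_integral_indicator[symmetric]) measurable
    also have "\<dots> = (\<integral>\<^sup>+\<omega>. ?\<phi> (A \<omega>, B \<omega>) \<partial>M)"
      by (intro nn_integral_cong) (auto simp: indicator_def)
    also have "\<dots> = (\<integral>\<^sup>+\<omega>. (\<integral>\<^sup>+x. ?\<phi> (x, B \<omega>) \<partial>(distr M borel A)) \<partial>M)"
      by (rule nn_integral_indep_var[OF ind meas])
    also have "\<dots> = (\<integral>\<^sup>+\<omega>. indicator D (B \<omega>) * ennreal (prob {\<omega>' \<in> space M. k (B \<omega>) \<le> A \<omega>'}) \<partial>M)"
    proof (rule nn_integral_cong)
      fix \<omega>
      have "(\<integral>\<^sup>+x. ?\<phi> (x, B \<omega>) \<partial>(distr M borel A)) = (\<integral>\<^sup>+x. indicator D (B \<omega>) * indicator {k (B \<omega>)..} x \<partial>(distr M borel A))"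
        by (intro nn_integral_cong) (auto simp: indicator_def)
      also have "\<dots> = indicator D (B \<omega>) * emeasure (distr M borel A) {k (B \<omega>)..}"
        by (simp add: nn_integral_cmult)
      also have "emeasure (distr M borel A) {k (B \<omega>)..} = ennreal (prob {\<omega>' \<in> space M. k (B \<omega>) \<le> A \<omega>'})"
        by (subst emeasure_distr) (auto simp: emeasure_eq_measure intro!: arg_cong[where f = prob])
      finally show "(\<integral>\<^sup>+x. ?\<phi> (x, B \<omega>) \<partial>(distr M borel A)) = indicator D (B \<omega>) * ennreal (prob {\<omega>' \<in> space M. k (B \<omega>) \<le> A \<omega>'})" .
    qed
    finally show ?thesis .
  qed
  have "emeasure M {\<omega> \<in> space M. g (B \<omega>) \<le> A \<omega> \<and> B \<omega> \<in> D}
      \<le> (\<integral>\<^sup>+\<omega>. ennreal K * (indicator D (B \<omega>) * ennreal (prob {\<omega>' \<in> space M. h (B \<omega>) \<le> A \<omega>'})) \<partial>M)"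
    unfolding eq[OF assms(3)] using le \<open>0 \<le> K\<close>
    by (intro nn_integral_mono) (auto simp: indicator_def simp flip: ennreal_mult intro!: ennreal_leI)
  also have "\<dots> = ennreal K * emeasure M {\<omega> \<in> space M. h (B \<omega>) \<le> A \<omega> \<and> B \<omega> \<in> D}"
    unfolding eq[OF assms(4)] by (rule nn_integral_cmult) measurable
  finally show ?thesis using \<open>0 \<le> K\<close> by (simp add: emeasure_eq_measure flip: ennreal_mult)
qed

lemma (in prob_space) indep_var_prob_Int:
  fixes A B :: "'a \<Rightarrow> real"
  assumes ind: "indep_var borel A borel B"
  shows "prob {\<omega> \<in> space M. x \<le> A \<omega> \<and> B \<omega> \<le> y} = prob {\<omega> \<in> space M. x \<le> A \<omega>} * prob {\<omega> \<in> space M. B \<omega> \<le> y}"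
proof -
  have "prob ((\<lambda>\<omega>. (A \<omega>, B \<omega>)) -` ({x..} \<times> {..y}) \<inter> space M) = prob (A -` {x..} \<inter> space M) * prob (B -` {..y} \<inter> space M)"
    by (rule indep_varD[OF ind]) auto
  moreover have "(\<lambda>\<omega>. (A \<omega>, B \<omega>)) -` ({x..} \<times> {..y}) \<inter> space M = {\<omega> \<in> space M. x \<le> A \<omega> \<and> B \<omega> \<le> y}"
    "A -` {x..} \<inter> space M = {\<omega> \<in> space M. x \<le> A \<omega>}" "B -` {..y} \<inter> space M = {\<omega> \<in> space M. B \<omega> \<le> y}" by auto
  ultimately show ?thesis by simp
qed

section \<open>The two-sample statistic\<close>

text \<open>\<open>W\<close> stands for the half squared differences, -b for the index of variation
  of their Laplace transform, r for the limit of m / n. \<open>saddle\<close> says that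
  \<Lambda>'(t) is stationary for 2 b r ln x - \<Lambda>*(x). \<open>shift\<close> packages the tail
  comparison, so that no density is mentioned below.\<close>

locale two_sample = prob_space M + X: iid_sequence M X F + W: iid_sequence M W G
  for M :: "'a measure" and X W :: "nat \<Rightarrow> 'a \<Rightarrow> real" and F G :: "real measure" +
  fixes b r t :: real and m n :: "nat \<Rightarrow> nat" and z :: "nat \<Rightarrow> real"
  assumes indep_sums: "\<And>i j. indep_var borel (X.psum i) borel (W.psum j)"
    and W_nonneg: "\<And>k \<omega>. 0 \<le> W k \<omega>"
    and b_pos: "0 < b"
    and laplace_rv: "\<And>k. 0 < k \<Longrightarrow>
      ((\<lambda>\<theta>. (LINT x|G. exp (- (k * \<theta>) * x)) / (LINT x|G. exp (- \<theta> * x))) \<longlongrightarrow> k powr (- b)) at_top"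
    and n_lim: "filterlim n at_top sequentially" and m_lim: "filterlim m at_top sequentially"
    and z_lim: "filterlim z at_top sequentially"
    and ratio_lim: "(\<lambda>N. real (m N) / real (n N)) \<longlonglongrightarrow> r" and r_pos: "0 < r"
    and t_int: "t \<in> interior (cgf_dom F)" and t_pos: "0 < t"
    and no_atoms: "\<And>x. measure F {x} = 0"
    and saddle: "t * deriv (cgf F) t = 2 * b * r"
    and shift: "\<And>a \<epsilon>. 0 < a \<Longrightarrow> 0 < \<epsilon> \<Longrightarrow> \<exists>\<delta>>0. eventually (\<lambda>k. \<forall>y.
      \<bar>y - real k * deriv (cgf F) t\<bar> \<le> real k * \<delta> \<longrightarrow>
      exp (t * a - \<epsilon>) * X.tail k y \<le> X.tail k (y - a) \<and>
      X.tail k (y - a) \<le> exp (t * a + \<epsilon>) * X.tail k y) sequentially"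
begin

definition L :: "real \<Rightarrow> real" where "L \<theta> = (LINT x|G. exp (- \<theta> * x))"
definition x0 :: real where "x0 = deriv (cgf F) t"
text \<open>The value at \<open>x0\<close> of the Legendre transform of \<Lambda>.\<close>

definition rate :: real where "rate = t * x0 - cgf F t"
definition T :: "nat \<Rightarrow> 'a \<Rightarrow> real" where "T N \<omega> = z N * sqrt (W.psum (m N) \<omega> / real (m N))"
text \<open>Regular variation of index -b suggests the mean b / \<theta> for \<open>W\<close> tilted
  by exp (-\<theta> x). At this \<theta> the corresponding value of \<open>T\<close> is z sqrt (b /
  \<theta>) = x0.\<close>

definition tilt :: "nat \<Rightarrow> real" where "tilt N = b * (z N)\<^sup>2 / x0\<^sup>2"
text \<open>The rejection event multiplied by n: the mean shift d becomes the shift a = n d of the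
  sum, which stays fixed in the limit.\<close>

definition rej :: "real \<Rightarrow> nat \<Rightarrow> real" where
  "rej a N = prob {\<omega> \<in> space M. real (n N) * T N \<omega> - a \<le> X.psum (n N) \<omega>}"

section \<open>The Laplace transform of \<open>W\<close> and the lower tail of
  \<open>T\<close>\<close>

lemma x0_pos: "0 < x0"
  using saddle t_pos b_pos r_pos unfolding x0_def by (metis mult_pos_pos zero_less_mult_pos zero_less_numeral)

lemma T_measurable [measurable]: "T N \<in> borel_measurable M"
  unfolding T_def[abs_def] by measurable

lemma psum_nonneg: "0 \<le> W.psum k \<omega>"
  unfolding W.psum_def by (intro sum_nonneg W_nonneg)

lemma T_nonneg: "0 < z N \<Longrightarrow> 0 \<le> T N \<omega>"
  unfolding T_def by (simp add: psum_nonneg)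

lemma AE_G_nonneg: "AE x in G. 0 \<le> x"
  unfolding W.law[of 1, simplified, symmetric]
  using W.Z_measurable[of 1] W_nonneg by (subst AE_distr_iff) auto

lemma L_integrable: "0 \<le> \<theta> \<Longrightarrow> integrable G (\<lambda>x. exp (- \<theta> * x))"
proof (rule W.F.integrable_const_bound[where B = 1])
  assume "0 \<le> \<theta>"
  show "AE x in G. norm (exp (- \<theta> * x)) \<le> 1"
    using AE_G_nonneg by eventually_elim (use \<open>0 \<le> \<theta>\<close> in simp)
qed (simp cong: measurable_cong_sets)

lemma L_pos: "0 \<le> \<theta> \<Longrightarrow> 0 < L \<theta>"
  using W.F.exp_moment_pos[of "- \<theta>"] L_integrable[of \<theta>] by (simp add: L_def cgf_dom_def)

lemma L_antimono: "0 \<le> \<theta> \<Longrightarrow> \<theta> \<le> \<theta>' \<Longrightarrow> L \<theta>' \<le> L \<theta>"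
  unfolding L_def
proof (rule integral_mono_AE)
  assume "0 \<le> \<theta>" "\<theta> \<le> \<theta>'"
  show "AE x in G. exp (- \<theta>' * x) \<le> exp (- \<theta> * x)"
    using AE_G_nonneg by eventually_elim (use \<open>\<theta> \<le> \<theta>'\<close> in \<open>simp add: mult_right_mono\<close>)
qed (use L_integrable in auto)

lemma L_le_1: "0 \<le> \<theta> \<Longrightarrow> L \<theta> \<le> 1"
  using L_antimono[of 0 \<theta>] W.F.prob_space by (simp add: L_def)

lemma L_rv: "0 < k \<Longrightarrow> ((\<lambda>\<theta>. L (k * \<theta>) / L \<theta>) \<longlongrightarrow> k powr (- b)) at_top"
  using laplace_rv unfolding L_def by simp

text \<open>For large \<theta> this is regular variation; on a bounded range L is at most 1 and
  bounded below by its value at the right end. The factor 4 corresponds to doubling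
  \<open>T\<close>, and iterating gives a growth bound valid for all scales at once.\<close>

lemma L_quarter: obtains A where "1 \<le> A" "\<And>\<theta>. 0 \<le> \<theta> \<Longrightarrow> L (\<theta> / 4) \<le> A * L \<theta>"
proof -
  define B where "B = (1/4) powr (- b) + 1"
  have "eventually (\<lambda>\<theta>. L (1/4 * \<theta>) / L \<theta> < B) at_top"
    using order_tendstoD(2)[OF L_rv[of "1/4"], of B] by (simp add: B_def)
  then obtain c where c: "\<And>\<theta>. c \<le> \<theta> \<Longrightarrow> L (1/4 * \<theta>) / L \<theta> < B" by (auto simp: eventually_at_top_linorder)
  define c' where "c' = max 0 c"
  define A where "A = max B (max 1 (1 / L c'))"
  have c': "0 \<le> c'" "c \<le> c'" by (auto simp: c'_def)
  show ?thesis
  proof (rule that[of A])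
    show "1 \<le> A" by (simp add: A_def)
    fix \<theta> :: real assume "0 \<le> \<theta>"
    show "L (\<theta> / 4) \<le> A * L \<theta>"
    proof (cases "c' \<le> \<theta>")
      case True
      have "L (1/4 * \<theta>) / L \<theta> \<le> A" using c[of \<theta>] True c' by (simp add: A_def)
      then show ?thesis using L_pos[OF \<open>0 \<le> \<theta>\<close>] by (simp add: pos_divide_le_eq)
    next
      case False
      have "1 / L c' * L c' \<le> A * L \<theta>"
        using False \<open>0 \<le> \<theta>\<close> L_pos[OF c'(1)] L_antimono[of \<theta> c'] by (intro mult_mono) (auto simp: A_def)
      then show ?thesis using L_le_1[of "\<theta> / 4"] \<open>0 \<le> \<theta>\<close> L_pos[OF c'(1)] by simp
    qed
  qed
qed

lemma eventually_pos: "eventually (\<lambda>N. 0 < n N \<and> 0 < m N \<and> 0 < z N) sequentially"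
  using filterlim_at_top_dense[THEN iffD1, OF z_lim, rule_format, of 0]
    eventually_compose_filterlim[OF eventually_gt_at_top[of 0] n_lim] eventually_compose_filterlim[OF eventually_gt_at_top[of 0] m_lim]
  by eventually_elim auto

lemma tilt_lim: "filterlim tilt at_top sequentially"
proof -
  have "filterlim (\<lambda>N. b / x0\<^sup>2 * (z N)\<^sup>2) at_top sequentially"
    using b_pos x0_pos
    by (intro filterlim_tendsto_pos_mult_at_top[OF tendsto_const] filterlim_pow_at_top z_lim) auto
  then show ?thesis unfolding tilt_def[abs_def] by simp
qed

text \<open>Chernoff's bound for \<open>W\<close> with \<theta> = b z^2 / w^2, the tilt adapted to
  the target value \<open>w\<close> of \<open>T\<close> in the way \<open>tilt\<close> is adapted to
  \<open>x0\<close>.\<close>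

lemma prob_T_le:
  assumes "0 < w" "0 < z N" "0 < m N"
  shows "prob {\<omega> \<in> space M. T N \<omega> \<le> w} \<le> exp (b * real (m N)) * L (b * (z N)\<^sup>2 / w\<^sup>2) ^ m N"
proof -
  let ?q = "b * (z N)\<^sup>2 / w\<^sup>2"
  have q: "0 < ?q" using assms b_pos by simp
  have "prob {\<omega> \<in> space M. T N \<omega> \<le> w} \<le> exp (- (- (b * real (m N)))) * (LINT x|G. exp (- ?q * x)) ^ m N"
  proof (rule W.exponential_markov)
    fix \<omega> assume "\<omega> \<in> {\<omega> \<in> space M. T N \<omega> \<le> w}"
    then have "(T N \<omega>)\<^sup>2 \<le> w\<^sup>2" using T_nonneg assms by (intro power_mono) auto
    moreover have "(T N \<omega>)\<^sup>2 = (z N)\<^sup>2 * (W.psum (m N) \<omega> / real (m N))"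
      unfolding T_def power_mult_distrib using psum_nonneg by simp
    ultimately have "(z N)\<^sup>2 * W.psum (m N) \<omega> \<le> w\<^sup>2 * real (m N)" using assms by (simp add: field_simps)
    then have "b * ((z N)\<^sup>2 * W.psum (m N) \<omega>) \<le> b * (w\<^sup>2 * real (m N))" using b_pos by (intro mult_left_mono) auto
    then have "?q * W.psum (m N) \<omega> \<le> b * real (m N)" using assms by (simp add: field_simps)
    then have "- (b * real (m N)) \<le> - ?q * W.psum (m N) \<omega>" by simp
    then show "- (b * real (m N)) \<le> (\<Sum>k=1..m N. - ?q * W k \<omega>)"
      unfolding W.psum_def sum_distrib_left .
  qed (use L_integrable[of ?q] q in auto)
  then show ?thesis by (simp add: L_def)
qed

text \<open>The tilts for \<open>w\<close> and for \<open>x0\<close> differ by the constant factor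
  (x0 / w)^2, whose power -b is exp (2 b ln (w / x0)). The bound is thus expressed through the
  common factor \<open>L (tilt N) ^ m N\<close>.\<close>

lemma prob_T_le_eventually:
  assumes "0 < w" "0 < \<epsilon>"
  shows "eventually (\<lambda>N. prob {\<omega> \<in> space M. T N \<omega> \<le> w}
    \<le> exp (real (m N) * (b + 2 * b * ln (w / x0) + \<epsilon>)) * L (tilt N) ^ m N) sequentially"
proof -
  let ?k = "(x0 / w)\<^sup>2"
  let ?c = "2 * b * ln (w / x0)"
  have k: "0 < ?k" using assms x0_pos by simp
  have "?k powr (- b) = exp (- b * (2 * ln (x0 / w)))"
    using k assms x0_pos by (simp add: powr_def ln_realpow)
  also have "- b * (2 * ln (x0 / w)) = ?c" using assms x0_pos by (simp add: ln_div algebra_simps)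
  finally have "?k powr (- b) < exp (?c + \<epsilon>)" using assms by simp
  then have "eventually (\<lambda>\<theta>. L (?k * \<theta>) / L \<theta> < exp (?c + \<epsilon>)) at_top"
    by (rule order_tendstoD(2)[OF L_rv[OF k]])
  then have "eventually (\<lambda>N. L (?k * tilt N) / L (tilt N) < exp (?c + \<epsilon>)) sequentially"
    by (rule eventually_compose_filterlim[OF _ tilt_lim])
  with eventually_pos show ?thesis
  proof eventually_elim
    case (elim N)
    have \<theta>: "0 \<le> tilt N" using b_pos by (simp add: tilt_def)
    have eq: "b * (z N)\<^sup>2 / w\<^sup>2 = ?k * tilt N" using x0_pos assms by (simp add: tilt_def power_divide)
    have "L (?k * tilt N) \<le> exp (?c + \<epsilon>) * L (tilt N)" using elim L_pos[OF \<theta>] by (simp add: pos_divide_less_eq)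
    moreover have "0 \<le> L (?k * tilt N)" using L_pos[of "?k * tilt N"] \<theta> k by simp
    ultimately have "L (?k * tilt N) ^ m N \<le> (exp (?c + \<epsilon>) * L (tilt N)) ^ m N" by (intro power_mono)
    then have "exp (b * real (m N)) * L (?k * tilt N) ^ m N \<le> exp (b * real (m N)) * (exp (?c + \<epsilon>) * L (tilt N)) ^ m N"
      by (intro mult_left_mono) auto
    also have "\<dots> = exp (b * real (m N) + real (m N) * (?c + \<epsilon>)) * L (tilt N) ^ m N"
      by (simp only: power_mult_distrib exp_add exp_of_nat_mult mult.assoc)
    also have "b * real (m N) + real (m N) * (?c + \<epsilon>) = real (m N) * (b + ?c + \<epsilon>)" by (simp add: algebra_simps)
    finally show ?case using prob_T_le[of w N] elim assms unfolding eq by linarith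
  qed
qed

text \<open>The tilted lower bound for \<open>W\<close>. Mean b / \<theta>, window \<eta> / \<theta>
  and increments \<sigma> \<theta> all scale with \<theta> = tilt N, so the two moment conditions
  become scale-free inequalities between powers of 1 - \<sigma>, 1 + \<sigma> and
  exponentials.\<close>

lemma prob_T_le_lower:
  assumes "0 < \<delta>" "0 < \<epsilon>"
  shows "eventually (\<lambda>N. exp (real (m N) * (b - \<epsilon>)) * L (tilt N) ^ m N \<le> prob {\<omega> \<in> space M. T N \<omega> \<le> x0 + \<delta>}) sequentially"
proof -
  \<comment> \<open>The second bound ensures that \<open>W\<close> in the window implies T^2 \<le>
    x0^2 + x0^2 \<eta> / b \<le> (x0 + \<delta>)^2.\<close>
  define \<eta> where "\<eta> = min (\<epsilon> / 2) (b * \<delta>\<^sup>2 / x0\<^sup>2)"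
  have \<eta>: "0 < \<eta>" "\<eta> \<le> \<epsilon> / 2" "x0\<^sup>2 * \<eta> / b \<le> \<delta>\<^sup>2"
    using assms b_pos x0_pos by (auto simp: \<eta>_def min_def field_simps)
  \<comment> \<open>With \<kappa> = \<sigma> \<eta> / 4 this makes the quadratic error 2 b
    \<sigma>^2 of the logarithm at most 2 \<kappa>; the linear gain \<sigma> \<eta> = 4 \<kappa>
    then leaves more than the required \<kappa>.\<close>
  define \<sigma> where "\<sigma> = min (1/2) (\<eta> / (4 * b))"
  have \<sigma>: "0 < \<sigma>" "\<sigma> \<le> 1/2" "2 * b * \<sigma> \<le> \<eta> / 2"
    using \<eta> b_pos by (auto simp: \<sigma>_def min_def field_simps)
  define \<kappa> where "\<kappa> = \<sigma> * \<eta> / 4"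
  have \<kappa>: "0 < \<kappa>" using \<sigma> \<eta> by (simp add: \<kappa>_def)
  have quad: "2 * b * \<sigma>\<^sup>2 \<le> 2 * \<kappa>"
    using mult_right_mono[OF \<sigma>(3), of \<sigma>] \<sigma>(1) by (simp add: \<kappa>_def power2_eq_square algebra_simps)
  have up: "eventually (\<lambda>N. L ((1 - \<sigma>) * tilt N) / L (tilt N) < exp (\<sigma> * (b + \<eta>) - \<kappa>)) sequentially"
  proof (rule eventually_compose_filterlim[OF order_tendstoD(2)[OF L_rv] tilt_lim])
    show "0 < 1 - \<sigma>" using \<sigma> by simp
    have "b * (- \<sigma> - 2 * \<sigma>\<^sup>2) \<le> b * ln (1 - \<sigma>)"
      using ln_one_minus_pos_lower_bound[of \<sigma>] \<sigma> b_pos by (intro mult_left_mono) auto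
    then have "- b * ln (1 - \<sigma>) < \<sigma> * (b + \<eta>) - \<kappa>"
      using quad \<kappa> \<sigma> by (simp add: \<kappa>_def algebra_simps)
    then show "(1 - \<sigma>) powr (- b) < exp (\<sigma> * (b + \<eta>) - \<kappa>)" using \<sigma> by (simp add: powr_def)
  qed
  have lo: "eventually (\<lambda>N. L ((1 + \<sigma>) * tilt N) / L (tilt N) < exp (- \<sigma> * (b - \<eta>) - \<kappa>)) sequentially"
  proof (rule eventually_compose_filterlim[OF order_tendstoD(2)[OF L_rv] tilt_lim])
    show "0 < 1 + \<sigma>" using \<sigma> by simp
    have "b * (\<sigma> - \<sigma>\<^sup>2) \<le> b * ln (1 + \<sigma>)"
      using ln_one_plus_pos_lower_bound[of \<sigma>] \<sigma> b_pos by (intro mult_left_mono) auto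
    then have "- b * ln (1 + \<sigma>) < - \<sigma> * (b - \<eta>) - \<kappa>"
      using quad \<kappa> \<sigma> b_pos by (simp add: \<kappa>_def algebra_simps)
    then show "(1 + \<sigma>) powr (- b) < exp (- \<sigma> * (b - \<eta>) - \<kappa>)" using \<sigma> by (simp add: powr_def)
  qed
  have "((\<lambda>k. 1 - 2 * exp (- \<kappa> * real k)) \<longlonglongrightarrow> 1)" using \<kappa> by real_asymp
  then have "eventually (\<lambda>k. 1/2 < 1 - 2 * exp (- \<kappa> * real k)) sequentially" by (rule order_tendstoD) simp
  then have half: "eventually (\<lambda>N. 1/2 < 1 - 2 * exp (- \<kappa> * real (m N))) sequentially"
    by (rule eventually_compose_filterlim[OF _ m_lim])
  have "((\<lambda>k. exp (- (\<epsilon> / 2) * real k)) \<longlonglongrightarrow> 0)" using \<open>0 < \<epsilon>\<close> by real_asymp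
  then have "eventually (\<lambda>k. exp (- (\<epsilon> / 2) * real k) < 1 / 2) sequentially" by (rule order_tendstoD) simp
  then have small: "eventually (\<lambda>N. exp (- (\<epsilon> / 2) * real (m N)) < 1 / 2) sequentially"
    by (rule eventually_compose_filterlim[OF _ m_lim])
  show ?thesis
    using up lo half small eventually_pos
  proof eventually_elim
    case (elim N)
    let ?\<theta> = "tilt N" and ?m = "real (m N)"
    have \<theta>: "0 < ?\<theta>" using b_pos x0_pos elim by (simp add: tilt_def)
    have "exp (- (?m * (- ?\<theta> * (b / ?\<theta>) + \<bar>- ?\<theta>\<bar> * (\<eta> / ?\<theta>)))) * (LINT x|G. exp (- ?\<theta> * x)) ^ m N * (1 - 2 * exp (- \<kappa> * ?m))
        \<le> prob {\<omega> \<in> space M. \<bar>W.psum (m N) \<omega> - ?m * (b / ?\<theta>)\<bar> \<le> ?m * (\<eta> / ?\<theta>)}"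
    proof (rule W.tilted_lower_bound)
      have e: "- ?\<theta> + \<sigma> * ?\<theta> = - ((1 - \<sigma>) * ?\<theta>)" "- ?\<theta> - \<sigma> * ?\<theta> = - ((1 + \<sigma>) * ?\<theta>)" by (simp_all add: algebra_simps)
      show "integrable G (\<lambda>x. exp (- ?\<theta> * x))" using L_integrable[of ?\<theta>] \<theta> by simp
      show "integrable G (\<lambda>x. exp ((- ?\<theta> + \<sigma> * ?\<theta>) * x))" unfolding e by (rule L_integrable) (use \<sigma> \<theta> in simp)
      show "integrable G (\<lambda>x. exp ((- ?\<theta> - \<sigma> * ?\<theta>) * x))" unfolding e by (rule L_integrable) (use \<sigma> \<theta> in simp)
      show "0 \<le> \<sigma> * ?\<theta>" "0 \<le> \<sigma> * ?\<theta>" using \<sigma> \<theta> by simp_all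
      have cancel: "exp (A - \<kappa>) * v * exp (- A) = exp (- \<kappa>) * v" for A v :: real
        by (simp add: exp_diff exp_minus field_simps)
      have s: "- (\<sigma> * ?\<theta>) * (b / ?\<theta> + \<eta> / ?\<theta>) = - (\<sigma> * (b + \<eta>))" "(\<sigma> * ?\<theta>) * (b / ?\<theta> - \<eta> / ?\<theta>) = \<sigma> * (b - \<eta>)"
        using \<theta> by (simp_all add: field_simps)
      have "L ((1 - \<sigma>) * ?\<theta>) \<le> exp (\<sigma> * (b + \<eta>) - \<kappa>) * L ?\<theta>" using elim L_pos[of ?\<theta>] \<theta> by (simp add: pos_divide_less_eq)
      then have "L ((1 - \<sigma>) * ?\<theta>) * exp (- (\<sigma> * (b + \<eta>))) \<le> exp (\<sigma> * (b + \<eta>) - \<kappa>) * L ?\<theta> * exp (- (\<sigma> * (b + \<eta>)))"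
        by (intro mult_right_mono) auto
      also have "\<dots> = exp (- \<kappa>) * L ?\<theta>" by (rule cancel)
      finally show "(LINT x|G. exp ((- ?\<theta> + \<sigma> * ?\<theta>) * x)) * exp (- (\<sigma> * ?\<theta>) * (b / ?\<theta> + \<eta> / ?\<theta>)) \<le> exp (- \<kappa>) * (LINT x|G. exp (- ?\<theta> * x))"
        unfolding e s L_def .
      have "L ((1 + \<sigma>) * ?\<theta>) \<le> exp (- \<sigma> * (b - \<eta>) - \<kappa>) * L ?\<theta>" using elim L_pos[of ?\<theta>] \<theta> by (simp add: pos_divide_less_eq)
      then have "L ((1 + \<sigma>) * ?\<theta>) * exp (\<sigma> * (b - \<eta>)) \<le> exp (- \<sigma> * (b - \<eta>) - \<kappa>) * L ?\<theta> * exp (\<sigma> * (b - \<eta>))"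
        by (intro mult_right_mono) auto
      also have "\<dots> = exp (- \<kappa>) * L ?\<theta>" using cancel[of "- \<sigma> * (b - \<eta>)" "L ?\<theta>"] by simp
      finally show "(LINT x|G. exp ((- ?\<theta> - \<sigma> * ?\<theta>) * x)) * exp ((\<sigma> * ?\<theta>) * (b / ?\<theta> - \<eta> / ?\<theta>)) \<le> exp (- \<kappa>) * (LINT x|G. exp (- ?\<theta> * x))"
        unfolding e s L_def .
    qed
    moreover have "- (?m * (- ?\<theta> * (b / ?\<theta>) + \<bar>- ?\<theta>\<bar> * (\<eta> / ?\<theta>))) = ?m * (b - \<eta>)"
      using \<theta> by (simp add: algebra_simps)
    ultimately have 1: "exp (?m * (b - \<eta>)) * L ?\<theta> ^ m N * (1 - 2 * exp (- \<kappa> * ?m))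
        \<le> prob {\<omega> \<in> space M. \<bar>W.psum (m N) \<omega> - ?m * (b / ?\<theta>)\<bar> \<le> ?m * (\<eta> / ?\<theta>)}" by (simp add: L_def)
    have "exp (?m * (b - \<epsilon>)) * L ?\<theta> ^ m N \<le> exp (?m * (b - \<eta>) + - (\<epsilon> / 2) * ?m) * L ?\<theta> ^ m N"
    proof (intro mult_right_mono)
      have "?m * \<eta> \<le> ?m * (\<epsilon> / 2)" using \<eta> by (intro mult_left_mono) auto
      then show "exp (?m * (b - \<epsilon>)) \<le> exp (?m * (b - \<eta>) + - (\<epsilon> / 2) * ?m)" by (simp add: algebra_simps)
    qed (use L_pos[of ?\<theta>] \<theta> in simp)
    also have "\<dots> = exp (?m * (b - \<eta>)) * L ?\<theta> ^ m N * exp (- (\<epsilon> / 2) * ?m)" unfolding exp_add by (simp only: mult_ac)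
    also have "\<dots> \<le> exp (?m * (b - \<eta>)) * L ?\<theta> ^ m N * (1 - 2 * exp (- \<kappa> * ?m))"
      using elim L_pos[of ?\<theta>] \<theta> by (intro mult_left_mono) auto
    also note 1
    also have "prob {\<omega> \<in> space M. \<bar>W.psum (m N) \<omega> - ?m * (b / ?\<theta>)\<bar> \<le> ?m * (\<eta> / ?\<theta>)} \<le> prob {\<omega> \<in> space M. T N \<omega> \<le> x0 + \<delta>}"
    proof (rule finite_measure_mono)
      show "{\<omega> \<in> space M. \<bar>W.psum (m N) \<omega> - ?m * (b / ?\<theta>)\<bar> \<le> ?m * (\<eta> / ?\<theta>)} \<subseteq> {\<omega> \<in> space M. T N \<omega> \<le> x0 + \<delta>}"
      proof safe
        fix \<omega> assume "\<bar>W.psum (m N) \<omega> - ?m * (b / ?\<theta>)\<bar> \<le> ?m * (\<eta> / ?\<theta>)"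
        then have "W.psum (m N) \<omega> \<le> ?m * (b / ?\<theta>) + ?m * (\<eta> / ?\<theta>)" by linarith
        also have "\<dots> = ?m * ((b + \<eta>) / ?\<theta>)" by (simp add: add_divide_distrib distrib_left)
        finally have "W.psum (m N) \<omega> / ?m \<le> (b + \<eta>) / ?\<theta>" using elim by (simp add: pos_divide_le_eq mult.commute)
        then have "(z N)\<^sup>2 * (W.psum (m N) \<omega> / ?m) \<le> (z N)\<^sup>2 * ((b + \<eta>) / ?\<theta>)" by (intro mult_left_mono) auto
        also have "\<dots> = x0\<^sup>2 + x0\<^sup>2 * \<eta> / b" using elim b_pos x0_pos by (simp add: tilt_def field_simps)
        also have "\<dots> \<le> (x0 + \<delta>)\<^sup>2" 
          using \<eta>(3) mult_pos_pos[OF x0_pos assms(1)] unfolding power2_sum by linarith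
        also have "(z N)\<^sup>2 * (W.psum (m N) \<omega> / ?m) = (T N \<omega>)\<^sup>2"
          unfolding T_def power_mult_distrib using psum_nonneg by simp
        finally show "T N \<omega> \<le> x0 + \<delta>" by (rule power2_le_imp_le) (use assms x0_pos in simp)
      qed
    qed measurable
    finally show ?case .
  qed
qed

section \<open>Localisation of \<open>T\<close> near \<open>x0\<close> given a rejection\<close>

lemma indep_T: "indep_var borel (X.psum i) borel (T N)"
proof -
  have "indep_var borel ((\<lambda>x. x) \<circ> X.psum i) borel ((\<lambda>y. z N * sqrt (y / real (m N))) \<circ> W.psum (m N))"
    by (rule indep_var_compose[OF indep_sums]) measurable
  then show ?thesis by (simp add: comp_def T_def[abs_def])
qed

text \<open>The benchmark for all error terms: a rejection occurs when T \<le> x0 + \<delta> and S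
  \<ge> n (x0 + \<delta>), two independent events. The Cramer bound reaches slightly above n x0, so
  the exponent is still \<open>rate\<close> up to \<epsilon>.\<close>

lemma base_lower_bound:
  assumes "0 < \<epsilon>"
  shows "eventually (\<lambda>N. exp (- real (n N) * (rate + \<epsilon>) + real (m N) * b) * L (tilt N) ^ m N \<le> rej 0 N) sequentially"
proof -
  obtain \<delta> where \<delta>: "0 < \<delta>" and ev: "eventually (\<lambda>k. \<forall>y \<le> real k * (deriv (cgf F) t + \<delta>).
      exp (- real k * (t * deriv (cgf F) t - cgf F t + \<epsilon> / 2)) \<le> X.tail k y) sequentially"
    using X.cramer_lower_bound[OF t_int t_pos no_atoms, of "\<epsilon> / 2"] assms by auto
  have ev_n: "eventually (\<lambda>N. \<forall>y \<le> real (n N) * (x0 + \<delta>).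
      exp (- real (n N) * (rate + \<epsilon> / 2)) \<le> X.tail (n N) y) sequentially"
    using eventually_compose_filterlim[OF ev n_lim] unfolding x0_def rate_def .
  \<comment> \<open>An error \<epsilon>' per observation in the m-sample is at most \<epsilon> / 2
    per observation in the n-sample, since m \<le> (r + 1) n eventually.\<close>
  define \<epsilon>' where "\<epsilon>' = \<epsilon> / (2 * (r + 1))"
  have \<epsilon>': "0 < \<epsilon>'" using assms r_pos by (simp add: \<epsilon>'_def)
  have "eventually (\<lambda>N. real (m N) / real (n N) < r + 1) sequentially"
    by (rule order_tendstoD(2)[OF ratio_lim]) simp
  with ev_n prob_T_le_lower[OF \<delta> \<epsilon>'] eventually_pos show ?thesis
  proof eventually_elim
    case (elim N)
    let ?n = "real (n N)" and ?m = "real (m N)"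
    have L0: "0 < L (tilt N)" using L_pos b_pos by (simp add: tilt_def)
    have "?m \<le> (r + 1) * ?n" using elim by (simp add: pos_divide_less_eq)
    then have "?m * \<epsilon>' \<le> (r + 1) * ?n * \<epsilon>'" using \<epsilon>' by (intro mult_right_mono) auto
    also have "\<dots> = ?n * \<epsilon> / 2" using r_pos by (simp add: \<epsilon>'_def field_simps)
    finally have "- ?n * (rate + \<epsilon>) + ?m * b \<le> - ?n * (rate + \<epsilon> / 2) + ?m * (b - \<epsilon>')"
      by (simp add: algebra_simps)
    then have "exp (- ?n * (rate + \<epsilon>) + ?m * b) * L (tilt N) ^ m N
        \<le> exp (- ?n * (rate + \<epsilon> / 2) + ?m * (b - \<epsilon>')) * L (tilt N) ^ m N"
      using L0 by (intro mult_right_mono) auto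
    also have "\<dots> = exp (- ?n * (rate + \<epsilon> / 2)) * (exp (?m * (b - \<epsilon>')) * L (tilt N) ^ m N)"
      unfolding exp_add by (rule mult.assoc)
    also have "\<dots> \<le> X.tail (n N) (?n * (x0 + \<delta>)) * prob {\<omega> \<in> space M. T N \<omega> \<le> x0 + \<delta>}"
      using elim L0 by (intro mult_mono) (auto simp: X.tail_def)
    also have "\<dots> = prob {\<omega> \<in> space M. ?n * (x0 + \<delta>) \<le> X.psum (n N) \<omega> \<and> T N \<omega> \<le> x0 + \<delta>}"
      unfolding X.tail_def by (rule indep_var_prob_Int[symmetric, OF indep_T])
    also have "\<dots> \<le> rej 0 N"
      unfolding rej_def
    proof (rule finite_measure_mono)
      show "{\<omega> \<in> space M. ?n * (x0 + \<delta>) \<le> X.psum (n N) \<omega> \<and> T N \<omega> \<le> x0 + \<delta>} \<subseteq> {\<omega> \<in> space M. ?n * T N \<omega> - 0 \<le> X.psum (n N) \<omega>}"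
      proof safe
        fix \<omega> assume \<omega>: "?n * (x0 + \<delta>) \<le> X.psum (n N) \<omega>" "T N \<omega> \<le> x0 + \<delta>"
        have "?n * T N \<omega> \<le> ?n * (x0 + \<delta>)" using \<omega> by (intro mult_left_mono) auto
        then show "?n * T N \<omega> - 0 \<le> X.psum (n N) \<omega>" using \<omega> by simp
      qed
    qed measurable
    finally show ?case .
  qed
qed

lemma rej_pos: "eventually (\<lambda>N. 0 < rej 0 N) sequentially"
  using base_lower_bound[of 1, simplified]
proof eventually_elim
  case (elim N)
  have "0 < L (tilt N)" using L_pos b_pos by (simp add: tilt_def)
  then have "0 < exp (- real (n N) * (rate + 1) + real (m N) * b) * L (tilt N) ^ m N" by simp
  then show ?case using elim by simp
qed

text \<open>On the strip, \<open>T\<close> is replaced by its lower end in the condition on the sum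
  and by its upper end in the condition on \<open>T\<close>; independence and Chernoff's bound do
  the rest.\<close>

lemma piece_bound:
  assumes "0 \<le> s" "s \<in> cgf_dom F"
  shows "prob {\<omega> \<in> space M. real (n N) * T N \<omega> - a \<le> X.psum (n N) \<omega> \<and> y \<le> T N \<omega> \<and> T N \<omega> \<le> w}
    \<le> exp (- s * (real (n N) * y - a) + real (n N) * cgf F s) * prob {\<omega> \<in> space M. T N \<omega> \<le> w}"
proof -
  let ?n = "real (n N)"
  have "prob {\<omega> \<in> space M. ?n * T N \<omega> - a \<le> X.psum (n N) \<omega> \<and> y \<le> T N \<omega> \<and> T N \<omega> \<le> w}
      \<le> prob {\<omega> \<in> space M. ?n * y - a \<le> X.psum (n N) \<omega> \<and> T N \<omega> \<le> w}"
  proof (rule finite_measure_mono)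
    show "{\<omega> \<in> space M. ?n * T N \<omega> - a \<le> X.psum (n N) \<omega> \<and> y \<le> T N \<omega> \<and> T N \<omega> \<le> w}
        \<subseteq> {\<omega> \<in> space M. ?n * y - a \<le> X.psum (n N) \<omega> \<and> T N \<omega> \<le> w}"
    proof safe
      fix \<omega> assume \<omega>: "?n * T N \<omega> - a \<le> X.psum (n N) \<omega>" "y \<le> T N \<omega>"
      have "?n * y \<le> ?n * T N \<omega>" using \<omega> by (intro mult_left_mono) auto
      then show "?n * y - a \<le> X.psum (n N) \<omega>" using \<omega> by simp
    qed
  qed measurable
  also have "\<dots> = X.tail (n N) (?n * y - a) * prob {\<omega> \<in> space M. T N \<omega> \<le> w}"
    unfolding X.tail_def by (rule indep_var_prob_Int[OF indep_T])
  also have "\<dots> \<le> exp (- s * (?n * y - a) + ?n * cgf F s) * prob {\<omega> \<in> space M. T N \<omega> \<le> w}"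
    by (intro mult_right_mono X.tail_chernoff assms) simp
  finally show ?thesis .
qed

text \<open>The expression in \<open>neg\<close> is the exponential rate, per unit of n, of the
  strip bound divided by the benchmark; exp (m b) and the power of L cancel in the quotient.\<close>

lemma piece_negligible:
  assumes "0 \<le> s" "s \<in> cgf_dom F" "0 < w" "0 < \<epsilon>"
    and neg: "- s * y + cgf F s + rate + 2 * b * r * ln (w / x0) < 0"
  shows "eventually (\<lambda>N. prob {\<omega> \<in> space M. real (n N) * T N \<omega> - a \<le> X.psum (n N) \<omega> \<and> y \<le> T N \<omega> \<and> T N \<omega> \<le> w}
    \<le> \<epsilon> * rej 0 N) sequentially"
proof -
  define \<gamma> where "\<gamma> = - s * y + cgf F s + rate + 2 * b * r * ln (w / x0)"
  \<comment> \<open>The errors \<open>e\<close> per observation from the benchmark and from the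
    lower tail of \<open>T\<close> add up to e (1 + r) = -\<gamma> / 4 in the limit, which keeps the
    rate below \<gamma> / 2.\<close>
  define e where "e = - \<gamma> / (4 * (1 + r))"
  define lw where "lw = 2 * b * ln (w / x0)"
  have \<gamma>: "\<gamma> < 0" using neg by (simp add: \<gamma>_def)
  have e: "0 < e" "e * (1 + r) = - \<gamma> / 4" using \<gamma> r_pos by (auto simp: e_def field_simps)
  have "(\<lambda>N. (- s * y + cgf F s + rate + e) + real (m N) / real (n N) * (lw + e))
      \<longlonglongrightarrow> (- s * y + cgf F s + rate + e) + r * (lw + e)"
    by (intro tendsto_intros ratio_lim)
  moreover have lim: "(- s * y + cgf F s + rate + e) + r * (lw + e) < \<gamma> / 2"
  proof -
    have "(- s * y + cgf F s + rate + e) + r * (lw + e) = \<gamma> + e * (1 + r)"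
      by (simp add: \<gamma>_def lw_def algebra_simps)
    then show ?thesis using e \<gamma> by simp
  qed
  ultimately have ev1: "eventually (\<lambda>N. (- s * y + cgf F s + rate + e) + real (m N) / real (n N) * (lw + e) < \<gamma> / 2) sequentially"
    by (rule order_tendstoD(2))
  have "(\<lambda>k. exp (s * a + real k * (\<gamma> / 2))) \<longlonglongrightarrow> 0" using \<gamma> by real_asymp
  then have "eventually (\<lambda>k. exp (s * a + real k * (\<gamma> / 2)) < \<epsilon>) sequentially" using \<open>0 < \<epsilon>\<close> by (rule order_tendstoD)
  then have ev2: "eventually (\<lambda>N. exp (s * a + real (n N) * (\<gamma> / 2)) < \<epsilon>) sequentially"
    by (rule eventually_compose_filterlim[OF _ n_lim])
  show ?thesis
    using ev1 ev2 base_lower_bound[OF e(1)] prob_T_le_eventually[OF \<open>0 < w\<close> e(1)] eventually_pos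
  proof eventually_elim
    case (elim N)
    let ?n = "real (n N)" and ?m = "real (m N)"
    let ?B = "exp (- ?n * (rate + e) + ?m * b) * L (tilt N) ^ m N"
    have B: "0 \<le> ?B" using L_pos[of "tilt N"] b_pos by (simp add: tilt_def)
    have "prob {\<omega> \<in> space M. ?n * T N \<omega> - a \<le> X.psum (n N) \<omega> \<and> y \<le> T N \<omega> \<and> T N \<omega> \<le> w}
      \<le> exp (- s * (?n * y - a) + ?n * cgf F s) * prob {\<omega> \<in> space M. T N \<omega> \<le> w}"
      by (rule piece_bound[OF assms(1,2)])
    also have "\<dots> \<le> exp (- s * (?n * y - a) + ?n * cgf F s) * (exp (?m * (b + lw + e)) * L (tilt N) ^ m N)"
      using elim(4) unfolding lw_def by (intro mult_left_mono) auto
    also have "\<dots> = exp (s * a + ?n * ((- s * y + cgf F s + rate + e) + ?m / ?n * (lw + e))) * ?B"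
    proof -
      have "?n * (?m / ?n * (lw + e)) = ?m * (lw + e)" using elim by simp
      then have "s * a + ?n * ((- s * y + cgf F s + rate + e) + ?m / ?n * (lw + e)) + (- ?n * (rate + e) + ?m * b)
          = (- s * (?n * y - a) + ?n * cgf F s) + ?m * (b + lw + e)"
        unfolding distrib_left by (simp add: algebra_simps)
      then show ?thesis by (simp only: mult.assoc[symmetric] exp_add[symmetric])
    qed
    also have "\<dots> \<le> exp (s * a + ?n * (\<gamma> / 2)) * ?B"
      using elim(1,5) B by (intro mult_right_mono) auto
    also have "\<dots> \<le> \<epsilon> * rej 0 N" using elim(2,3) B \<open>0 < \<epsilon>\<close> by (intro mult_mono) auto
    finally show ?case .
  qed
qed

text \<open>Cut the interval into strips so thin that s times the width is below
  \<open>\<kappa>\<close>: evaluating the linear term at the left end and the logarithm at the right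
  end of a strip then keeps the exponent negative. The right end is positive even when l =
  0.\<close>

lemma interval_negligible:
  assumes s: "0 \<le> s" "s \<in> cgf_dom F" and lu: "0 \<le> l" "l < u" and "0 < \<kappa>" "0 < \<epsilon>"
    and neg: "\<And>x. l \<le> x \<Longrightarrow> x \<le> u \<Longrightarrow> 0 < x \<Longrightarrow> - s * x + cgf F s + rate + 2 * b * r * ln (x / x0) \<le> - \<kappa>"
  shows "eventually (\<lambda>N. prob {\<omega> \<in> space M. real (n N) * T N \<omega> - a \<le> X.psum (n N) \<omega> \<and> l \<le> T N \<omega> \<and> T N \<omega> \<le> u}
    \<le> \<epsilon> * rej 0 N) sequentially"
proof -
  obtain K where K: "s * (u - l) / \<kappa> < real K" using reals_Archimedean2 by blast
  moreover have "0 \<le> s * (u - l) / \<kappa>" using assms by simp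
  ultimately have K0: "0 < real K" by linarith
  define \<eta> where "\<eta> = (u - l) / real K"
  have \<eta>: "0 < \<eta>" "s * \<eta> < \<kappa>" using K K0 lu \<open>0 < \<kappa>\<close> by (auto simp: \<eta>_def field_simps)
  have u: "u = l + real K * \<eta>" using K0 by (simp add: \<eta>_def)
  let ?P = "\<lambda>j N. {\<omega> \<in> space M. real (n N) * T N \<omega> - a \<le> X.psum (n N) \<omega> \<and> l + real j * \<eta> \<le> T N \<omega> \<and> T N \<omega> \<le> l + real (Suc j) * \<eta>}"
  have "eventually (\<lambda>N. \<forall>j\<in>{..<K}. prob (?P j N) \<le> \<epsilon> / real K * rej 0 N) sequentially"
  proof (rule eventually_ball_finite, simp, rule ballI)
    fix j assume j: "j \<in> {..<K}"
    let ?w = "l + real (Suc j) * \<eta>"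
    have "real (Suc j) * \<eta> \<le> real K * \<eta>" using j \<eta> by (intro mult_right_mono) auto
    then have w: "l \<le> ?w" "?w \<le> u" "0 < ?w" using \<eta> lu u by (auto intro!: add_nonneg_pos)
    have "- s * (l + real j * \<eta>) = - s * ?w + s * \<eta>" by (simp add: algebra_simps)
    then have "- s * (l + real j * \<eta>) + cgf F s + rate + 2 * b * r * ln (?w / x0) < 0" using neg[OF w] \<eta> by linarith
    then show "eventually (\<lambda>N. prob (?P j N) \<le> \<epsilon> / real K * rej 0 N) sequentially"
      using s w \<open>0 < \<epsilon>\<close> K0 by (intro piece_negligible) auto
  qed
  then show ?thesis
  proof eventually_elim
    case (elim N)
    let ?A = "{\<omega> \<in> space M. real (n N) * T N \<omega> - a \<le> X.psum (n N) \<omega> \<and> l \<le> T N \<omega> \<and> T N \<omega> \<le> u}"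
    have "?A \<subseteq> (\<Union>j\<in>{..<K}. ?P j N)"
    proof
      fix \<omega> assume \<omega>: "\<omega> \<in> ?A"
      define q where "q = (T N \<omega> - l) / \<eta>"
      have q: "0 \<le> q" "q \<le> real K" "T N \<omega> = l + q * \<eta>" using \<omega> \<eta> u by (auto simp: q_def field_simps)
      \<comment> \<open>The right end of the interval belongs to the last strip; the floor would
        give \<open>K\<close>, one too many.\<close>
      define j where "j = (if q = real K then K - 1 else nat \<lfloor>q\<rfloor>)"
      have j: "j < K" "real j \<le> q" "q \<le> real (Suc j)"
        using q K0 by (auto simp: j_def nat_less_iff floor_less_iff of_nat_diff) linarith+
      then show "\<omega> \<in> (\<Union>j\<in>{..<K}. ?P j N)"
        using \<omega> q(3) \<eta> by (auto intro!: bexI[of _ j] mult_right_mono simp del: of_nat_Suc)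
    qed
    then have "prob ?A \<le> prob (\<Union>j\<in>{..<K}. ?P j N)" by (intro finite_measure_mono) measurable
    also have "\<dots> \<le> (\<Sum>j<K. prob (?P j N))" by (intro finite_measure_subadditive_finite) auto
    also have "\<dots> \<le> (\<Sum>j<K. \<epsilon> / real K * rej 0 N)" using elim by (intro sum_mono) auto
    also have "\<dots> = \<epsilon> * rej 0 N" using K0 by simp
    finally show ?case .
  qed
qed

text \<open>Infinitely many strips must be summed for the same N, so bounds valid eventually in N
  for each strip do not suffice. The Chernoff bound for \<open>T\<close> and the iterated bound
  \<open>A_pow\<close> hold for all strips at once: each doubling costs m ln A, whereas the linear
  term gains n t x0 2^k, and a geometric series with ratio exp (-n) results.\<close>

lemma dyadic_tail_negligible:
  assumes "0 < \<epsilon>"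
  shows "\<exists>k0. \<forall>k\<ge>k0. eventually (\<lambda>N. prob {\<omega> \<in> space M. real (n N) * T N \<omega> - a \<le> X.psum (n N) \<omega> \<and> x0 * 2 ^ k \<le> T N \<omega>}
    \<le> \<epsilon> * rej 0 N) sequentially"
proof -
  obtain A where A: "1 \<le> A" "\<And>\<theta>. 0 \<le> \<theta> \<Longrightarrow> L (\<theta> / 4) \<le> A * L \<theta>" using L_quarter by blast
  have A_pow: "L (\<theta> / 4 ^ k) \<le> A ^ k * L \<theta>" if "0 \<le> \<theta>" for \<theta> k
  proof (induction k)
    case (Suc k)
    have "L (\<theta> / 4 ^ k / 4) \<le> A * L (\<theta> / 4 ^ k)" using that by (intro A(2)) auto
    also have "\<dots> \<le> A * (A ^ k * L \<theta>)" using Suc A by (intro mult_left_mono) auto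
    finally show ?case by (simp add: mult.commute[of 4] mult.assoc)
  qed simp
  define c where "c = t * x0"
  have c: "0 < c" using t_pos x0_pos by (simp add: c_def)
  \<comment> \<open>The exponent of strip k relative to the benchmark with \<epsilon> = 1, divided
    by -n, after m \<le> (r + 1) n; the last term reserves a decay of k + 1 for the geometric
    series.\<close>
  have "filterlim (\<lambda>k. c * 2 ^ k - (c + 1) - (r + 1) * ln A * real (Suc k) - real (Suc k)) at_top sequentially"
    using c by real_asymp
  then have "eventually (\<lambda>k. 0 \<le> c * 2 ^ k - (c + 1) - (r + 1) * ln A * real (Suc k) - real (Suc k)) sequentially"
    unfolding filterlim_at_top by (rule spec)
  then obtain k0 where k0: "\<And>k. k0 \<le> k \<Longrightarrow> 0 \<le> c * 2 ^ k - (c + 1) - (r + 1) * ln A * real (Suc k) - real (Suc k)"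
    by (auto simp: eventually_sequentially)
  have "eventually (\<lambda>N. prob {\<omega> \<in> space M. real (n N) * T N \<omega> - a \<le> X.psum (n N) \<omega> \<and> x0 * 2 ^ k1 \<le> T N \<omega>}
    \<le> \<epsilon> * rej 0 N) sequentially" if k1: "k0 \<le> k1" for k1
  proof -
    have "(\<lambda>k. exp (t * a) * (exp (- real k) / (1 - exp (- real k)))) \<longlonglongrightarrow> 0" by real_asymp
    then have "eventually (\<lambda>k. exp (t * a) * (exp (- real k) / (1 - exp (- real k))) < \<epsilon>) sequentially"
      using \<open>0 < \<epsilon>\<close> by (rule order_tendstoD)
    then have ev1: "eventually (\<lambda>N. exp (t * a) * (exp (- real (n N)) / (1 - exp (- real (n N)))) < \<epsilon>) sequentially"
      by (rule eventually_compose_filterlim[OF _ n_lim])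
    have ev2: "eventually (\<lambda>N. real (m N) / real (n N) < r + 1) sequentially"
      by (rule order_tendstoD(2)[OF ratio_lim]) simp
    show ?thesis
      using ev1 ev2 base_lower_bound[of 1, simplified] eventually_pos rej_pos
    proof eventually_elim
      case (elim N)
      let ?n = "real (n N)" and ?m = "real (m N)"
      let ?B = "exp (- ?n * (rate + 1) + ?m * b) * L (tilt N) ^ m N"
      have tl: "0 \<le> tilt N" using b_pos by (simp add: tilt_def)
      have B: "0 \<le> ?B" using L_pos[OF tl] by simp
      have mn: "?m \<le> (r + 1) * ?n" using elim by (simp add: pos_divide_less_eq)
      have td: "t \<in> cgf_dom F" using t_int interior_subset by auto
      let ?P = "\<lambda>j. {\<omega> \<in> space M. ?n * T N \<omega> - a \<le> X.psum (n N) \<omega> \<and> x0 * 2 ^ (k1 + j) \<le> T N \<omega> \<and> T N \<omega> \<le> x0 * 2 ^ Suc (k1 + j)}"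
      have piece: "prob (?P j) \<le> exp (t * a) * exp (- ?n) ^ Suc j * rej 0 N" for j
      proof -
        let ?k = "k1 + j"
        have "prob {\<omega> \<in> space M. T N \<omega> \<le> x0 * 2 ^ Suc ?k} \<le> exp (b * ?m) * L (b * (z N)\<^sup>2 / (x0 * 2 ^ Suc ?k)\<^sup>2) ^ m N"
          using elim x0_pos by (intro prob_T_le) auto
        also have "(2 ^ Suc ?k)\<^sup>2 = (4 :: real) ^ Suc ?k" by (simp add: power2_eq_square flip: power_mult_distrib)
        then have "b * (z N)\<^sup>2 / (x0 * 2 ^ Suc ?k)\<^sup>2 = tilt N / 4 ^ Suc ?k"
          unfolding power_mult_distrib tilt_def by simp
        also have "L (tilt N / 4 ^ Suc ?k) ^ m N \<le> (A ^ Suc ?k * L (tilt N)) ^ m N"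
          using L_pos[of "tilt N / 4 ^ Suc ?k"] tl by (intro power_mono A_pow) auto
        also have "A ^ Suc ?k = exp (real (Suc ?k) * ln A)" using A by (simp only: exp_of_nat_mult exp_ln)
        also have "(exp (real (Suc ?k) * ln A) * L (tilt N)) ^ m N = exp (?m * (real (Suc ?k) * ln A)) * L (tilt N) ^ m N"
          by (simp only: power_mult_distrib exp_of_nat_mult)
        finally have T_le: "prob {\<omega> \<in> space M. T N \<omega> \<le> x0 * 2 ^ Suc ?k}
            \<le> exp (b * ?m) * (exp (?m * (real (Suc ?k) * ln A)) * L (tilt N) ^ m N)" by simp
        have "prob (?P j) \<le> exp (- t * (?n * (x0 * 2 ^ ?k) - a) + ?n * cgf F t) * prob {\<omega> \<in> space M. T N \<omega> \<le> x0 * 2 ^ Suc ?k}"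
          using t_pos td by (intro piece_bound) auto
        also have "\<dots> \<le> exp (- t * (?n * (x0 * 2 ^ ?k) - a) + ?n * cgf F t) * (exp (b * ?m) * (exp (?m * (real (Suc ?k) * ln A)) * L (tilt N) ^ m N))"
          using T_le by (intro mult_left_mono) auto
        also have "\<dots> = exp ((t * a + ?n * (c + 1 - c * 2 ^ ?k) + ?m * (real (Suc ?k) * ln A)) + (- ?n * (rate + 1) + ?m * b)) * L (tilt N) ^ m N"
        proof -
          have "(t * a + ?n * (c + 1 - c * 2 ^ ?k) + ?m * (real (Suc ?k) * ln A)) + (- ?n * (rate + 1) + ?m * b)
              = (- t * (?n * (x0 * 2 ^ ?k) - a) + ?n * cgf F t) + (b * ?m + ?m * (real (Suc ?k) * ln A))"
            unfolding c_def rate_def by (simp add: algebra_simps)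
          then show ?thesis by (simp only: mult.assoc exp_add)
        qed
        also have "\<dots> = exp (t * a + ?n * (c + 1 - c * 2 ^ ?k) + ?m * (real (Suc ?k) * ln A)) * ?B"
          unfolding exp_add[of "t * a + ?n * (c + 1 - c * 2 ^ ?k) + ?m * (real (Suc ?k) * ln A)"] by (rule mult.assoc)
        also have "\<dots> \<le> exp (t * a + ?n * (- real (Suc j))) * ?B"
        proof (intro mult_right_mono B)
          have "?m * (real (Suc ?k) * ln A) \<le> (r + 1) * ?n * (real (Suc ?k) * ln A)"
            using mn A by (intro mult_right_mono) auto
          also have "\<dots> = ?n * ((r + 1) * ln A * real (Suc ?k))" by simp
          finally have "?n * (c + 1 - c * 2 ^ ?k) + ?m * (real (Suc ?k) * ln A)
              \<le> ?n * (c + 1 - c * 2 ^ ?k + (r + 1) * ln A * real (Suc ?k))" by (simp add: distrib_left)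
          also have "\<dots> \<le> ?n * (- real (Suc j))"
            using k0[of ?k] k1 by (intro mult_left_mono) auto
          finally show "exp (t * a + ?n * (c + 1 - c * 2 ^ ?k) + ?m * (real (Suc ?k) * ln A)) \<le> exp (t * a + ?n * (- real (Suc j)))"
            by simp
        qed
        also have "\<dots> \<le> exp (t * a + ?n * (- real (Suc j))) * rej 0 N" using elim by (intro mult_left_mono) auto
        also have "exp (t * a + ?n * (- real (Suc j))) = exp (t * a) * exp (- ?n) ^ Suc j"
          by (simp only: exp_add exp_of_nat2_mult[symmetric] mult_minus_left mult_minus_right)
        finally show ?thesis .
      qed
      have q: "exp (- ?n) < 1" using elim by simp
      have gs: "(\<lambda>j. exp (t * a) * exp (- ?n) ^ Suc j * rej 0 N) sums (exp (t * a) * (exp (- ?n) * (1 / (1 - exp (- ?n)))) * rej 0 N)"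
        unfolding power_Suc using q by (intro sums_mult sums_mult2 geometric_sums) auto
      have summ: "summable (\<lambda>j. prob (?P j))"
        by (rule summable_comparison_test'[OF sums_summable[OF gs]]) (use piece in auto)
      have "prob {\<omega> \<in> space M. ?n * T N \<omega> - a \<le> X.psum (n N) \<omega> \<and> x0 * 2 ^ k1 \<le> T N \<omega>} \<le> prob (\<Union>j. ?P j)"
      proof (rule finite_measure_mono)
        show "{\<omega> \<in> space M. ?n * T N \<omega> - a \<le> X.psum (n N) \<omega> \<and> x0 * 2 ^ k1 \<le> T N \<omega>} \<subseteq> (\<Union>j. ?P j)"
        proof
          fix \<omega> assume \<omega>: "\<omega> \<in> {\<omega> \<in> space M. ?n * T N \<omega> - a \<le> X.psum (n N) \<omega> \<and> x0 * 2 ^ k1 \<le> T N \<omega>}"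
          have "\<exists>i. T N \<omega> \<le> x0 * 2 ^ Suc (k1 + i)"
          proof -
            obtain i where "T N \<omega> / x0 < 2 ^ i" using real_arch_pow[of 2 "T N \<omega> / x0"] by auto
            then have "T N \<omega> < x0 * 2 ^ i" using x0_pos by (simp add: pos_divide_less_eq mult.commute)
            also have "\<dots> \<le> x0 * 2 ^ Suc (k1 + i)" using x0_pos by (intro mult_left_mono power_increasing) auto
            finally show ?thesis by (intro exI[of _ i]) simp
          qed
          then obtain j where j: "T N \<omega> \<le> x0 * 2 ^ Suc (k1 + j)" "\<And>i. i < j \<Longrightarrow> \<not> T N \<omega> \<le> x0 * 2 ^ Suc (k1 + i)"
            using exists_least_iff[of "\<lambda>i. T N \<omega> \<le> x0 * 2 ^ Suc (k1 + i)"] by auto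
          have "x0 * 2 ^ (k1 + j) \<le> T N \<omega>"
          proof (cases j)
            case 0 then show ?thesis using \<omega> by simp
          next
            case (Suc i) then show ?thesis using j(2)[of i] by simp
          qed
          then show "\<omega> \<in> (\<Union>j. ?P j)" using \<omega> j(1) by auto
        qed
      qed measurable
      also have "\<dots> \<le> (\<Sum>j. prob (?P j))"
        using summ by (intro finite_measure_subadditive_countably) auto
      also have "\<dots> \<le> exp (t * a) * (exp (- ?n) * (1 / (1 - exp (- ?n)))) * rej 0 N"
        using suminf_le[OF piece summ sums_summable[OF gs]] sums_unique[OF gs] by simp
      also have "\<dots> \<le> \<epsilon> * rej 0 N" using elim by (intro mult_right_mono) auto
      finally show ?case .
    qed
  qed
  then show ?thesis by blast
qed

text \<open>For the exponent \<open>x \<mapsto> 2 b r ln x - \<Lambda>* x\<close>, maximal at \<open>x0\<close>, this bounds the loss away from \<open>x0\<close>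
  uniformly, replacing the Legendre transform \<open>\<Lambda>*\<close> by a single tangent.\<close>

lemma exponent_gap:
  assumes s: "s \<in> interior (cgf_dom F)" and "0 < x"
  shows "- s * x + cgf F s + rate + 2 * b * r * ln (x / x0) \<le> (s - t) * (deriv (cgf F) s - x)"
proof -
  have "ln (x / x0) \<le> x / x0 - 1" using assms x0_pos by (intro ln_le_minus_one) simp
  then have "(t * x0) * ln (x / x0) \<le> (t * x0) * (x / x0 - 1)" using t_pos x0_pos by (intro mult_left_mono) auto
  also have "\<dots> = t * x - t * x0" using x0_pos by (simp add: field_simps)
  finally have 1: "2 * b * r * ln (x / x0) \<le> t * x - t * x0" using saddle by (simp add: x0_def)
  have "cgf F s - cgf F t \<le> deriv (cgf F) s * (s - t)"
    by (rule X.F.cgf_le_tangent[OF t_int s no_atoms])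
  with 1 show ?thesis unfolding rate_def by (simp add: algebra_simps)
qed

text \<open>Three regions: left of the window with a parameter s < t, right of it up to
  \<open>u\<close> with s > t, and beyond \<open>u\<close> by the dyadic bound. One fixed s per side
  suffices, since with \<Lambda>'(s) within \<delta>' / 2 of \<open>x0\<close> the exponent gap is
  at most -|s - t| \<delta>' / 2 throughout the region.\<close>

lemma concentration:
  assumes "0 < \<delta>" "0 < \<epsilon>"
  shows "eventually (\<lambda>N. prob {\<omega> \<in> space M. real (n N) * T N \<omega> - a \<le> X.psum (n N) \<omega> \<and> T N \<omega> \<notin> {x0 - \<delta>..x0 + \<delta>}}
    \<le> \<epsilon> * rej 0 N) sequentially"
proof -
  \<comment> \<open>The cap x0 / 2 keeps x0 - \<delta>' positive, so that the left region is a
    proper interval, and x0 + \<delta>' below \<open>u\<close>.\<close>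
  define \<delta>' where "\<delta>' = min \<delta> (x0 / 2)"
  have \<delta>': "0 < \<delta>'" "\<delta>' \<le> \<delta>" "\<delta>' \<le> x0 / 2" using assms x0_pos by (auto simp: \<delta>'_def)
  define E where "E N P = {\<omega> \<in> space M. real (n N) * T N \<omega> - a \<le> X.psum (n N) \<omega> \<and> P (T N \<omega>)}" for N and P :: "real \<Rightarrow> bool"
  have cont: "(deriv (cgf F) \<longlongrightarrow> x0) (at t)"
    using X.F.cgf_deriv_continuous[OF t_int] unfolding isCont_def x0_def .
  have dom: "eventually (\<lambda>s. s \<in> interior (cgf_dom F)) (at t)"
    using t_int by (intro eventually_at_in_open') auto
  have \<epsilon>3: "0 < \<epsilon> / 3" using assms by simp
  obtain k0 where k0: "\<And>k. k0 \<le> k \<Longrightarrow> eventually (\<lambda>N. prob (E N (\<lambda>x. x0 * 2 ^ k \<le> x)) \<le> \<epsilon> / 3 * rej 0 N) sequentially"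
    using dyadic_tail_negligible[OF \<epsilon>3, of a] unfolding E_def by auto
  define u where "u = x0 * 2 ^ Suc k0"
  have u: "x0 + \<delta>' < u" "eventually (\<lambda>N. prob (E N (\<lambda>x. u \<le> x)) \<le> \<epsilon> / 3 * rej 0 N) sequentially"
  proof -
    have "x0 * 2 \<le> x0 * 2 ^ Suc k0" using x0_pos by (intro mult_left_mono) auto
    then show "x0 + \<delta>' < u" unfolding u_def using \<delta>' x0_pos by linarith
  qed (use k0[of "Suc k0"] in \<open>simp add: u_def\<close>)
  have right: "eventually (\<lambda>N. prob (E N (\<lambda>x. x0 + \<delta>' \<le> x \<and> x \<le> u)) \<le> \<epsilon> / 3 * rej 0 N) sequentially"
  proof -
    have "eventually (\<lambda>s. deriv (cgf F) s < x0 + \<delta>' / 2 \<and> s \<in> interior (cgf_dom F) \<and> t < s) (at_right t)"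
      using filter_leD[OF at_le[OF subset_UNIV] order_tendstoD(2)[OF cont, of "x0 + \<delta>' / 2"]]
        filter_leD[OF at_le[OF subset_UNIV] dom] eventually_at_right_less[of t] \<delta>'
      by (auto simp: eventually_conj_iff)
    then obtain s where s: "deriv (cgf F) s < x0 + \<delta>' / 2" "s \<in> interior (cgf_dom F)" "t < s"
      by (auto dest!: eventually_happens'[OF trivial_limit_at_right_real])
    show ?thesis unfolding E_def
    proof (rule interval_negligible[of s _ _ "(s - t) * (\<delta>' / 2)"])
      show "s \<in> cgf_dom F" using s interior_subset by auto
      fix x assume x: "x0 + \<delta>' \<le> x" "0 < x"
      have "(s - t) * (deriv (cgf F) s - x) \<le> (s - t) * (- (\<delta>' / 2))" using s x by (intro mult_left_mono) auto
      then show "- s * x + cgf F s + rate + 2 * b * r * ln (x / x0) \<le> - ((s - t) * (\<delta>' / 2))"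
        using exponent_gap[OF s(2) x(2)] by simp
    qed (use s t_pos x0_pos \<delta>' u assms in auto)
  qed
  have left: "eventually (\<lambda>N. prob (E N (\<lambda>x. 0 \<le> x \<and> x \<le> x0 - \<delta>')) \<le> \<epsilon> / 3 * rej 0 N) sequentially"
  proof -
    have "eventually (\<lambda>s. s \<in> {0<..<t}) (at_left t)" using t_pos by (intro eventually_at_leftI[of 0]) auto
    then have "eventually (\<lambda>s. x0 - \<delta>' / 2 < deriv (cgf F) s \<and> s \<in> interior (cgf_dom F) \<and> 0 < s \<and> s < t) (at_left t)"
      using filter_leD[OF at_le[OF subset_UNIV] order_tendstoD(1)[OF cont, of "x0 - \<delta>' / 2"]]
        filter_leD[OF at_le[OF subset_UNIV] dom] \<delta>'
      by (auto simp: eventually_conj_iff)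
    then obtain s where s: "x0 - \<delta>' / 2 < deriv (cgf F) s" "s \<in> interior (cgf_dom F)" "0 < s" "s < t"
      by (auto dest!: eventually_happens'[OF trivial_limit_at_left_real])
    show ?thesis unfolding E_def
    proof (rule interval_negligible[of s _ _ "(t - s) * (\<delta>' / 2)"])
      show "s \<in> cgf_dom F" using s interior_subset by auto
      fix x assume x: "x \<le> x0 - \<delta>'" "0 < x"
      have "(t - s) * (\<delta>' / 2) \<le> (t - s) * (deriv (cgf F) s - x)" using s x by (intro mult_left_mono) auto
      then show "- s * x + cgf F s + rate + 2 * b * r * ln (x / x0) \<le> - ((t - s) * (\<delta>' / 2))"
        using exponent_gap[OF s(2) x(2)] by (simp add: algebra_simps)
    qed (use s x0_pos \<delta>' assms in auto)
  qed
  show ?thesis using left right u(2) eventually_pos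
  proof eventually_elim
    case (elim N)
    have [measurable]: "E N (\<lambda>x. 0 \<le> x \<and> x \<le> x0 - \<delta>') \<in> events" "E N (\<lambda>x. x0 + \<delta>' \<le> x \<and> x \<le> u) \<in> events" "E N (\<lambda>x. u \<le> x) \<in> events"
      unfolding E_def by measurable
    have "prob {\<omega> \<in> space M. real (n N) * T N \<omega> - a \<le> X.psum (n N) \<omega> \<and> T N \<omega> \<notin> {x0 - \<delta>..x0 + \<delta>}}
        \<le> prob (E N (\<lambda>x. 0 \<le> x \<and> x \<le> x0 - \<delta>') \<union> (E N (\<lambda>x. x0 + \<delta>' \<le> x \<and> x \<le> u) \<union> E N (\<lambda>x. u \<le> x)))"
      using \<delta>'(2) T_nonneg[of N] elim by (intro finite_measure_mono) (auto simp: E_def)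
    also have "\<dots> \<le> prob (E N (\<lambda>x. 0 \<le> x \<and> x \<le> x0 - \<delta>')) + prob (E N (\<lambda>x. x0 + \<delta>' \<le> x \<and> x \<le> u) \<union> E N (\<lambda>x. u \<le> x))"
      by (intro measure_Un_le) measurable
    also have "prob (E N (\<lambda>x. x0 + \<delta>' \<le> x \<and> x \<le> u) \<union> E N (\<lambda>x. u \<le> x)) \<le> prob (E N (\<lambda>x. x0 + \<delta>' \<le> x \<and> x \<le> u)) + prob (E N (\<lambda>x. u \<le> x))"
      by (intro measure_Un_le) measurable
    finally show ?case using elim by linarith
  qed
qed

text \<open>Inside the window the tail comparison holds for every value of \<open>T\<close> and is
  integrated by independence. Outside, the shifted and the unshifted event are both at most
  \<epsilon> times \<open>rej 0 N\<close>; this produces the factor 1 - \<epsilon> in the lower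
  bound and the summand \<epsilon> in the upper one.\<close>

lemma rej_ratio:
  assumes "0 < a"
  shows "(\<lambda>N. rej a N / rej 0 N) \<longlonglongrightarrow> exp (t * a)"
proof -
  have bounds: "eventually (\<lambda>N. (1 - \<epsilon>) * exp (t * a - \<epsilon>) \<le> rej a N / rej 0 N \<and> rej a N / rej 0 N \<le> exp (t * a + \<epsilon>) + \<epsilon>) sequentially"
    if eps: "0 < \<epsilon>" for \<epsilon>
  proof -
    obtain \<delta> where "0 < \<delta>" and ev: "eventually (\<lambda>k. \<forall>y. \<bar>y - real k * x0\<bar> \<le> real k * \<delta> \<longrightarrow>
      exp (t * a - \<epsilon>) * X.tail k y \<le> X.tail k (y - a) \<and> X.tail k (y - a) \<le> exp (t * a + \<epsilon>) * X.tail k y) sequentially"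
      using shift[OF assms eps] unfolding x0_def by auto
    show ?thesis
      using eventually_compose_filterlim[OF ev n_lim] concentration[OF \<open>0 < \<delta>\<close> eps, of 0] concentration[OF \<open>0 < \<delta>\<close> eps, of a] rej_pos
    proof eventually_elim
      case (elim N)
      let ?n = "real (n N)" and ?D = "{x0 - \<delta>..x0 + \<delta>}"
      define I where "I c = prob {\<omega> \<in> space M. ?n * T N \<omega> - c \<le> X.psum (n N) \<omega> \<and> T N \<omega> \<in> ?D}" for c
      define O' where "O' c = prob {\<omega> \<in> space M. ?n * T N \<omega> - c \<le> X.psum (n N) \<omega> \<and> T N \<omega> \<notin> ?D}" for c
      have split: "rej c N = I c + O' c" for c
      proof -
        have "rej c N = prob ({\<omega> \<in> space M. ?n * T N \<omega> - c \<le> X.psum (n N) \<omega> \<and> T N \<omega> \<in> ?D}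
            \<union> {\<omega> \<in> space M. ?n * T N \<omega> - c \<le> X.psum (n N) \<omega> \<and> T N \<omega> \<notin> ?D})"
          unfolding rej_def by (rule arg_cong[where f = prob]) auto
        also have "\<dots> = I c + O' c" unfolding I_def O'_def by (intro finite_measure_Union) auto
        finally show ?thesis .
      qed
      have near: "\<bar>?n * \<tau> - ?n * x0\<bar> \<le> ?n * \<delta>" if "\<tau> \<in> ?D" for \<tau>
      proof -
        have "\<bar>?n * (\<tau> - x0)\<bar> \<le> ?n * \<delta>" using that unfolding abs_mult by (intro mult_mono) auto
        then show ?thesis by (simp add: right_diff_distrib)
      qed
      have "I a \<le> exp (t * a + \<epsilon>) * I 0" unfolding I_def
      proof (rule indep_compare[OF indep_T])
        fix \<tau> assume "\<tau> \<in> ?D"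
        then show "prob {\<omega> \<in> space M. ?n * \<tau> - a \<le> X.psum (n N) \<omega>} \<le> exp (t * a + \<epsilon>) * prob {\<omega> \<in> space M. ?n * \<tau> - 0 \<le> X.psum (n N) \<omega>}"
          using elim(1) near[of \<tau>] by (simp add: X.tail_def)
      qed auto
      moreover have "I 0 \<le> exp (- (t * a - \<epsilon>)) * I a" unfolding I_def
      proof (rule indep_compare[OF indep_T])
        fix \<tau> assume "\<tau> \<in> ?D"
        then have "exp (t * a - \<epsilon>) * X.tail (n N) (?n * \<tau>) \<le> X.tail (n N) (?n * \<tau> - a)" using elim(1) near[of \<tau>] by simp
        then have "exp (- (t * a - \<epsilon>)) * (exp (t * a - \<epsilon>) * X.tail (n N) (?n * \<tau>)) \<le> exp (- (t * a - \<epsilon>)) * X.tail (n N) (?n * \<tau> - a)"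
          by (intro mult_left_mono) auto
        moreover have "exp (- (t * a - \<epsilon>)) * (exp (t * a - \<epsilon>) * X.tail (n N) (?n * \<tau>)) = X.tail (n N) (?n * \<tau>)"
          unfolding mult.assoc[symmetric] exp_add[symmetric] by simp
        ultimately have "X.tail (n N) (?n * \<tau>) \<le> exp (- (t * a - \<epsilon>)) * X.tail (n N) (?n * \<tau> - a)" by linarith
        then show "prob {\<omega> \<in> space M. ?n * \<tau> - 0 \<le> X.psum (n N) \<omega>} \<le> exp (- (t * a - \<epsilon>)) * prob {\<omega> \<in> space M. ?n * \<tau> - a \<le> X.psum (n N) \<omega>}"
          by (simp add: X.tail_def)
      qed auto
      then have "exp (t * a - \<epsilon>) * I 0 \<le> exp (t * a - \<epsilon>) * (exp (- (t * a - \<epsilon>)) * I a)" by (intro mult_left_mono) auto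
      then have "exp (t * a - \<epsilon>) * I 0 \<le> I a" unfolding mult.assoc[symmetric] exp_add[symmetric] by simp
      moreover have O: "0 \<le> O' 0" "0 \<le> O' a" "O' 0 \<le> \<epsilon> * rej 0 N" "O' a \<le> \<epsilon> * rej 0 N"
        using elim unfolding O'_def by auto
      ultimately have I: "I a \<le> exp (t * a + \<epsilon>) * I 0" "exp (t * a - \<epsilon>) * I 0 \<le> I a" by auto
      have "exp (t * a + \<epsilon>) * I 0 \<le> exp (t * a + \<epsilon>) * rej 0 N" using split[of 0] O by (intro mult_left_mono) auto
      then have 1: "rej a N \<le> (exp (t * a + \<epsilon>) + \<epsilon>) * rej 0 N"
        unfolding distrib_right using split[of a] I O by linarith
      have "(1 - \<epsilon>) * rej 0 N \<le> I 0" unfolding left_diff_distrib using split[of 0] O by linarith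
      then have "exp (t * a - \<epsilon>) * ((1 - \<epsilon>) * rej 0 N) \<le> exp (t * a - \<epsilon>) * I 0" by (intro mult_left_mono) auto
      then have "exp (t * a - \<epsilon>) * ((1 - \<epsilon>) * rej 0 N) \<le> rej a N" using split[of a] I O by linarith
      then have 2: "(1 - \<epsilon>) * exp (t * a - \<epsilon>) * rej 0 N \<le> rej a N" by (simp only: mult_ac)
      show ?case using 1 2 elim(4) by (simp add: pos_le_divide_eq pos_divide_le_eq)
    qed
  qed
  show ?thesis
  proof (rule order_tendstoI)
    fix l assume l: "l < exp (t * a)"
    have "((\<lambda>\<epsilon>. (1 - \<epsilon>) * exp (t * a - \<epsilon>)) \<longlongrightarrow> (1 - 0) * exp (t * a - 0)) (at_right 0)" by (intro tendsto_intros)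
    then have "eventually (\<lambda>\<epsilon>. l < (1 - \<epsilon>) * exp (t * a - \<epsilon>)) (at_right 0)" using l by (intro order_tendstoD) auto
    then have "eventually (\<lambda>\<epsilon>. l < (1 - \<epsilon>) * exp (t * a - \<epsilon>) \<and> 0 < \<epsilon>) (at_right 0)"
      using eventually_at_right_less[of 0] by eventually_elim auto
    then obtain \<epsilon> where \<epsilon>: "l < (1 - \<epsilon>) * exp (t * a - \<epsilon>)" "0 < \<epsilon>"
      by (auto dest!: eventually_happens'[OF trivial_limit_at_right_real])
    show "eventually (\<lambda>N. l < rej a N / rej 0 N) sequentially"
      using bounds[OF \<epsilon>(2)] by eventually_elim (use \<epsilon> in linarith)
  next
    fix l assume l: "exp (t * a) < l"
    have "((\<lambda>\<epsilon>. exp (t * a + \<epsilon>) + \<epsilon>) \<longlongrightarrow> exp (t * a + 0) + 0) (at_right 0)" by (intro tendsto_intros)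
    then have "eventually (\<lambda>\<epsilon>. exp (t * a + \<epsilon>) + \<epsilon> < l) (at_right 0)" using l by (intro order_tendstoD) auto
    then have "eventually (\<lambda>\<epsilon>. exp (t * a + \<epsilon>) + \<epsilon> < l \<and> 0 < \<epsilon>) (at_right 0)"
      using eventually_at_right_less[of 0] by eventually_elim auto
    then obtain \<epsilon> where \<epsilon>: "exp (t * a + \<epsilon>) + \<epsilon> < l" "0 < \<epsilon>"
      by (auto dest!: eventually_happens'[OF trivial_limit_at_right_real])
    show "eventually (\<lambda>N. rej a N / rej 0 N < l) sequentially"
      using bounds[OF \<epsilon>(2)] by eventually_elim (use \<epsilon> in linarith)
  qed
qed

end

section \<open>First passage over the sample size\<close>

text \<open>The limit suggests that the level is reached when n d is about ln Q / t, that is N about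
  c / d. \<open>mono\<close> transfers the limits at a / n N to the given d, with a slightly above
  or below ln Q / t. To bound the infimum it is enough that one N near (1 + e) c / d belongs to the
  set and that every member is at least (1 - e) c / d.\<close>

lemma first_passage_asymptotics:
  fixes R :: "nat \<Rightarrow> real \<Rightarrow> real" and n :: "nat \<Rightarrow> nat" and Q t \<kappa> :: real
  assumes mono: "\<And>N d d'. 2 \<le> N \<Longrightarrow> d \<le> d' \<Longrightarrow> R N d \<le> R N d'"
    and small: "\<And>N. 2 \<le> N \<Longrightarrow> eventually (\<lambda>d. R N d < Q) (at_right 0)"
    and lim: "\<And>a. 0 < a \<Longrightarrow> (\<lambda>N. R N (a / real (n N))) \<longlonglongrightarrow> exp (t * a)"
    and n_pos: "\<And>N. 2 \<le> N \<Longrightarrow> 0 < n N" and n_lim: "(\<lambda>N. real (n N) / real N) \<longlonglongrightarrow> \<kappa>"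
    and "0 < \<kappa>" "1 < Q" "0 < t"
  shows "(\<lambda>d. real (Inf {N. 2 \<le> N \<and> Q \<le> R N d})) \<sim>[at_right 0] (\<lambda>d. 1 / d * (ln Q / (\<kappa> * t)))"
proof (rule asymp_equivI')
  define c where "c = ln Q / (\<kappa> * t)"
  have c: "0 < c" using assms by (simp add: c_def)
  have exp_Q: "exp (t * (u * (ln Q / t))) = exp (u * ln Q)" for u using \<open>0 < t\<close> by simp
  show "((\<lambda>d. real (Inf {N. 2 \<le> N \<and> Q \<le> R N d}) / (1 / d * (ln Q / (\<kappa> * t)))) \<longlongrightarrow> 1) (at_right 0)"
    unfolding c_def[symmetric]
  proof (rule tendstoI)
    fix e0 :: real assume "0 < e0"
    define e where "e = min (1/2) (e0 / 2)"
    have e: "0 < e" "e \<le> 1/2" "e < e0" using \<open>0 < e0\<close> by (auto simp: e_def)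
    define a1 where "a1 = (1 + e / 2) * (ln Q / t)"
    define a2 where "a2 = (1 - e / 2) * (ln Q / t)"
    have lnQ: "0 < ln Q" using \<open>1 < Q\<close> by simp
    have a: "0 < a1" "0 < a2" using e lnQ \<open>0 < t\<close> by (auto simp: a1_def a2_def)
    have "ln Q < (1 + e / 2) * ln Q" "(1 - e / 2) * ln Q < ln Q" using lnQ e by auto
    then have "exp (ln Q) < exp ((1 + e / 2) * ln Q)" "exp ((1 - e / 2) * ln Q) < exp (ln Q)" by (simp_all only: exp_less_cancel_iff)
    then have Qa: "Q < exp (t * a1)" "exp (t * a2) < Q"
      unfolding a1_def a2_def exp_Q using \<open>1 < Q\<close> by simp_all
    \<comment> \<open>The tolerances for n N / N. They turn N \<ge> (1 + 3e/4) c / d into n N \<ge>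
      a1 / d, and N < (1 - e) c / d into n N \<le> a2 / d.\<close>
    define \<theta>1 where "\<theta>1 = (1 + e / 2) / (1 + 3 * e / 4)"
    define \<theta>2 where "\<theta>2 = (1 - e / 2) / (1 - e)"
    have \<theta>: "\<kappa> * \<theta>1 < \<kappa>" "\<kappa> < \<kappa> * \<theta>2" "0 < \<theta>1" using e \<open>0 < \<kappa>\<close> by (auto simp: \<theta>1_def \<theta>2_def field_simps)
    have "eventually (\<lambda>N. Q < R N (a1 / real (n N)) \<and> R N (a2 / real (n N)) < Q \<and>
        \<kappa> * \<theta>1 < real (n N) / real N \<and> real (n N) / real N < \<kappa> * \<theta>2) sequentially"
      using order_tendstoD(1)[OF lim[OF a(1)] Qa(1)] order_tendstoD(2)[OF lim[OF a(2)] Qa(2)]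
        order_tendstoD(1)[OF n_lim \<theta>(1)] order_tendstoD(2)[OF n_lim \<theta>(2)]
      by eventually_elim auto
    then obtain N0 where N0: "\<And>N. N0 \<le> N \<Longrightarrow> Q < R N (a1 / real (n N)) \<and> R N (a2 / real (n N)) < Q \<and>
        \<kappa> * \<theta>1 < real (n N) / real N \<and> real (n N) / real N < \<kappa> * \<theta>2"
      by (auto simp: eventually_sequentially)
    have below: "eventually (\<lambda>d. d < v) (at_right 0)" if "0 < v" for v :: real
      by (rule order_tendstoD(2)[OF tendsto_ident_at that])
    \<comment> \<open>The limits say nothing about N below \<open>N0\<close>; these finitely many N
      leave the set once d is small.\<close>
    have "eventually (\<lambda>d. \<forall>N\<in>{2..<N0}. R N d < Q) (at_right 0)"
      using small by (intro eventually_ball_finite) auto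
    moreover have "eventually (\<lambda>d. d < e * c / 4) (at_right 0)" "eventually (\<lambda>d. d < c / real (N0 + 3)) (at_right 0)"
      using e c by (intro below; simp)+
    moreover have "eventually (\<lambda>d::real. 0 < d) (at_right 0)" by (rule eventually_at_right_less)
    ultimately show "eventually (\<lambda>d. dist (real (Inf {N. 2 \<le> N \<and> Q \<le> R N d}) / (1 / d * c)) 1 < e0) (at_right 0)"
    proof eventually_elim
      case (elim d)
      let ?S = "{N. 2 \<le> N \<and> Q \<le> R N d}"
      \<comment> \<open>Rounding loses at most 1 \<le> e c / (4 d), so \<open>K\<close> is still at
        least (1 + 3e/4) c / d. Membership of \<open>K\<close> also shows that the infimum is
        attained and is not the default value of an empty set.\<close>
      define K where "K = nat \<lfloor>(1 + e) * c / d\<rfloor>"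
      have d: "0 < d" using elim by simp
      have pos: "0 \<le> (1 + e) * c / d" using e c d by simp
      have K_le: "real K \<le> (1 + e) * c / d" using pos by (simp add: K_def)
      have "(1 + e) * c / d - 1 < real K" using pos by (simp add: K_def)
      moreover have "1 \<le> e * c / (4 * d)" using elim d by (simp add: field_simps)
      moreover have "(1 + e) * c / d - e * c / (4 * d) = (1 + 3 * e / 4) * c / d" using d by (simp add: field_simps)
      ultimately have K_ge: "(1 + 3 * e / 4) * c / d \<le> real K" by linarith
      have "real (N0 + 3) < c / d" using elim d by (simp add: field_simps del: of_nat_add)
      also have "c / d \<le> (1 + 3 * e / 4) * c / d" using e c d by (intro divide_right_mono) auto
      finally have K_big: "N0 + 3 \<le> K" using K_ge by linarith
      have "Q \<le> R K d"
      proof -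
        have "\<kappa> * \<theta>1 * real K \<le> real (n K)" using N0[of K] K_big by (simp add: pos_less_divide_eq)
        moreover have "\<kappa> * \<theta>1 * ((1 + 3 * e / 4) * c / d) \<le> \<kappa> * \<theta>1 * real K" using K_ge \<theta> \<open>0 < \<kappa>\<close> by (intro mult_left_mono) auto
        moreover have "\<kappa> * \<theta>1 * ((1 + 3 * e / 4) * c / d) = a1 / d"
        proof -
          have "\<theta>1 * (1 + 3 * e / 4) = 1 + e / 2" using e by (simp add: \<theta>1_def)
          then have "\<kappa> * \<theta>1 * ((1 + 3 * e / 4) * c / d) = \<kappa> * (1 + e / 2) * c / d" by (metis mult.assoc times_divide_eq_right)
          also have "\<dots> = a1 / d" using \<open>0 < \<kappa>\<close> by (simp add: a1_def c_def)
          finally show ?thesis .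
        qed
        ultimately have "a1 / d \<le> real (n K)" by linarith
        then have "a1 / real (n K) \<le> d" using d n_pos[of K] K_big by (simp add: field_simps)
        then show ?thesis using mono[of K "a1 / real (n K)" d] N0[of K] K_big by simp
      qed
      then have K_in: "K \<in> ?S" using K_big by simp
      have "Inf ?S \<in> ?S" using K_in by (intro Inf_nat_def1) auto
      moreover have "Inf ?S \<le> K" using K_in by (rule cInf_lower) simp
      moreover have "(1 - e) * c / d \<le> real N" if N: "N \<in> ?S" for N
      proof (rule ccontr)
        assume "\<not> (1 - e) * c / d \<le> real N"
        then have N_lt: "real N < (1 - e) * c / d" by simp
        have "N0 \<le> N" using N elim(1) by force
        then have "R N (a2 / real (n N)) < Q" "real (n N) \<le> \<kappa> * \<theta>2 * real N"
          using N0[of N] N by (auto simp: pos_divide_less_eq)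
        moreover have "\<kappa> * \<theta>2 * real N \<le> \<kappa> * \<theta>2 * ((1 - e) * c / d)"
          using N_lt \<theta> \<open>0 < \<kappa>\<close> by (intro mult_left_mono) auto
        moreover have "\<kappa> * \<theta>2 * ((1 - e) * c / d) = a2 / d"
        proof -
          have "\<theta>2 * (1 - e) = 1 - e / 2" using e by (simp add: \<theta>2_def)
          then have "\<kappa> * \<theta>2 * ((1 - e) * c / d) = \<kappa> * (1 - e / 2) * c / d" by (metis mult.assoc times_divide_eq_right)
          also have "\<dots> = a2 / d" using \<open>0 < \<kappa>\<close> by (simp add: a2_def c_def)
          finally show ?thesis .
        qed
        ultimately have "real (n N) \<le> a2 / d" by linarith
        then have "d \<le> a2 / real (n N)" using d n_pos[of N] N by (simp add: field_simps)
        then have "R N d \<le> R N (a2 / real (n N))" using N by (intro mono) auto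
        then show False using N \<open>R N (a2 / real (n N)) < Q\<close> by simp
      qed
      ultimately have I: "(1 - e) * c / d \<le> real (Inf ?S)" "real (Inf ?S) \<le> (1 + e) * c / d"
        using K_le by (blast, linarith)
      have "real (Inf ?S) / (1 / d * c) = real (Inf ?S) * d / c" using d by simp
      moreover have "1 - e \<le> real (Inf ?S) * d / c" "real (Inf ?S) * d / c \<le> 1 + e"
        using I c d by (simp_all add: field_simps)
      ultimately show ?case using e by (simp add: dist_real_def abs_less_iff)
    qed
  qed
qed

section \<open>Reduction of the samples to the two-sample setting\<close>

lemma exp_square_transform:
  fixes f :: "real \<Rightarrow> real"
  defines "F \<equiv> density lborel (\<lambda>x. ennreal (f x))" and "G \<equiv> \<lambda>x. diff_density f x * indicator {0<..} x"
  assumes F: "prob_space F" and [measurable]: "f \<in> borel_measurable borel" and f: "\<And>x. 0 \<le> f x"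
    and int: "\<And>t. 0 < t \<Longrightarrow> integrable lborel (\<lambda>x. f x * f (x + t))"
  shows "integrable lborel G" and "\<And>x. 0 \<le> G x"
    and "0 \<le> \<theta> \<Longrightarrow> (LINT x|distr (F \<Otimes>\<^sub>M F) borel (\<lambda>p. (fst p - snd p)\<^sup>2 / 2). exp (- \<theta> * x)) = 2 * gauss_trans G \<theta>"
proof -
  interpret F: prob_space F by (rule F)
  interpret FF: pair_prob_space F F ..
  have [simp]: "sets F = sets borel" "space F = UNIV" by (auto simp: F_def)
  have [measurable]: "G \<in> borel_measurable borel" unfolding G_def by measurable
  have dd: "0 \<le> diff_density f x" for x unfolding diff_density_def using f by simp
  then show G: "0 \<le> G x" for x by (simp add: G_def)
  have main: "(\<integral>\<^sup>+p. ennreal (exp (- \<theta> * ((fst p - snd p)\<^sup>2 / 2))) \<partial>(F \<Otimes>\<^sub>M F))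
      = 2 * (\<integral>\<^sup>+x. ennreal (G x * exp (- \<theta> * x\<^sup>2 / 2)) \<partial>lborel)" for \<theta>
  proof -
    have "(\<integral>\<^sup>+p. ennreal (exp (- \<theta> * ((fst p - snd p)\<^sup>2 / 2))) \<partial>(F \<Otimes>\<^sub>M F))
        = (\<integral>\<^sup>+x. \<integral>\<^sup>+y. ennreal (exp (- \<theta> * (x - y)\<^sup>2 / 2)) \<partial>F \<partial>F)"
      by (subst F.nn_integral_fst[symmetric]) (auto simp: cong: measurable_cong_sets sets_pair_measure_cong)
    also have "\<dots> = 2 * (\<integral>\<^sup>+t. ennreal (exp (- \<theta> * t\<^sup>2 / 2)) * ennreal (diff_density f t * indicator {0<..} t) \<partial>lborel)"
      unfolding F_def by (rule nn_integral_difference[OF _ f int]) (auto simp: power2_commute)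
    also have "(\<integral>\<^sup>+t. ennreal (exp (- \<theta> * t\<^sup>2 / 2)) * ennreal (diff_density f t * indicator {0<..} t) \<partial>lborel)
        = (\<integral>\<^sup>+x. ennreal (G x * exp (- \<theta> * x\<^sup>2 / 2)) \<partial>lborel)"
      using dd by (intro nn_integral_cong) (simp add: G_def ennreal_mult mult.commute)
    finally show ?thesis .
  qed
  \<comment> \<open>At \<theta> = 0 the identity \<open>main\<close> is the total mass: half of the
    law of the difference lies on the positive half-line, which yields integrability.\<close>
  have "2 * (\<integral>\<^sup>+x. ennreal (G x) \<partial>lborel) = 1"
    using main[of 0] FF.emeasure_space_1 by simp
  then have "(\<integral>\<^sup>+x. ennreal (G x) \<partial>lborel) \<noteq> \<infinity>" by auto
  then show iG: "integrable lborel G" using G by (intro integrableI_nonneg) (auto simp: less_top)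
  assume \<theta>: "0 \<le> \<theta>"
  have "integrable lborel (\<lambda>x. G x * exp (- \<theta> * x\<^sup>2 / 2))"
  proof (rule Bochner_Integration.integrable_bound[OF iG])
    have "G x * exp (- \<theta> * x\<^sup>2 / 2) \<le> G x" for x using G[of x] \<theta> by (intro mult_left_le) auto
    then show "AE x in lborel. norm (G x * exp (- \<theta> * x\<^sup>2 / 2)) \<le> norm (G x)" using G by (intro AE_I2) (simp add: abs_mult)
  qed measurable
  then have "(\<integral>\<^sup>+x. ennreal (G x * exp (- \<theta> * x\<^sup>2 / 2)) \<partial>lborel) = ennreal (gauss_trans G \<theta>)"
    unfolding gauss_trans_def using G by (intro nn_integral_eq_integral) auto
  moreover have "0 \<le> gauss_trans G \<theta>" unfolding gauss_trans_def using G by simp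
  ultimately have "(\<integral>\<^sup>+p. ennreal (exp (- \<theta> * ((fst p - snd p)\<^sup>2 / 2))) \<partial>(F \<Otimes>\<^sub>M F)) = ennreal (2 * gauss_trans G \<theta>)"
    unfolding main by (simp add: ennreal_mult)
  then have "(LINT p|(F \<Otimes>\<^sub>M F). exp (- \<theta> * ((fst p - snd p)\<^sup>2 / 2))) = 2 * gauss_trans G \<theta>"
    using \<open>0 \<le> gauss_trans G \<theta>\<close>
    by (subst integral_eq_nn_integral) (auto cong: measurable_cong_sets sets_pair_measure_cong)
  then show "(LINT x|distr (F \<Otimes>\<^sub>M F) borel (\<lambda>p. (fst p - snd p)\<^sup>2 / 2). exp (- \<theta> * x)) = 2 * gauss_trans G \<theta>"
    by (subst integral_distr) (auto cong: measurable_cong_sets sets_pair_measure_cong)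
qed

lemma density_no_atoms: "f \<in> borel_measurable borel \<Longrightarrow> measure (density lborel (\<lambda>x. ennreal (f x))) {x} = 0" for x :: real
  by (simp add: measure_def emeasure_density nn_integral_null_set)

text \<open>The unbiased variance estimate from a single pair; \<open>pair_sd\<close> is the square
  root of the average of these.\<close>

definition half_sq_diff :: "(nat \<Rightarrow> 'a \<Rightarrow> real) \<Rightarrow> nat \<Rightarrow> 'a \<Rightarrow> real" where
  "half_sq_diff Y k \<omega> = (Y (2 * k - 1) \<omega> - Y (2 * k) \<omega>)\<^sup>2 / 2"

text \<open>Functions of disjoint blocks of a jointly independent family are independent. The blocks
  are the singletons for \<open>X\<close>, the consecutive pairs for \<open>Y\<close>, and finally
  all of the X-indices against all of the Y-indices.\<close>

lemma iid_samples_split: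
  assumes M: "prob_space M" and iid: "iid_samples M F X Y"
  shows "iid_sequence M X F"
    and "iid_sequence M (half_sq_diff Y) (distr (F \<Otimes>\<^sub>M F) borel (\<lambda>p. (fst p - snd p)\<^sup>2 / 2))"
    and "prob_space.indep_var M borel (\<lambda>\<omega>. \<Sum>k=1..i. X k \<omega>) borel (\<lambda>\<omega>. \<Sum>k=1..j. half_sq_diff Y k \<omega>)"
proof -
  interpret prob_space M by (rule M)
  let ?I = "{1..} <+> {1..} :: (nat + nat) set"
  have ind: "indep_vars (\<lambda>_. borel) (case_sum X Y) ?I"
    and law: "\<And>k. 1 \<le> k \<Longrightarrow> distr M borel (X k) = F" "\<And>k. 1 \<le> k \<Longrightarrow> distr M borel (Y k) = F"
    using iid by (auto simp: iid_samples_def)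
  have Xm: "X k \<in> borel_measurable M" and Ym: "Y k \<in> borel_measurable M" if "1 \<le> k" for k
    using ind that by (auto simp: indep_vars_def split: sum.splits)
  have "indep_vars (\<lambda>j. PiM {Inl j} (\<lambda>_. borel)) (\<lambda>j \<omega>. restrict (\<lambda>i. case_sum X Y i \<omega>) {Inl j}) {1..}"
    by (rule indep_vars_restrict[OF ind]) (auto simp: disjoint_family_on_def)
  then have "indep_vars (\<lambda>_. borel) (\<lambda>j \<omega>. restrict (\<lambda>i. case_sum X Y i \<omega>) {Inl j} (Inl j)) {1..}"
    by (rule indep_vars_compose2[where Y = "\<lambda>j g. g (Inl j)"]) measurable
  then have indX: "indep_vars (\<lambda>_. borel) X {1..}" by simp
  then show "iid_sequence M X F" using M law by (simp add: iid_sequence_def iid_sequence_axioms_def)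
  let ?K = "\<lambda>j. {Inr (2 * j - 1), Inr (2 * j)} :: (nat + nat) set"
  have "indep_vars (\<lambda>j. PiM (?K j) (\<lambda>_. borel)) (\<lambda>j \<omega>. restrict (\<lambda>i. case_sum X Y i \<omega>) (?K j)) {1..}"
  proof (rule indep_vars_restrict[OF ind])
    show "disjoint_family_on ?K {1..}" unfolding disjoint_family_on_def by (auto; presburger)
  qed auto
  then have "indep_vars (\<lambda>_. borel) (\<lambda>j \<omega>. (restrict (\<lambda>i. case_sum X Y i \<omega>) (?K j) (Inr (2 * j - 1)) - restrict (\<lambda>i. case_sum X Y i \<omega>) (?K j) (Inr (2 * j)))\<^sup>2 / 2) {1..}"
    by (rule indep_vars_compose2[where Y = "\<lambda>j g. (g (Inr (2 * j - 1)) - g (Inr (2 * j)))\<^sup>2 / 2"]) measurable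
  then have indW: "indep_vars (\<lambda>_. borel) (half_sq_diff Y) {1..}"
    by (simp add: half_sq_diff_def[abs_def])
  have "distr M borel (half_sq_diff Y k) = distr (F \<Otimes>\<^sub>M F) borel (\<lambda>p. (fst p - snd p)\<^sup>2 / 2)" if k: "1 \<le> k" for k
  proof -
    have "indep_var (PiM {Inr (2 * k - 1)} (\<lambda>_. borel)) (\<lambda>\<omega>. restrict (\<lambda>i. case_sum X Y i \<omega>) {Inr (2 * k - 1)})
        (PiM {Inr (2 * k)} (\<lambda>_. borel)) (\<lambda>\<omega>. restrict (\<lambda>i. case_sum X Y i \<omega>) {Inr (2 * k)})"
      using k by (intro indep_var_restrict[OF ind]) auto
    then have "indep_var borel ((\<lambda>g. g (Inr (2 * k - 1))) \<circ> (\<lambda>\<omega>. restrict (\<lambda>i. case_sum X Y i \<omega>) {Inr (2 * k - 1)}))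
        borel ((\<lambda>g. g (Inr (2 * k))) \<circ> (\<lambda>\<omega>. restrict (\<lambda>i. case_sum X Y i \<omega>) {Inr (2 * k)}))"
      by (rule indep_var_compose) measurable
    then have "indep_var borel (Y (2 * k - 1)) borel (Y (2 * k))" by (simp add: comp_def)
    then have FF: "F \<Otimes>\<^sub>M F = distr M (borel \<Otimes>\<^sub>M borel) (\<lambda>\<omega>. (Y (2 * k - 1) \<omega>, Y (2 * k) \<omega>))"
      using law(2)[of "2 * k - 1"] law(2)[of "2 * k"] k by (simp add: indep_var_distribution_eq)
    show ?thesis unfolding FF using Ym[of "2 * k - 1"] Ym[of "2 * k"] k
      by (subst distr_distr) (auto simp: comp_def half_sq_diff_def[abs_def])
  qed
  then show "iid_sequence M (half_sq_diff Y) (distr (F \<Otimes>\<^sub>M F) borel (\<lambda>p. (fst p - snd p)\<^sup>2 / 2))"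
    using M indW by (simp add: iid_sequence_def iid_sequence_axioms_def)
  let ?A = "Inl ` {1..i} :: (nat + nat) set" and ?B = "Inr ` {1..2 * j} :: (nat + nat) set"
  have "indep_var (PiM ?A (\<lambda>_. borel)) (\<lambda>\<omega>. restrict (\<lambda>i. case_sum X Y i \<omega>) ?A)
      (PiM ?B (\<lambda>_. borel)) (\<lambda>\<omega>. restrict (\<lambda>i. case_sum X Y i \<omega>) ?B)"
    by (intro indep_var_restrict[OF ind]) auto
  then have "indep_var borel ((\<lambda>g. \<Sum>k=1..i. g (Inl k)) \<circ> (\<lambda>\<omega>. restrict (\<lambda>i. case_sum X Y i \<omega>) ?A))
      borel ((\<lambda>g. \<Sum>k=1..j. (g (Inr (2 * k - 1)) - g (Inr (2 * k)))\<^sup>2 / 2) \<circ> (\<lambda>\<omega>. restrict (\<lambda>i. case_sum X Y i \<omega>) ?B))"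
  proof (rule indep_var_compose)
    show "(\<lambda>g. \<Sum>k=1..i. g (Inl k)) \<in> PiM ?A (\<lambda>_. borel) \<rightarrow>\<^sub>M (borel :: real measure)"
      by (intro borel_measurable_sum measurable_component_singleton) auto
    show "(\<lambda>g. \<Sum>k=1..j. (g (Inr (2 * k - 1)) - g (Inr (2 * k)))\<^sup>2 / 2) \<in> PiM ?B (\<lambda>_. borel) \<rightarrow>\<^sub>M (borel :: real measure)"
      by (intro borel_measurable_sum borel_measurable_divide borel_measurable_power borel_measurable_diff measurable_component_singleton imageI) auto
  qed
  moreover have "(\<lambda>g. \<Sum>k=1..i. g (Inl k)) \<circ> (\<lambda>\<omega>. restrict (\<lambda>i. case_sum X Y i \<omega>) ?A) = (\<lambda>\<omega>. \<Sum>k=1..i. X k \<omega>)"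
    by (auto simp: fun_eq_iff intro!: sum.cong)
  moreover have "(\<lambda>g. \<Sum>k=1..j. (g (Inr (2 * k - 1)) - g (Inr (2 * k)))\<^sup>2 / 2) \<circ> (\<lambda>\<omega>. restrict (\<lambda>i. case_sum X Y i \<omega>) ?B)
      = (\<lambda>\<omega>. \<Sum>k=1..j. half_sq_diff Y k \<omega>)"
  proof (unfold fun_eq_iff comp_def half_sq_diff_def, intro allI sum.cong refl)
    fix \<omega> k assume "k \<in> {1..j}"
    then have "Inr (2 * k - 1) \<in> ?B" "Inr (2 * k) \<in> ?B" by (auto intro!: imageI)
    then show "(restrict (\<lambda>i. case_sum X Y i \<omega>) ?B (Inr (2 * k - 1)) - restrict (\<lambda>i. case_sum X Y i \<omega>) ?B (Inr (2 * k)))\<^sup>2 / 2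
        = (Y (2 * k - 1) \<omega> - Y (2 * k) \<omega>)\<^sup>2 / 2"
      by (simp only: restrict_apply' sum.case)
  qed
  ultimately show "indep_var borel (\<lambda>\<omega>. \<Sum>k=1..i. X k \<omega>) borel (\<lambda>\<omega>. \<Sum>k=1..j. half_sq_diff Y k \<omega>)" by simp
qed

text \<open>The rejection condition is closed, so the events decrease to the one at 0 as d decreases
  to 0. This is what keeps a fixed N from attaining the level for arbitrarily small d.\<close>

lemma rejection_prob_right_continuous:
  fixes X Y :: "nat \<Rightarrow> 'a \<Rightarrow> real"
  assumes "prob_space M" and [measurable]: "sample_mean X n \<in> borel_measurable M" "pair_sd Y m \<in> borel_measurable M"
    and "rejection_prob M X Y m n z 0 < c"
  shows "eventually (\<lambda>d. rejection_prob M X Y m n z d < c) (at_right 0)"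
proof -
  interpret prob_space M by fact
  define A where "A d = {\<omega> \<in> space M. z * pair_sd Y m \<omega> \<le> sample_mean X n \<omega> + d}" for d
  have rp: "rejection_prob M X Y m n z d = prob (A d)" for d by (simp add: rejection_prob_def A_def)
  have [measurable]: "A d \<in> events" for d unfolding A_def by measurable
  have A_mono: "A d \<subseteq> A d'" if "d \<le> d'" for d d'
    using that by (auto simp: A_def)
  then have mono: "prob (A d) \<le> prob (A d')" if "d \<le> d'" for d d'
    using that by (intro finite_measure_mono) auto
  have "(\<lambda>i. prob (A (1 / real (Suc i)))) \<longlonglongrightarrow> prob (\<Inter>i. A (1 / real (Suc i)))"
  proof (rule finite_Lim_measure_decseq)
    show "decseq (\<lambda>i. A (1 / real (Suc i)))"
      unfolding decseq_def by (intro allI impI A_mono divide_left_mono) auto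
  qed auto
  moreover have "(\<Inter>i. A (1 / real (Suc i))) = A 0"
  proof safe
    fix \<omega> assume \<omega>: "\<omega> \<in> (\<Inter>i. A (1 / real (Suc i)))"
    have "z * pair_sd Y m \<omega> - sample_mean X n \<omega> \<le> 1 / real (Suc i)" for i
      using \<omega> by (auto simp: A_def algebra_simps simp del: of_nat_Suc dest!: INT_D[of _ _ _ i])
    moreover have "(\<lambda>i. 1 / real (Suc i)) \<longlonglongrightarrow> 0" using LIMSEQ_inverse_real_of_nat by (simp add: divide_inverse)
    ultimately have "z * pair_sd Y m \<omega> - sample_mean X n \<omega> \<le> 0" by (meson LIMSEQ_le_const)
    then show "\<omega> \<in> A 0" using \<omega> by (auto simp: A_def)
  next
    fix \<omega> and i :: nat assume "\<omega> \<in> A 0"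
    moreover have "A 0 \<subseteq> A (1 / real (Suc i))" by (rule A_mono) simp
    ultimately show "\<omega> \<in> A (1 / real (Suc i))" by blast
  qed
  ultimately have "(\<lambda>i. prob (A (1 / real (Suc i)))) \<longlonglongrightarrow> prob (A 0)" by simp
  then have "eventually (\<lambda>i. prob (A (1 / real (Suc i))) < c) sequentially"
    using assms(4) unfolding rp by (rule order_tendstoD(2))
  then obtain i where i: "prob (A (1 / real (Suc i))) < c" by (auto simp: eventually_sequentially)
  have "eventually (\<lambda>d. d < 1 / real (Suc i)) (at_right 0)"
    by (rule order_tendstoD(2)[OF tendsto_ident_at]) simp
  then show ?thesis unfolding rp
    by eventually_elim (use i mono in \<open>meson less_imp_le le_less_trans\<close>)
qed

text \<open>Clearing a positive denominator. If the rejection probability under the null vanishes,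
  the quotient is 0 by convention on both sides, and the equivalence persists.\<close>

lemma alpha_star_le_iff:
  assumes "\<alpha> \<in> {0<..<1}" "p \<in> {0<..<1}"
  shows "alpha_star M X Y p m n z d \<le> \<alpha> \<longleftrightarrow>
    ((1 - \<alpha>) * (1 - p)) / (\<alpha> * p) \<le> rejection_prob M X Y m n z d / rejection_prob M X Y m n z 0"
proof -
  define q where "q = rejection_prob M X Y m n z d / rejection_prob M X Y m n z 0"
  have q: "0 \<le> q" by (simp add: q_def rejection_prob_def)
  have D: "0 < 1 - p + p * q" using assms q by (intro add_pos_nonneg) auto
  have "alpha_star M X Y p m n z d \<le> \<alpha> \<longleftrightarrow> 1 - p \<le> \<alpha> * (1 - p + p * q)"
    unfolding alpha_star_def q_def[symmetric] using D by (simp add: inverse_eq_divide pos_divide_le_eq)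
  also have "\<dots> \<longleftrightarrow> (1 - \<alpha>) * (1 - p) \<le> q * (\<alpha> * p)" by (simp add: algebra_simps)
  also have "\<dots> \<longleftrightarrow> ((1 - \<alpha>) * (1 - p)) / (\<alpha> * p) \<le> q" using assms by (simp add: pos_divide_le_eq)
  finally show ?thesis unfolding q_def .
qed

theorem theorem4p1:
  fixes M :: "'a measure" and F :: "real measure" and f :: "real \<Rightarrow> real"
    and X Y :: "nat \<Rightarrow> 'a \<Rightarrow> real" and \<zeta> :: "real \<Rightarrow> real"
    and lam C \<alpha> p \<rho> Q :: real and m n :: "nat \<Rightarrow> nat"
  assumes "prob_space M" and "prob_space F"
    and "f \<in> borel_measurable borel" and "\<And>x. 0 \<le> f x"
    and "F = density lborel (\<lambda>x. ennreal (f x))"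
    and "iid_samples M F X Y"
    and "integrable F (\<lambda>x. x)" and "(LINT x|F. x) = 0"
    and "integrable F (\<lambda>x. x\<^sup>2)"
    and "0 \<in> interior (cgf_dom F)"
    and "filterlim (cgf F) at_top (at_sup_cgf_dom F)"
    \<comment> \<open>finiteness of \<open>diff_density f t\<close>; a divergent integral would have value 0\<close>
    and "\<And>t. 0 < t \<Longrightarrow> integrable lborel (\<lambda>x. f x * f (x + t))"
    and "\<And>\<epsilon>. 0 < \<epsilon> \<Longrightarrow> continuous_on {\<epsilon><..} (diff_density f) \<and> bounded (diff_density f ` {\<epsilon><..})"
    and "-1 < lam"
    and "\<And>x. 0 \<le> x \<Longrightarrow> 0 \<le> \<zeta> x" and "mono_on {0..} \<zeta>" and "slowly_varying \<zeta>"
    and "0 < C"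
    and "((\<lambda>x. diff_density f x / (x powr lam * \<zeta> (1 / x))) \<longlongrightarrow> C) (at_right 0)"
    and "\<alpha> \<in> {0<..<1}" and "p \<in> {0<..<1}"
    and "Q = ((1 - \<alpha>) * (1 - p)) / (\<alpha> * p)" and "1 < Q"
    and "\<And>N. 2 \<le> N \<Longrightarrow> 0 < m N \<and> 0 < n N \<and> m N + n N = N"
    and "\<rho> \<in> {0<..<1}" and "(\<lambda>N. real (m N) / real N) \<longlonglongrightarrow> \<rho>"
  shows "\<exists>t\<^sub>0. t\<^sub>0 > 0 \<and> t\<^sub>0 \<in> cgf_dom F \<and> t\<^sub>0 * deriv (cgf F) t\<^sub>0 = (1 + lam) * \<rho> / (1 - \<rho>) \<and>
    (\<forall>t. t > 0 \<and> t \<in> cgf_dom F \<and> t * deriv (cgf F) t = (1 + lam) * \<rho> / (1 - \<rho>) \<longrightarrow> t = t\<^sub>0) \<and>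
    (\<exists>zbar :: nat \<Rightarrow> real. filterlim zbar at_top sequentially \<and>
      (\<forall>z :: nat \<Rightarrow> real. filterlim z at_top sequentially \<and> (\<forall>N\<ge>2. z N \<le> zbar N) \<longrightarrow>
        (\<lambda>d. real (N_star M X Y \<alpha> p m n z d))
          \<sim>[at_right 0] (\<lambda>d. 1 / d * (ln Q / ((1 - \<rho>) * t\<^sub>0)))))"
proof -
  note M = assms(1) and f = assms(3,4) and F_eq = assms(5) and iid = assms(6)
  note mn = assms(24) and \<rho> = assms(25) and m_lim = assms(26)
  \<comment> \<open>Half of lam + 1, because the Laplace transform is that of a squared
    variable.\<close>
  define b where "b = (1 + lam) / 2"
  define r where "r = \<rho> / (1 - \<rho>)"
  define c where "c = (1 + lam) * \<rho> / (1 - \<rho>)"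
  have b: "0 < b" and r: "0 < r" and c: "0 < c"
    using \<open>-1 < lam\<close> \<rho> by (auto simp: b_def r_def c_def)
  have "2 * b = 1 + lam" by (simp add: b_def)
  then have c_eq: "c = 2 * b * r" by (simp add: r_def c_def)
  interpret prob_space M by (rule M)
  interpret X: iid_sequence M X F by (rule iid_samples_split(1)[OF M iid])
  define G where "G = distr (F \<Otimes>\<^sub>M F) borel (\<lambda>p. (fst p - snd p)\<^sup>2 / 2)"
  interpret W: iid_sequence M "half_sq_diff Y" G
    unfolding G_def by (rule iid_samples_split(2)[OF M iid])
  have no_atoms: "measure F {x} = 0" for x unfolding F_eq by (rule density_no_atoms[OF f(1)])
  obtain t where t: "t > 0" "t \<in> cgf_dom F" "t * deriv (cgf F) t = c"
    and uniq: "\<And>s. s > 0 \<Longrightarrow> s \<in> cgf_dom F \<Longrightarrow> s * deriv (cgf F) s = c \<Longrightarrow> s = t"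
    using X.F.cgf_saddle_point_ex1[OF assms(11) assms(10) no_atoms c] by metis
  have t_int: "t \<in> interior (cgf_dom F)" by (rule X.F.positive_cgf_dom_interior[OF assms(11) t(2,1)])
  note g = regular_variation_at_zero[OF assms(15) assms(17) assms(18) assms(19)]
  have g_pos: "eventually (\<lambda>x. 0 < diff_density f x) (at_right 0)"
    and g_rv: "0 < k \<Longrightarrow> ((\<lambda>x. diff_density f (k * x) / diff_density f x) \<longlongrightarrow> k powr lam) (at_right 0)" for k
    using g by auto
  have laplace: "((\<lambda>\<theta>. (LINT x|G. exp (- (k * \<theta>) * x)) / (LINT x|G. exp (- \<theta> * x))) \<longlongrightarrow> k powr (- b)) at_top" if "0 < k" for k
  proof -
    define H where "H x = diff_density f x * indicator {0<..} x" for x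
    have H: "integrable lborel H" "\<And>x. 0 \<le> H x"
      and tr: "\<And>\<theta>. 0 \<le> \<theta> \<Longrightarrow> (LINT x|G. exp (- \<theta> * x)) = 2 * gauss_trans H \<theta>"
      using exp_square_transform[OF assms(2)[unfolded F_eq] f assms(12)] unfolding H_def[abs_def] G_def F_eq by auto
    have pos: "eventually (\<lambda>x::real. 0 < x) (at_right 0)" by (rule eventually_at_right_less)
    have "((\<lambda>\<theta>. gauss_trans H (k * \<theta>) / gauss_trans H \<theta>) \<longlongrightarrow> k powr (- ((1 + lam) / 2))) at_top"
    proof (rule gauss_trans_regular_variation[OF H _ _ _ \<open>0 < k\<close>])
      show "H x = 0" if "x \<le> 0" for x using that by (simp add: H_def)
      show "eventually (\<lambda>x. 0 < H x) (at_right 0)" using g_pos pos by eventually_elim (simp add: H_def)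
      fix j :: real assume j: "0 < j"
      have "eventually (\<lambda>x. diff_density f (j * x) / diff_density f x = H (j * x) / H x) (at_right 0)"
        using pos by eventually_elim (use j in \<open>simp add: H_def\<close>)
      with g_rv[OF j] show "((\<lambda>x. H (j * x) / H x) \<longlongrightarrow> j powr lam) (at_right 0)" by (rule Lim_transform_eventually)
    qed
    moreover have "eventually (\<lambda>\<theta>. gauss_trans H (k * \<theta>) / gauss_trans H \<theta>
        = (LINT x|G. exp (- (k * \<theta>) * x)) / (LINT x|G. exp (- \<theta> * x))) at_top"
      using eventually_ge_at_top[of 0]
    proof eventually_elim
      case (elim \<theta>)
      then have "0 \<le> k * \<theta>" using \<open>0 < k\<close> by simp
      then show ?case unfolding tr[OF elim] tr[OF \<open>0 \<le> k * \<theta>\<close>] by simp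
    qed
    ultimately show ?thesis unfolding b_def by (rule Lim_transform_eventually)
  qed
  have n_ratio: "(\<lambda>N. real (n N) / real N) \<longlonglongrightarrow> 1 - \<rho>"
  proof (rule Lim_transform_eventually)
    show "(\<lambda>N. 1 - real (m N) / real N) \<longlonglongrightarrow> 1 - \<rho>" by (intro tendsto_intros m_lim)
    show "eventually (\<lambda>N. 1 - real (m N) / real N = real (n N) / real N) sequentially"
      using eventually_ge_at_top[of 2]
    proof eventually_elim
      case (elim N)
      then have "real N = real (m N) + real (n N)" using mn[of N] by (metis of_nat_add)
      then show ?case using elim by (simp add: field_simps)
    qed
  qed
  have real_lim: "filterlim (\<lambda>N. real (k N)) at_top sequentially"
    if "(\<lambda>N. real (k N) / real N) \<longlonglongrightarrow> l" "0 < l" for k :: "nat \<Rightarrow> nat" and l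
  proof (rule filterlim_mono_eventually[OF _ order_refl order_refl])
    show "filterlim (\<lambda>N. real (k N) / real N * real N) at_top sequentially"
      by (rule filterlim_tendsto_pos_mult_at_top[OF that filterlim_real_sequentially])
    show "eventually (\<lambda>N. real (k N) / real N * real N = real (k N)) sequentially"
      using eventually_gt_at_top[of 0] by eventually_elim simp
  qed
  have nat_lim: "filterlim k at_top sequentially"
    if "(\<lambda>N. real (k N) / real N) \<longlonglongrightarrow> l" "0 < l" for k :: "nat \<Rightarrow> nat" and l
    using real_lim[OF that] by (simp add: filterlim_sequentially_iff_filterlim_real)
  have mn_ratio: "(\<lambda>N. real (m N) / real (n N)) \<longlonglongrightarrow> r"
  proof (rule Lim_transform_eventually)
    show "(\<lambda>N. (real (m N) / real N) / (real (n N) / real N)) \<longlonglongrightarrow> r"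
      unfolding r_def using \<rho> by (intro tendsto_divide m_lim n_ratio) auto
    show "eventually (\<lambda>N. (real (m N) / real N) / (real (n N) / real N) = real (m N) / real (n N)) sequentially"
      using eventually_gt_at_top[of 0] by eventually_elim simp
  qed
  \<comment> \<open>The witness for \<open>zbar\<close>: the asymptotics are proved next for an
    arbitrary z tending to infinity, so a concrete divergent sequence is chosen.\<close>
  have "filterlim (\<lambda>N. real N) at_top sequentially" by (rule filterlim_real_sequentially)
  moreover have "(\<lambda>d. real (N_star M X Y \<alpha> p m n z d)) \<sim>[at_right 0] (\<lambda>d. 1 / d * (ln Q / ((1 - \<rho>) * t)))"
    if z: "filterlim z at_top sequentially" for z
  proof -
    interpret TS: two_sample M X "half_sq_diff Y" F G b r t m n z
    proof unfold_locales
      show "indep_var borel (X.psum i) borel (W.psum j)" for i j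
        using iid_samples_split(3)[OF M iid, of i j] unfolding X.psum_def[abs_def] W.psum_def[abs_def] .
      show "0 \<le> half_sq_diff Y k \<omega>" for k \<omega> by (simp add: half_sq_diff_def)
      show "filterlim n at_top sequentially" "filterlim m at_top sequentially"
        using nat_lim[OF n_ratio] nat_lim[OF m_lim] \<rho> by auto
      show "t * deriv (cgf F) t = 2 * b * r" using t c_eq by simp
      fix a \<epsilon> :: real assume a\<epsilon>: "0 < a" "0 < \<epsilon>"
      show "\<exists>\<delta>>0. eventually (\<lambda>k. \<forall>y. \<bar>y - real k * deriv (cgf F) t\<bar> \<le> real k * \<delta> \<longrightarrow>
          exp (t * a - \<epsilon>) * X.tail k y \<le> X.tail k (y - a) \<and> X.tail k (y - a) \<le> exp (t * a + \<epsilon>) * X.tail k y) sequentially"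
        by (rule X.tail_shift[OF f F_eq t_int t(1) no_atoms g_pos a\<epsilon>]) blast
    qed (use b r t_int t z mn_ratio no_atoms laplace in auto)
    \<comment> \<open>Multiplying the inequality by n turns a shift d of the mean into a shift n d
      of the sum; the 1/2 in \<open>pair_sd\<close> is absorbed into the half squared
      differences.\<close>
    have rej: "rejection_prob M X Y (m N) (n N) (z N) d = TS.rej (real (n N) * d) N" if N: "2 \<le> N" for N d
    proof -
      have pos: "0 < real (m N)" "0 < real (n N)" using mn[OF N] by auto
      have sd: "z N * pair_sd Y (m N) \<omega> = TS.T N \<omega>" for \<omega>
        unfolding TS.T_def pair_sd_def W.psum_def half_sq_diff_def
        by (simp add: sum_divide_distrib[symmetric])
      have "z N * pair_sd Y (m N) \<omega> \<le> sample_mean X (n N) \<omega> + d \<longleftrightarrow> real (n N) * TS.T N \<omega> - real (n N) * d \<le> X.psum (n N) \<omega>" for \<omega>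
        unfolding sd sample_mean_def X.psum_def using pos by (simp add: field_simps)
      then show ?thesis unfolding rejection_prob_def TS.rej_def by simp
    qed
    define R where "R N d = rejection_prob M X Y (m N) (n N) (z N) d / rejection_prob M X Y (m N) (n N) (z N) 0" for N d
    have meas: "sample_mean X k \<in> borel_measurable M" "pair_sd Y k \<in> borel_measurable M" for k
    proof -
      have "sample_mean X k = (\<lambda>\<omega>. (1 / real k) * X.psum k \<omega>)" "pair_sd Y k = (\<lambda>\<omega>. sqrt (1 / real k * W.psum k \<omega>))"
        by (auto simp: fun_eq_iff sample_mean_def X.psum_def pair_sd_def W.psum_def half_sq_diff_def sum_divide_distrib[symmetric])
      then show "sample_mean X k \<in> borel_measurable M" "pair_sd Y k \<in> borel_measurable M" by simp_all
    qed
    have N_star: "N_star M X Y \<alpha> p m n z d = Inf {N. 2 \<le> N \<and> Q \<le> R N d}" for d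
      unfolding N_star_def R_def alpha_star_le_iff[OF assms(20,21)] assms(22) ..
    show ?thesis
      unfolding N_star
    proof (rule first_passage_asymptotics[where n = n])
      show "R N d \<le> R N d'" if "2 \<le> N" "d \<le> d'" for N d d'
        unfolding R_def rejection_prob_def using that(2) meas
        by (intro divide_right_mono finite_measure_mono) auto
      show "eventually (\<lambda>d. R N d < Q) (at_right 0)" if "2 \<le> N" for N
      \<comment> \<open>For small N the denominator may vanish; then \<open>R\<close> is 0 by
        convention and stays below Q. Otherwise \<open>R\<close> equals 1 < Q at d = 0 and right
        continuity applies.\<close>
      proof (cases "rejection_prob M X Y (m N) (n N) (z N) 0 = 0")
        case True
        then show ?thesis using \<open>1 < Q\<close> by (simp add: R_def)
      next
        case False
        then have pos: "0 < rejection_prob M X Y (m N) (n N) (z N) 0" by (simp add: rejection_prob_def zero_less_measure_iff)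
        then have "rejection_prob M X Y (m N) (n N) (z N) 0 < Q * rejection_prob M X Y (m N) (n N) (z N) 0" using \<open>1 < Q\<close> by simp
        from rejection_prob_right_continuous[OF M meas this]
        show ?thesis by eventually_elim (use pos in \<open>simp add: R_def pos_divide_less_eq\<close>)
      qed
      show "(\<lambda>N. R N (a / real (n N))) \<longlonglongrightarrow> exp (t * a)" if "0 < a" for a
      proof (rule Lim_transform_eventually[OF TS.rej_ratio[OF that]])
        show "eventually (\<lambda>N. TS.rej a N / TS.rej 0 N = R N (a / real (n N))) sequentially"
          using eventually_ge_at_top[of 2]
        proof eventually_elim
          case (elim N)
          then show ?case using mn[OF elim] unfolding R_def by (simp add: rej)
        qed
      qed
    qed (use mn n_ratio \<rho> \<open>1 < Q\<close> t in auto)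
  qed
  ultimately show ?thesis
    using t uniq unfolding c_def[symmetric] by blast
qed

end
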